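(* For every integer $n\ge1$, $$\operatorname{Ind}(Y_n)\simeq\begin{cases}\mathbb{S}^1, & n=1;\\ \mathbb{S}^3\vee\mathbb{S}^3\vee\mathbb{S}^3, & n=2;\\ \mathbb{S}^5\vee\mathbb{S}^5, & n=3;\\ \mathbb{S}^6\vee\mathbb{S}^6\vee\mathbb{S}^6, & n=4;\\ \Sigma^4\left(\operatorname{Ind}\left(H^2_{n-3}\right)\right)\vee\Sigma^6\left(\operatorname{Ind}\left(H^2_{n-4}\right)\right)\vee\Sigma^5\left(\operatorname{Ind}\left(Y_{n-3}\right)\right), & n\ge5.\end{cases}$$
   Context: For a finite simple graph $G$, $\operatorname{Ind}(G)$ is the simplicial complex on $V(G)$ whose faces are the independent sets of $G$. For $n\ge1$, $H^2_n=H_{1\times 2\times n}$ is the graph with vertex set $\{v^1_1,\dots,v^1_{2n+1}\}\sqcup\{v^2_1,\dots,v^2_{2n+2}\}\sqcup\{v^3_1,\dots,v^3_{2n+1}\}$ and edges: $\{v^1_r,v^1_{r+1}\}$ and $\{v^3_r,v^3_{r+1}\}$ for $1\le r\le 2n$; $\{v^2_s,v^2_{s+1}\}$ for $1\le s\le 2n+1$; and $\{v^1_{2t-1},v^2_{2t}\}$ and $\{v^2_{2t-1},v^3_{2t-1}\}$ for $1\le t\le n+1$. $Y_n$ is the induced subgraph $H^2_n\setminus\{v^1_{2n},v^1_{2n+1},v^2_{2n+2}\}$, where $G\setminus S$ denotes the subgraph induced on $V(G)\setminus S$. $\Sigma^k$ is the $k$-fold (unreduced) suspension, $\vee$ the wedge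 sum, $\simeq$ homotopy equivalence. *)

theory Defs
  imports "HOL-Analysis.Analysis"
begin

section \<open>Finite simple graphs\<close>

text \<open>A graph is a pair of a vertex set and a set of two-element edges.\<close>

type_synonym 'a ugraph = "'a set \<times> 'a set set"

abbreviation verts :: "'a ugraph \<Rightarrow> 'a set" where "verts G \<equiv> fst G"
abbreviation edges :: "'a ugraph \<Rightarrow> 'a set set" where "edges G \<equiv> snd G"

definition finite_simple_graph :: "'a ugraph \<Rightarrow> bool" where
  "finite_simple_graph G \<longleftrightarrow> finite (verts G) \<and> (\<forall>e\<in>edges G. e \<subseteq> verts G \<and> card e = 2)"

definition del_verts :: "'a ugraph \<Rightarrow> 'a set \<Rightarrow> 'a ugraph" (infixl \<open>\<setminus>\<^sub>v\<close> 65) where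
  "G \<setminus>\<^sub>v S = (verts G - S, {e \<in> edges G. e \<subseteq> verts G - S})"

definition independent :: "'a ugraph \<Rightarrow> 'a set \<Rightarrow> bool" where
  "independent G A \<longleftrightarrow> A \<subseteq> verts G \<and> (\<forall>u\<in>A. \<forall>v\<in>A. {u, v} \<notin> edges G)"

text \<open>The pair \<open>(i, j)\<close> stands for the vertex written \<open>v\<close> with upper index \<open>i\<close>
  and lower index \<open>j\<close>.\<close>

definition H2 :: "nat \<Rightarrow> (nat \<times> nat) ugraph" where
  "H2 n =
    ({(1, r) |r. 1 \<le> r \<and> r \<le> 2*n+1} \<union> {(2, s) |s. 1 \<le> s \<and> s \<le> 2*n+2}
       \<union> {(3, r) |r. 1 \<le> r \<and> r \<le> 2*n+1},
     {{(1, r), (1, r+1)} |r. 1 \<le> r \<and> r \<le> 2*n} \<union> {{(3, r), (3, r+1)} |r. 1 \<le> r \<and> r \<le> 2*n}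
       \<union> {{(2, s), (2, s+1)} |s. 1 \<le> s \<and> s \<le> 2*n+1}
       \<union> {{(1, 2*t-1), (2, 2*t)} |t. 1 \<le> t \<and> t \<le> n+1}
       \<union> {{(2, 2*t-1), (3, 2*t-1)} |t. 1 \<le> t \<and> t \<le> n+1})"

definition Y :: "nat \<Rightarrow> (nat \<times> nat) ugraph" where
  "Y n = H2 n \<setminus>\<^sub>v {(1, 2*n), (1, 2*n+1), (2, 2*n+2)}"

lemma finite_simple_graph_H2: "finite_simple_graph (H2 n)"
proof -
  have "verts (H2 n) \<subseteq> {1..3} \<times> {1..2*n+2}"
    by (auto simp: H2_def)
  then have "finite (verts (H2 n))"
    by (rule finite_subset) auto
  moreover have "e \<subseteq> verts (H2 n) \<and> card e = 2" if "e \<in> edges (H2 n)" for e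
    using that by (auto simp: H2_def)
  ultimately show ?thesis
    by (auto simp: finite_simple_graph_def)
qed

lemma finite_simple_graph_del_verts:
  "finite_simple_graph G \<Longrightarrow> finite_simple_graph (G \<setminus>\<^sub>v S)"
  by (auto simp: finite_simple_graph_def del_verts_def)

lemma finite_simple_graph_Y: "finite_simple_graph (Y n)"
  by (simp add: Y_def finite_simple_graph_H2 finite_simple_graph_del_verts)


section \<open>Independence complexes and their geometric realizations\<close>

text \<open>An abstract simplicial complex is given by its set of faces (including the empty face).\<close>

definition Ind :: "'a ugraph \<Rightarrow> 'a set set" where
  "Ind G = {A. independent G A}"

text \<open>Points are barycentric coordinates whose support is a face. The topology is that of
  pointwise convergence; for a finite complex, the only case used here, this is the usual
  topology of the polyhedron.\<close>

definition realization :: "'a set set \<Rightarrow> ('a \<Rightarrow> real) topology" where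
  "realization K = subtopology (powertop_real UNIV)
     {x. (\<forall>v. 0 \<le> x v) \<and> {v. x v \<noteq> 0} \<in> K \<and> (\<Sum>v | x v \<noteq> 0. x v) = 1}"


section \<open>Quotients, suspensions and wedge sums\<close>

text \<open>The final topology on \<open>S\<close> along \<open>q\<close>, where \<open>q\<close> maps \<open>topspace X\<close> into \<open>S\<close>.
  If \<open>S\<close> is the image of \<open>q\<close>, it is the quotient topology (see \<open>quotient_map_final_topology\<close>);
  points of \<open>S\<close> outside the image are isolated.\<close>

definition final_topology :: "'b set \<Rightarrow> 'a topology \<Rightarrow> ('a \<Rightarrow> 'b) \<Rightarrow> 'b topology" where
  "final_topology S X q =
     topology (\<lambda>U. U \<subseteq> S \<and> openin X {x \<in> topspace X. q x \<in> U})"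

lemma openin_final_topology:
  "openin (final_topology S X q) U \<longleftrightarrow> U \<subseteq> S \<and> openin X {x \<in> topspace X. q x \<in> U}"
proof -
  have "istopology (\<lambda>U. U \<subseteq> S \<and> openin X {x \<in> topspace X. q x \<in> U})"
    unfolding istopology_def
  proof (intro conjI allI impI)
    fix U V
    assume "U \<subseteq> S \<and> openin X {x \<in> topspace X. q x \<in> U}"
      and "V \<subseteq> S \<and> openin X {x \<in> topspace X. q x \<in> V}"
    then show "U \<inter> V \<subseteq> S" and "openin X {x \<in> topspace X. q x \<in> U \<inter> V}"
      using openin_Int[of X "{x \<in> topspace X. q x \<in> U}" "{x \<in> topspace X. q x \<in> V}"]
      by (auto simp: Collect_conj_eq[symmetric] Int_def conj_ac elim!: back_subst[of "openin X"])
  next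
    fix \<K>
    assume *: "\<forall>U\<in>\<K>. U \<subseteq> S \<and> openin X {x \<in> topspace X. q x \<in> U}"
    then show "\<Union>\<K> \<subseteq> S" by auto
    have "{x \<in> topspace X. q x \<in> \<Union>\<K>} = (\<Union>U\<in>\<K>. {x \<in> topspace X. q x \<in> U})" by auto
    then show "openin X {x \<in> topspace X. q x \<in> \<Union>\<K>}"
      using * by auto
  qed
  then show ?thesis
    by (simp add: final_topology_def)
qed

lemma topspace_final_topology:
  assumes "q ` topspace X \<subseteq> S"
  shows "topspace (final_topology S X q) = S"
proof -
  have "{x \<in> topspace X. q x \<in> S} = topspace X"
    using assms by auto
  then have "openin (final_topology S X q) S"
    by (simp add: openin_final_topology)
  then show ?thesis
    by (metis openin_final_topology openin_subset openin_topspace subset_antisym)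
qed

lemma quotient_map_final_topology:
  "quotient_map X (final_topology (q ` topspace X) X q) q"
  by (auto simp: quotient_map_def topspace_final_topology openin_final_topology)

text \<open>The unreduced suspension of \<open>X\<close> is the quotient of \<open>X \<times> [0,1]\<close> collapsing \<open>X \<times> {0}\<close>
  to one point and \<open>X \<times> {1}\<close> to another. The quotient points are represented by a datatype,
  so that suspension is an operation on topologies over one fixed type and can be iterated;
  \<open>Base\<close> embeds the points of the unsuspended space. The poles are present even
  if \<open>X\<close> is empty, so that the suspension of the empty space is the 0-sphere.\<close>

datatype 'a susp_point = Base 'a | South | North | Mid "'a susp_point" real

definition susp_proj :: "'a susp_point \<times> real \<Rightarrow> 'a susp_point" where
  "susp_proj = (\<lambda>(x, t). if t = 0 then South else if t = 1 then North else Mid x t)"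

definition suspension :: "'a susp_point topology \<Rightarrow> 'a susp_point topology" where
  "suspension X =
     final_topology ({South, North} \<union> susp_proj ` (topspace X \<times> {0..1}))
       (prod_topology X (top_of_set {0..1})) susp_proj"

definition base_copy :: "'a topology \<Rightarrow> 'a susp_point topology" where
  "base_copy X = final_topology (Base ` topspace X) X Base"

definition iter_suspension :: "nat \<Rightarrow> 'a topology \<Rightarrow> 'a susp_point topology" where
  "iter_suspension k X = (suspension ^^ k) (base_copy X)"

lemma homeomorphic_map_base_copy: "homeomorphic_map X (base_copy X) Base"
  unfolding base_copy_def homeomorphic_map_def
  by (auto simp: quotient_map_final_topology inj_on_def)

lemma topspace_suspension:
  "topspace (suspension X) = {South, North} \<union> susp_proj ` (topspace X \<times> {0..1})"
  unfolding suspension_def by (rule topspace_final_topology) auto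

lemma quotient_map_susp_proj:
  assumes "topspace X \<noteq> {}"
  shows "quotient_map (prod_topology X (top_of_set {0..1})) (suspension X) susp_proj"
proof -
  obtain a where "a \<in> topspace X" using assms by blast
  then have "(a, 0) \<in> topspace X \<times> {0..1::real}" "(a, 1) \<in> topspace X \<times> {0..1::real}"
    by auto
  moreover have "susp_proj (a, 0) = South" "susp_proj (a, 1) = North"
    by (simp_all add: susp_proj_def)
  ultimately have "{South, North} \<subseteq> susp_proj ` (topspace X \<times> {0..1})"
    by (metis empty_subsetI image_eqI insert_subset)
  then have "{South, North} \<union> susp_proj ` (topspace X \<times> {0..1}) =
      susp_proj ` topspace (prod_topology X (top_of_set {0..1}))"
    by (simp add: insert_absorb)
  then show ?thesis
    unfolding suspension_def by (metis quotient_map_final_topology)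
qed

text \<open>The wedge sum of a list of pointed spaces \<open>(X, p)\<close>: the disjoint union with all base points
  identified to the single point \<open>None\<close>.\<close>

definition wedge_proj :: "('a topology \<times> 'a) list \<Rightarrow> nat \<times> 'a \<Rightarrow> (nat \<times> 'a) option" where
  "wedge_proj Xs = (\<lambda>(i, x). if x = snd (Xs ! i) then None else Some (i, x))"

definition wedge :: "('a topology \<times> 'a) list \<Rightarrow> (nat \<times> 'a) option topology" where
  "wedge Xs =
     (let D = sum_topology (\<lambda>i. fst (Xs ! i)) {..<length Xs}
      in final_topology (insert None (wedge_proj Xs ` topspace D)) D (wedge_proj Xs))"

lemma quotient_map_wedge_proj:
  assumes "Xs \<noteq> []" and "\<forall>(X, p) \<in> set Xs. p \<in> topspace X"
  shows "quotient_map (sum_topology (\<lambda>i. fst (Xs ! i)) {..<length Xs}) (wedge Xs) (wedge_proj Xs)"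
proof -
  let ?D = "sum_topology (\<lambda>i. fst (Xs ! i)) {..<length Xs}"
  have "snd (Xs ! 0) \<in> topspace (fst (Xs ! 0))"
    using assms by (metis (mono_tags, lifting) case_prod_beta length_greater_0_conv nth_mem)
  then have "(0, snd (Xs ! 0)) \<in> topspace ?D"
    using assms(1) by simp
  moreover have "wedge_proj Xs (0, snd (Xs ! 0)) = None"
    by (simp add: wedge_proj_def)
  ultimately have "insert None (wedge_proj Xs ` topspace ?D) = wedge_proj Xs ` topspace ?D"
    by (metis image_eqI insert_absorb)
  then show ?thesis
    unfolding wedge_def Let_def by (simp add: quotient_map_final_topology del: topspace_sum_topology)
qed

text \<open>The base points can be chosen, since spheres and suspensions are nonempty.\<close>

lemma nsphere_nonempty: "topspace (nsphere k) \<noteq> {}"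
proof -
  have "(\<lambda>i. if i = 0 then 1 else 0) \<in> topspace (nsphere k)"
    by (simp add: nsphere if_distrib[of "\<lambda>x. x ^ 2"] sum.delta cong: if_cong)
  then show ?thesis by blast
qed

lemma iter_suspension_nonempty: "k > 0 \<Longrightarrow> topspace (iter_suspension k X) \<noteq> {}"
  by (cases k) (auto simp: iter_suspension_def topspace_suspension)

end

theory Submission
  imports Defs
begin

text \<open>Removing a vertex \<open>v\<close> that is dominated by \<open>u\<close> (every neighbour of \<open>u\<close> is a neighbour of \<open>v\<close>) is a
  deformation retraction of the independence complex. For the general case delete the two adjacent
  vertices with upper index 2 and lower indices \<open>2 * n\<close> and \<open>2 * n + 1\<close>. Since no face contains both,
  the complex is the mapping cone of the inclusions of their links into the rest. Folding identifies
  the two links with \<open>H2 (n - 3)\<close> plus three disjoint edges and \<open>H2 (n - 4)\<close> plus five disjoint edges, and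
  the rest with \<open>Y (n - 3)\<close> plus five disjoint edges, and a disjoint edge amounts to a suspension. The
  inclusions of the links are null-homotopic, because they deform into cones inside the rest.
  Hence the mapping cone is the wedge of the rest and the suspended links. The cases \<open>n = 2\<close> and
  \<open>n = 3\<close> are analogous, and for \<open>n = 4\<close> a vertex with contractible link is deleted first.

  Arbitrary base points are handled by growing whiskers at them.\<close>

section \<open>Joint quotients\<close>

text \<open>The target wedges are quantified over all base points, and a free homotopy equivalence
  need not extend over a wedge when base points are degenerate. Every summand is therefore kept
  homeomorphic to the realization of an independence complex, in which each point is nondegenerate.
  For the suspended links this is the purpose of an edge in the otherwise empty row
  \<open>0\<close>: adding it suspends a link once, so that three and five edges of the strip give
  the exponents \<open>4\<close> and \<open>6\<close>, while the rest, to which no cone adds a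
  suspension, keeps its five. Cones, suspensions and wedges carry quotient topologies but a
  realization carries a subspace topology; compactness matches the two. Homotopies are defined on
  the pieces of a glued space, for which gluing has to commute with the product with an interval.
  The size of the graph enters only through a part left of a bounded window that no fold touches, so
  the combinatorics reduces to finite lists checked by evaluation.\<close>

abbreviation unit_interval :: "real topology" where
  "unit_interval \<equiv> top_of_set {0..1}"

lemma unit_interval_locally_compact_Hausdorff:
  "locally_compact_space unit_interval" "Hausdorff_space unit_interval"
  by (auto simp: Hausdorff_space_subtopology compact_imp_locally_compact_space compact_space_subtopology)

text \<open>Mapping cones and wedges are both glued from several pieces. A common format for the
  gluing lets maps and homotopies be defined on the pieces and checked only on the
  identifications.\<close>

definition joint_quotient ::
    "'i set \<Rightarrow> ('i \<Rightarrow> 'a topology) \<Rightarrow> 'b topology \<Rightarrow> ('i \<Rightarrow> 'a \<Rightarrow> 'b) \<Rightarrow> bool" where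
  "joint_quotient J A X q \<longleftrightarrow> quotient_map (sum_topology A J) X (\<lambda>(j, a). q j a)"

lemma continuous_map_from_sum:
  assumes "\<And>j. j \<in> J \<Longrightarrow> continuous_map (A j) Z (\<lambda>a. f (j, a))"
  shows "continuous_map (sum_topology A J) Z f"
  unfolding continuous_map_def
proof (intro conjI allI impI)
  show "f \<in> topspace (sum_topology A J) \<rightarrow> topspace Z"
    using assms by (fastforce simp: continuous_map_def)
  fix U assume "openin Z U"
  then have "openin (A j) {a \<in> topspace (A j). f (j, a) \<in> U}" if "j \<in> J" for j
    using assms[OF that] by (simp add: continuous_map_def)
  then have "openin (sum_topology A J) (Sigma J (\<lambda>j. {a \<in> topspace (A j). f (j, a) \<in> U}))"
    by (simp add: openin_disjoint_union)
  moreover have "Sigma J (\<lambda>j. {a \<in> topspace (A j). f (j, a) \<in> U}) =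
      {x \<in> topspace (sum_topology A J). f x \<in> U}"
    by auto
  ultimately show "openin (sum_topology A J) {x \<in> topspace (sum_topology A J). f x \<in> U}"
    by simp
qed

lemma joint_quotient_continuous:
  assumes "joint_quotient J A X q" "j \<in> J"
  shows "continuous_map (A j) X (q j)"
proof -
  have "continuous_map (A j) X ((\<lambda>(j, a). q j a) \<circ> (\<lambda>a. (j, a)))"
    using assms continuous_map_component_injection
    by (metis (no_types, lifting) continuous_map_compose joint_quotient_def quotient_imp_continuous_map)
  then show ?thesis by (simp add: o_def)
qed

lemma joint_quotient_surj:
  assumes "joint_quotient J A X q" "x \<in> topspace X"
  obtains j a where "j \<in> J" "a \<in> topspace (A j)" "x = q j a"
proof -
  have "x \<in> (\<lambda>(j, a). q j a) ` topspace (sum_topology A J)"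
    using assms unfolding joint_quotient_def by (metis quotient_imp_surjective_map)
  then show ?thesis using that by auto
qed

lemma joint_quotient_lift:
  assumes "joint_quotient J A X q"
    and "\<And>j. j \<in> J \<Longrightarrow> continuous_map (A j) Z (\<lambda>a. f (q j a))"
  shows "continuous_map X Z f"
  using assms(1) unfolding joint_quotient_def
  by (rule continuous_compose_quotient_map)
     (rule continuous_map_from_sum, use assms(2) in \<open>auto simp: o_def\<close>)

lemma joint_quotient_extend:
  assumes q: "joint_quotient J A X q"
    and g: "\<And>j. j \<in> J \<Longrightarrow> continuous_map (A j) Z (g j)"
    and compat: "\<And>i j a b. \<lbrakk>i \<in> J; j \<in> J; a \<in> topspace (A i); b \<in> topspace (A j); q i a = q j b\<rbrakk>
        \<Longrightarrow> g i a = g j b"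
  obtains f where "continuous_map X Z f"
    "\<And>j a. \<lbrakk>j \<in> J; a \<in> topspace (A j)\<rbrakk> \<Longrightarrow> f (q j a) = g j a"
proof -
  define f where "f x = (let (j, a) = SOME (j, a). j \<in> J \<and> a \<in> topspace (A j) \<and> q j a = x in g j a)" for x
  have f: "f (q j a) = g j a" if "j \<in> J" "a \<in> topspace (A j)" for j a
  proof -
    let ?P = "\<lambda>(j', a'). j' \<in> J \<and> a' \<in> topspace (A j') \<and> q j' a' = q j a"
    obtain i b where ib: "(SOME z. ?P z) = (i, b)" by (cases "SOME z. ?P z")
    have "?P (SOME z. ?P z)"
      by (rule someI[of ?P "(j, a)"]) (use that in auto)
    then have "i \<in> J" "b \<in> topspace (A i)" "q i b = q j a"
      unfolding ib by auto
    then have "g i b = g j a" using compat that by blast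
    then show ?thesis
      unfolding f_def ib by simp
  qed
  have "continuous_map X Z f"
    using q
  proof (rule joint_quotient_lift)
    fix j assume j: "j \<in> J"
    show "continuous_map (A j) Z (\<lambda>a. f (q j a))"
      by (rule continuous_map_eq[OF g[OF j]]) (use f j in auto)
  qed
  then show ?thesis using f that by blast
qed

text \<open>Whitehead's theorem: the product with a locally compact Hausdorff space preserves
  quotient maps. It allows a homotopy on a glued space to be given piece by piece; the factor
  \<open>T\<close> comes first because \<open>homotopic_with\<close> puts time first.\<close>

lemma joint_quotient_prod:
  assumes q: "joint_quotient J A X q" and T: "locally_compact_space T" "Hausdorff_space T"
  shows "joint_quotient J (\<lambda>j. prod_topology T (A j)) (prod_topology T X) (\<lambda>j (t, a). (t, q j a))"
proof -
  let ?S = "sum_topology (\<lambda>j. prod_topology T (A j)) J"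
  let ?f = "\<lambda>(j, t, a). (t, j, a)"
  let ?g = "\<lambda>(t, j, a). (j, t, a)"
  \<comment> \<open>The product distributes over the disjoint union; after that the product theorem
    applies to the single quotient map out of the sum.\<close>
  have "homeomorphic_maps ?S (prod_topology T (sum_topology A J)) ?f ?g"
    unfolding homeomorphic_maps_def
  proof (intro conjI ballI)
    show "continuous_map ?S (prod_topology T (sum_topology A J)) ?f"
    proof (rule continuous_map_from_sum)
      fix j assume "j \<in> J"
      then have "continuous_map (prod_topology T (A j)) (prod_topology T (sum_topology A J))
          (\<lambda>x. (fst x, j, snd x))"
        using continuous_map_compose[OF continuous_map_snd continuous_map_component_injection[of j J A]]
        by (intro continuous_map_pairedI continuous_map_fst) (simp add: o_def)
      then show "continuous_map (prod_topology T (A j)) (prod_topology T (sum_topology A J))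
          (\<lambda>a. case (j, a) of (j, t, a) \<Rightarrow> (t, j, a))"
        by (simp add: case_prod_unfold)
    qed
    show "continuous_map (prod_topology T (sum_topology A J)) ?S ?g"
      unfolding continuous_map_def
    proof (intro conjI allI impI)
      fix U assume U: "openin ?S U"
      let ?V = "{x \<in> topspace (prod_topology T (sum_topology A J)). ?g x \<in> U}"
      show "openin (prod_topology T (sum_topology A J)) ?V"
        unfolding openin_prod_topology_alt
      proof (intro allI impI)
        fix t ja assume "(t, ja) \<in> ?V"
        moreover obtain j a where ja: "ja = (j, a)" by (cases ja)
        ultimately have "j \<in> J" "t \<in> topspace T" "a \<in> topspace (A j)" "(j, t, a) \<in> U"
          by auto
        have "openin (prod_topology T (A j)) {x. (j, x) \<in> U}"
          using U \<open>j \<in> J\<close> by (auto simp: openin_sum_topology)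
        then obtain P Q where PQ: "openin T P" "openin (A j) Q" "t \<in> P" "a \<in> Q" "P \<times> Q \<subseteq> {x. (j, x) \<in> U}"
          using \<open>(j, t, a) \<in> U\<close> unfolding openin_prod_topology_alt by (metis mem_Collect_eq)
        have "openin (sum_topology A J) ({j} \<times> Q)"
        proof -
          have "openin (sum_topology A J) (Pair j ` Q)"
            using PQ(2) open_map_component_injection[OF \<open>j \<in> J\<close>, of A]
            by (simp add: open_map_def)
          moreover have "Pair j ` Q = {j} \<times> Q" by auto
          ultimately show ?thesis by simp
        qed
        moreover have "P \<times> ({j} \<times> Q) \<subseteq> ?V"
          using PQ openin_subset[OF PQ(1)] openin_subset[OF PQ(2)] \<open>j \<in> J\<close> by auto
        ultimately show "\<exists>P R. openin T P \<and> openin (sum_topology A J) R \<and> t \<in> P \<and> ja \<in> R \<and> P \<times> R \<subseteq> ?V"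
          using PQ ja by blast
      qed
    qed auto
  qed auto
  then have "quotient_map ?S (prod_topology T (sum_topology A J)) ?f"
    by (simp add: homeomorphic_maps_map homeomorphic_map_def)
  moreover have "quotient_map (prod_topology T (sum_topology A J)) (prod_topology T X)
      (\<lambda>(x, y). (x, (\<lambda>(j, a). q j a) y))"
    using q T unfolding joint_quotient_def by (intro quotient_map_prod_right) auto
  ultimately have "quotient_map ?S (prod_topology T X) ((\<lambda>(x, y). (x, (\<lambda>(j, a). q j a) y)) \<circ> ?f)"
    by (rule quotient_map_compose)
  then show ?thesis
    unfolding joint_quotient_def by (simp add: o_def case_prod_unfold)
qed

lemma joint_quotient_compose:
  assumes q: "joint_quotient J A X q" and r: "\<And>j. j \<in> J \<Longrightarrow> quotient_map (B j) (A j) (r j)"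
  shows "joint_quotient J B X (\<lambda>j b. q j (r j b))"
proof -
  let ?R = "\<lambda>(j, b). (j, r j b)"
  have "quotient_map (sum_topology B J) (sum_topology A J) ?R"
    unfolding quotient_map_def
  proof (intro conjI allI impI)
    have "r j ` topspace (B j) = topspace (A j)" if "j \<in> J" for j
      using r[OF that] by (simp add: quotient_imp_surjective_map)
    then show "?R ` topspace (sum_topology B J) = topspace (sum_topology A J)"
      by (fastforce simp: image_iff)
    fix U assume U: "U \<subseteq> topspace (sum_topology A J)"
    have eq: "{b. (j, b) \<in> {x \<in> topspace (sum_topology B J). ?R x \<in> U}} =
        {b \<in> topspace (B j). r j b \<in> {a. (j, a) \<in> U}}" if "j \<in> J" for j
      using that by auto
    have "openin (B j) {b \<in> topspace (B j). r j b \<in> {a. (j, a) \<in> U}} = openin (A j) {a. (j, a) \<in> U}"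
      if "j \<in> J" for j
    proof -
      have "{a. (j, a) \<in> U} \<subseteq> topspace (A j)" using U by auto
      then show ?thesis using r[OF that] unfolding quotient_map_def by blast
    qed
    then show "openin (sum_topology B J) {x \<in> topspace (sum_topology B J). ?R x \<in> U} =
        openin (sum_topology A J) U"
      using U eq by (auto simp: openin_sum_topology)
  qed
  then have "quotient_map (sum_topology B J) X ((\<lambda>(j, a). q j a) \<circ> ?R)"
    using q unfolding joint_quotient_def by (rule quotient_map_compose)
  then show ?thesis
    unfolding joint_quotient_def by (simp add: o_def case_prod_unfold)
qed

text \<open>A continuous map from a compact space to a Hausdorff space is closed, and a closed
  continuous surjection is a quotient map. This is how a realization, whose topology is that of
  pointwise convergence, is recognised as glued from its parts.\<close>

lemma joint_quotient_compact:
  assumes fin: "finite J" and A: "\<And>j. j \<in> J \<Longrightarrow> compact_space (A j)" and X: "Hausdorff_space X"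
    and q: "\<And>j. j \<in> J \<Longrightarrow> continuous_map (A j) X (q j)"
    and surj: "\<And>x. x \<in> topspace X \<Longrightarrow> \<exists>j\<in>J. x \<in> q j ` topspace (A j)"
  shows "joint_quotient J A X q"
  unfolding joint_quotient_def
proof (rule continuous_closed_imp_quotient_map)
  show cont: "continuous_map (sum_topology A J) X (\<lambda>(j, a). q j a)"
    by (rule continuous_map_from_sum) (use q in auto)
  show "closed_map (sum_topology A J) X (\<lambda>(j, a). q j a)"
    unfolding closed_map_def
  proof (intro allI impI)
    fix C assume C: "closedin (sum_topology A J) C"
    have "(\<lambda>(j, a). q j a) ` C = (\<Union>j\<in>J. q j ` {a. (j, a) \<in> C})"
      using closedin_subset[OF C] by (auto simp: image_iff; blast)
    moreover have "closedin X (q j ` {a. (j, a) \<in> C})" if "j \<in> J" for j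
    proof -
      have "closedin (A j) {a. (j, a) \<in> C}"
        using C that by (auto simp: closedin_sum_topology)
      then show ?thesis
        using continuous_imp_closed_map[OF q[OF that] A[OF that] X] by (simp add: closed_map_def)
    qed
    ultimately show "closedin X ((\<lambda>(j, a). q j a) ` C)"
      using fin by (auto intro!: closedin_Union)
  qed
  show "(\<lambda>(j, a). q j a) ` topspace (sum_topology A J) = topspace X"
  proof
    show "(\<lambda>(j, a). q j a) ` topspace (sum_topology A J) \<subseteq> topspace X"
      using continuous_map_image_subset_topspace[OF cont] .
    show "topspace X \<subseteq> (\<lambda>(j, a). q j a) ` topspace (sum_topology A J)"
    proof
      fix x assume "x \<in> topspace X"
      then obtain j a where "j \<in> J" "a \<in> topspace (A j)" "x = q j a" using surj by blast
      then show "x \<in> (\<lambda>(j, a). q j a) ` topspace (sum_topology A J)"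
        by (intro image_eqI[of _ _ "(j, a)"]) auto
    qed
  qed
qed


section \<open>Mapping cones\<close>

text \<open>\<open>\<iota>\<close> is the inclusion of \<open>L\<close> and \<open>c j\<close> the structure map of the cone over \<open>M j\<close>, with base at
  height \<open>0\<close> and apex at height \<open>1\<close>. The piece \<open>L\<close>, with index \<open>k\<close>, is multiplied by an interval
  only to give all pieces the same type.\<close>

definition mapping_cone ::
    "nat \<Rightarrow> 'a topology \<Rightarrow> (nat \<Rightarrow> 'a topology) \<Rightarrow> (nat \<Rightarrow> 'a \<Rightarrow> 'a) \<Rightarrow> 'x topology \<Rightarrow>
      ('a \<Rightarrow> 'x) \<Rightarrow> (nat \<Rightarrow> 'a \<times> real \<Rightarrow> 'x) \<Rightarrow> bool" where
  "mapping_cone k L M f X \<iota> c \<longleftrightarrow>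
     joint_quotient {..k} (\<lambda>j. prod_topology (if j < k then M j else L) unit_interval) X
       (\<lambda>j z. if j < k then c j z else \<iota> (fst z)) \<and>
     inj_on \<iota> (topspace L) \<and>
     (\<forall>j<k. continuous_map (M j) L (f j)) \<and>
     (\<forall>j<k. \<forall>m\<in>topspace (M j). c j (m, 0) = \<iota> (f j m)) \<and>
     (\<forall>j<k. \<forall>m\<in>topspace (M j). \<forall>m'\<in>topspace (M j). c j (m, 1) = c j (m', 1)) \<and>
     (\<forall>j<k. \<forall>m\<in>topspace (M j). \<forall>t\<in>{0<..1}. c j (m, t) \<notin> \<iota> ` topspace L) \<and>
     (\<forall>j<k. \<forall>j'<k. \<forall>m\<in>topspace (M j). \<forall>m'\<in>topspace (M j'). \<forall>t\<in>{0<..1}. \<forall>t'\<in>{0<..1}.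
        c j (m, t) = c j' (m', t') \<longrightarrow> j = j' \<and> t = t' \<and> (t < 1 \<longrightarrow> m = m'))"

text \<open>The gluing identifies only height \<open>0\<close> with the base and the top of each
  cone with one point. The check serves single maps and, at each fixed time, homotopies.\<close>

lemma mapping_cone_compatible:
  assumes mc: "mapping_cone k L M f X \<iota> c"
    and G0: "\<And>j m. \<lbrakk>j < k; m \<in> topspace (M j)\<rbrakk> \<Longrightarrow> G j (m, 0) = GL (f j m)"
    and G1: "\<And>j m m'. \<lbrakk>j < k; m \<in> topspace (M j); m' \<in> topspace (M j)\<rbrakk> \<Longrightarrow> G j (m, 1) = G j (m', 1)"
    and ij: "i \<le> k" "j \<le> k"
    and a: "a \<in> topspace (prod_topology (if i < k then M i else L) unit_interval)"
    and b: "b \<in> topspace (prod_topology (if j < k then M j else L) unit_interval)"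
    and eq: "(if i < k then c i a else \<iota> (fst a)) = (if j < k then c j b else \<iota> (fst b))"
  shows "(if i < k then G i a else GL (fst a)) = (if j < k then G j b else GL (fst b))"
proof -
  have f: "f j m \<in> topspace L" if "j < k" "m \<in> topspace (M j)" for j m
  proof -
    have "continuous_map (M j) L (f j)"
      using mc that(1) by (simp add: mapping_cone_def)
    then show ?thesis using that(2) by (auto simp: continuous_map_def)
  qed
  have inj: "inj_on \<iota> (topspace L)"
    and c0: "\<And>j m. j < k \<Longrightarrow> m \<in> topspace (M j) \<Longrightarrow> c j (m, 0) = \<iota> (f j m)"
    and cL: "\<And>j m t. j < k \<Longrightarrow> m \<in> topspace (M j) \<Longrightarrow> 0 < t \<Longrightarrow> t \<le> 1 \<Longrightarrow> c j (m, t) \<notin> \<iota> ` topspace L"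
    and cc: "\<And>j j' m m' t t'. j < k \<Longrightarrow> j' < k \<Longrightarrow> m \<in> topspace (M j) \<Longrightarrow> m' \<in> topspace (M j') \<Longrightarrow>
       0 < t \<Longrightarrow> t \<le> 1 \<Longrightarrow> 0 < t' \<Longrightarrow> t' \<le> 1 \<Longrightarrow> c j (m, t) = c j' (m', t') \<Longrightarrow>
       j = j' \<and> t = t' \<and> (t < 1 \<longrightarrow> m = m')"
    using mc unfolding mapping_cone_def by auto
  obtain m s where a': "a = (m, s)" by (cases a)
  obtain m' s' where b': "b = (m', s')" by (cases b)
  \<comment> \<open>A point at height \<open>0\<close> of a cone and a point of the piece
    \<open>L\<close> are both replaced by a point \<open>l\<close> of the base, so only the four
    combinations of base level and positive height remain.\<close>
  have L: "(if i < k then G i a else GL (fst a)) = GL l \<and> (if i < k then c i a else \<iota> (fst a)) = \<iota> l \<and> l \<in> topspace L"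
    if "i < k \<longrightarrow> s = 0" "l = (if i < k then f i m else m)" for l
    using that a a' G0 c0 f by auto
  have L': "(if j < k then G j b else GL (fst b)) = GL l \<and> (if j < k then c j b else \<iota> (fst b)) = \<iota> l \<and> l \<in> topspace L"
    if "j < k \<longrightarrow> s' = 0" "l = (if j < k then f j m' else m')" for l
    using that b b' G0 c0 f by auto
  consider "i < k \<longrightarrow> s = 0" "j < k \<longrightarrow> s' = 0" | "i < k" "s > 0" "j < k \<longrightarrow> s' = 0"
    | "i < k \<longrightarrow> s = 0" "j < k" "s' > 0" | "i < k" "s > 0" "j < k" "s' > 0"
    using a b a' b' by force
  then show ?thesis
  proof cases
    case 1
    then show ?thesis using L L' eq inj by (metis inj_onD)
  next
    case 2
    then have "c i (m, s) \<notin> \<iota> ` topspace L" using a a' by (intro cL) auto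
    then show ?thesis using 2 L' eq a' by auto
  next
    case 3
    then have "c j (m', s') \<notin> \<iota> ` topspace L" using b b' by (intro cL) auto
    then show ?thesis using 3 L eq b' by (metis image_eqI)
  next
    case 4
    have st: "i = j \<and> s = s' \<and> (s < 1 \<longrightarrow> m = m')"
      by (rule cc) (use 4 a b a' b' eq in auto)
    have m: "m \<in> topspace (M j)" "m' \<in> topspace (M j)" "s \<le> 1"
      using 4 a b a' b' st by auto
    show ?thesis
    proof (cases "s < 1")
      case False
      then have "s = 1" using m(3) by simp
      then show ?thesis using 4 a' b' st G1[OF 4(3) m(1,2)] by simp
    qed (use 4 a' b' st in simp)
  qed
qed

lemma mapping_cone_extend:
  assumes mc: "mapping_cone k L M f X \<iota> c"
    and gL: "continuous_map L Z gL"
    and g: "\<And>j. j < k \<Longrightarrow> continuous_map (prod_topology (M j) unit_interval) Z (g j)"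
    and g0: "\<And>j m. \<lbrakk>j < k; m \<in> topspace (M j)\<rbrakk> \<Longrightarrow> g j (m, 0) = gL (f j m)"
    and g1: "\<And>j m m'. \<lbrakk>j < k; m \<in> topspace (M j); m' \<in> topspace (M j)\<rbrakk> \<Longrightarrow> g j (m, 1) = g j (m', 1)"
  obtains F where "continuous_map X Z F" "\<And>l. l \<in> topspace L \<Longrightarrow> F (\<iota> l) = gL l"
    "\<And>j m t. \<lbrakk>j < k; m \<in> topspace (M j); t \<in> {0..1}\<rbrakk> \<Longrightarrow> F (c j (m, t)) = g j (m, t)"
proof -
  have jq: "joint_quotient {..k} (\<lambda>j. prod_topology (if j < k then M j else L) unit_interval) X
       (\<lambda>j z. if j < k then c j z else \<iota> (fst z))"
    using mc by (simp add: mapping_cone_def)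
  obtain F where F: "continuous_map X Z F"
    "\<And>j a. \<lbrakk>j \<in> {..k}; a \<in> topspace (prod_topology (if j < k then M j else L) unit_interval)\<rbrakk> \<Longrightarrow>
      F (if j < k then c j a else \<iota> (fst a)) = (if j < k then g j a else gL (fst a))"
  proof (rule joint_quotient_extend[OF jq, of Z "\<lambda>j a. if j < k then g j a else gL (fst a)"])
    show "continuous_map (prod_topology (if j < k then M j else L) unit_interval) Z
        (\<lambda>a. if j < k then g j a else gL (fst a))" if "j \<in> {..k}" for j
      using g[of j] continuous_map_compose[OF continuous_map_fst[of L unit_interval] gL] by (simp add: o_def)
  qed (rule mapping_cone_compatible[OF mc g0 g1], auto)
  have "F (\<iota> l) = gL l" if "l \<in> topspace L" for l
    using F(2)[of k "(l, 0)"] that by simp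
  moreover have "F (c j (m, t)) = g j (m, t)" if "j < k" "m \<in> topspace (M j)" "t \<in> {0..1}" for j m t
    using F(2)[of j "(m, t)"] that by simp
  ultimately show ?thesis using F(1) that by blast
qed

lemma mapping_cone_homotopic:
  assumes mc: "mapping_cone k L M f X \<iota> c"
    and GL: "continuous_map (prod_topology unit_interval L) Z GL"
    and G: "\<And>j. j < k \<Longrightarrow> continuous_map (prod_topology unit_interval (prod_topology (M j) unit_interval)) Z (G j)"
    and G0: "\<And>j m s. \<lbrakk>j < k; m \<in> topspace (M j); s \<in> {0..1}\<rbrakk> \<Longrightarrow> G j (s, m, 0) = GL (s, f j m)"
    and G1: "\<And>j m m' s. \<lbrakk>j < k; m \<in> topspace (M j); m' \<in> topspace (M j); s \<in> {0..1}\<rbrakk>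
        \<Longrightarrow> G j (s, m, 1) = G j (s, m', 1)"
    and start: "\<And>l. l \<in> topspace L \<Longrightarrow> GL (0, l) = u (\<iota> l)" "\<And>l. l \<in> topspace L \<Longrightarrow> GL (1, l) = v (\<iota> l)"
    and fin: "\<And>j m t. \<lbrakk>j < k; m \<in> topspace (M j); t \<in> {0..1}\<rbrakk> \<Longrightarrow> G j (0, m, t) = u (c j (m, t))"
       "\<And>j m t. \<lbrakk>j < k; m \<in> topspace (M j); t \<in> {0..1}\<rbrakk> \<Longrightarrow> G j (1, m, t) = v (c j (m, t))"
  shows "homotopic_with (\<lambda>_. True) X Z u v"
proof -
  let ?B = "\<lambda>j. prod_topology (if j < k then M j else L) unit_interval"
  let ?q = "\<lambda>j z. if j < k then c j z else \<iota> (fst z)"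
  have jq0: "joint_quotient {..k} ?B X ?q"
    using mc by (simp add: mapping_cone_def)
  note lc = unit_interval_locally_compact_Hausdorff
  have jq: "joint_quotient {..k} (\<lambda>j. prod_topology unit_interval (?B j)) (prod_topology unit_interval X)
     (\<lambda>j (t, a). (t, ?q j a))"
    by (rule joint_quotient_prod[OF jq0 lc])
  have "\<exists>F. continuous_map (prod_topology unit_interval X) Z F \<and>
    (\<forall>j\<in>{..k}. \<forall>a\<in>topspace (prod_topology unit_interval (?B j)).
      F ((\<lambda>(t, a). (t, ?q j a)) a) = (if j < k then G j a else GL (fst a, fst (snd a))))" (is "\<exists>F. ?F F")
  proof (rule joint_quotient_extend[OF jq, of Z "\<lambda>j a. if j < k then G j a else GL (fst a, fst (snd a))"])
    show "continuous_map (prod_topology unit_interval (?B j)) Z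
        (\<lambda>a. if j < k then G j a else GL (fst a, fst (snd a)))" if "j \<in> {..k}" for j
    proof (cases "j < k")
      case False
      have "continuous_map (prod_topology unit_interval (prod_topology L unit_interval))
          (prod_topology unit_interval L) (\<lambda>a. (fst a, fst (snd a)))"
        by (intro continuous_map_pairedI continuous_map_fst continuous_map_snd
            continuous_map_compose[OF continuous_map_snd continuous_map_fst, unfolded o_def])
      from continuous_map_compose[OF this GL] show ?thesis using False by (simp add: o_def)
    qed (use G in simp)
    fix i j a b assume ij: "i \<in> {..k}" "j \<in> {..k}"
      and a: "a \<in> topspace (prod_topology unit_interval (?B i))"
      and b: "b \<in> topspace (prod_topology unit_interval (?B j))"
      and eq: "(\<lambda>(t, a). (t, ?q i a)) a = (\<lambda>(t, a). (t, ?q j a)) b"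
    obtain s a' where a': "a = (s, a')" by (cases a)
    obtain s' b' where b': "b = (s', b')" by (cases b)
    have s: "s' = s" "s \<in> {0..1}" using eq a a' b' by auto
    \<comment> \<open>Identified points have the same time \<open>s\<close>, so compatibility is
      that of ordinary maps out of the cone, frozen at time \<open>s\<close>.\<close>
    have "(if i < k then G i (s, a') else GL (s, fst a')) = (if j < k then G j (s, b') else GL (s, fst b'))"
    proof (rule mapping_cone_compatible[OF mc, where G = "\<lambda>i a. G i (s, a)" and GL = "\<lambda>a. GL (s, a)"])
      show "i \<le> k" "j \<le> k" using ij by auto
      show "a' \<in> topspace (?B i)" "b' \<in> topspace (?B j)"
        using a b a' b' by (simp_all only: topspace_prod_topology mem_Sigma_iff)
      show "(if i < k then c i a' else \<iota> (fst a')) = (if j < k then c j b' else \<iota> (fst b'))"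
        using eq by (simp only: a' b' prod.case prod.inject)
    qed (use G0 G1 s(2) in \<open>blast+\<close>)
    then show "(if i < k then G i a else GL (fst a, fst (snd a))) = (if j < k then G j b else GL (fst b, fst (snd b)))"
      by (simp only: a' b' s(1) fst_conv snd_conv)
  qed (intro exI conjI ballI; assumption?; simp only:)
  then obtain F where F: "continuous_map (prod_topology unit_interval X) Z F"
    "\<And>j a. \<lbrakk>j \<in> {..k}; a \<in> topspace (prod_topology unit_interval (?B j))\<rbrakk> \<Longrightarrow>
      F ((\<lambda>(t, a). (t, ?q j a)) a) = (if j < k then G j a else GL (fst a, fst (snd a)))"
    by blast
  have F0: "F (s, \<iota> l) = GL (s, l)" if "l \<in> topspace L" "s \<in> {0..1}" for s l
    using F(2)[of k "(s, l, 0)"] that by simp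
  have F1: "F (s, c j (m, t)) = G j (s, m, t)" if "j < k" "m \<in> topspace (M j)" "t \<in> {0..1}" "s \<in> {0..1}" for j m t s
    using F(2)[of j "(s, m, t)"] that by simp
  have ends: "F (0, x) = u x \<and> F (1, x) = v x" if x: "x \<in> topspace X" for x
  proof -
    obtain j a where ja: "j \<in> {..k}" "a \<in> topspace (?B j)" "x = ?q j a"
      using joint_quotient_surj[OF jq0 x] by blast
    obtain m t where a: "a = (m, t)" by (cases a)
    show ?thesis
      using ja a F0 F1 start fin by (cases "j < k") auto
  qed
  show ?thesis
    by (subst homotopic_with) (use F(1) ends in auto)
qed

lemma mapping_cone_continuous:
  assumes mc: "mapping_cone k L M f X \<iota> c"
  shows "continuous_map L X \<iota>" and "j < k \<Longrightarrow> continuous_map (prod_topology (M j) unit_interval) X (c j)"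
proof -
  have jq: "joint_quotient {..k} (\<lambda>j. prod_topology (if j < k then M j else L) unit_interval) X
       (\<lambda>j z. if j < k then c j z else \<iota> (fst z))"
    using mc by (simp add: mapping_cone_def)
  have "continuous_map (prod_topology L unit_interval) X (\<lambda>z. \<iota> (fst z))"
    using joint_quotient_continuous[OF jq, of k] by simp
  moreover have "continuous_map L (prod_topology L unit_interval) (\<lambda>l. (l, 0))"
    by (intro continuous_map_pairedI) (auto simp: continuous_map_in_subtopology)
  ultimately show "continuous_map L X \<iota>"
    using continuous_map_compose by (force simp: o_def)
  show "continuous_map (prod_topology (M j) unit_interval) X (c j)" if "j < k"
    using joint_quotient_continuous[OF jq, of j] that by simp
qed

text \<open>\<open>\<Phi>\<close> and \<open>\<Psi>\<close> spend the lower half of each cone on the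
  homotopy \<open>h\<close>, forwards and backwards, and the upper half on the cone itself. Their
  composite runs along \<open>h\<close>, back again and then up; this detour contracts while the
  base stays fixed.\<close>

lemma mapping_cone_left_inverse:
  assumes X: "mapping_cone k L M f X \<iota> c" and W: "mapping_cone k L M g W \<kappa> d"
    and h: "\<And>j. j < k \<Longrightarrow> continuous_map (prod_topology unit_interval (M j)) L (h j)"
    and h0: "\<And>j m. \<lbrakk>j < k; m \<in> topspace (M j)\<rbrakk> \<Longrightarrow> h j (0, m) = f j m"
    and h1: "\<And>j m. \<lbrakk>j < k; m \<in> topspace (M j)\<rbrakk> \<Longrightarrow> h j (1, m) = g j m"
    and \<Phi>: "\<And>l. l \<in> topspace L \<Longrightarrow> \<Phi> (\<iota> l) = \<kappa> l"
      "\<And>j m t. \<lbrakk>j < k; m \<in> topspace (M j); t \<in> {0..1}\<rbrakk> \<Longrightarrow>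
         \<Phi> (c j (m, t)) = (if t \<le> 1/2 then \<kappa> (h j (2*t, m)) else d j (m, 2*t - 1))"
    and \<Psi>: "\<And>l. l \<in> topspace L \<Longrightarrow> \<Psi> (\<kappa> l) = \<iota> l"
      "\<And>j m t. \<lbrakk>j < k; m \<in> topspace (M j); t \<in> {0..1}\<rbrakk> \<Longrightarrow>
         \<Psi> (d j (m, t)) = (if t \<le> 1/2 then \<iota> (h j (1 - 2*t, m)) else c j (m, 2*t - 1))"
  shows "homotopic_with (\<lambda>_. True) X X (\<Psi> \<circ> \<Phi>) id"
proof -
  define P where "P j z = (if snd z \<le> 0 then \<iota> (h j (- snd z, fst z)) else c j z)" for j and z :: "'a \<times> real"
  \<comment> \<open>\<open>P j (m, -)\<close> runs backwards along the homotopy and then up the cone. Both maps to be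
    compared are reparametrizations of it, by \<open>\<sigma>\<close> and by the identity.\<close>
  define \<sigma> :: "real \<Rightarrow> real" where "\<sigma> t = max (- 2 * t) (4 * t - 3)" for t
  have hL: "h j (s, m) \<in> topspace L" if "j < k" "m \<in> topspace (M j)" "s \<in> {0..1}" for j s m
    using h[OF that(1)] that(2,3) by (auto simp: continuous_map_def)
  have c0: "c j (m, 0) = \<iota> (f j m)" if "j < k" "m \<in> topspace (M j)" for j m
    using X that by (auto simp: mapping_cone_def)
  have c1: "c j (m, 1) = c j (m', 1)" if "j < k" "m \<in> topspace (M j)" "m' \<in> topspace (M j)" for j m m'
    using X that unfolding mapping_cone_def by blast
  have \<iota>: "continuous_map L X \<iota>" and c: "\<And>j. j < k \<Longrightarrow> continuous_map (prod_topology (M j) unit_interval) X (c j)"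
    using mapping_cone_continuous[OF X] by auto
  have P: "continuous_map (prod_topology (M j) (top_of_set {-1..1})) X (P j)" if j: "j < k" for j
  proof -
    let ?D = "prod_topology (M j) (top_of_set {-1..1::real})"
    have snd: "continuous_map ?D euclideanreal snd"
      using continuous_map_snd[of "M j" "top_of_set {-1..1::real}"] by (simp add: continuous_map_in_subtopology)
    have "continuous_map ?D X (\<lambda>z. if snd z \<le> 0 then \<iota> (h j (- snd z, fst z)) else c j z)"
    proof (rule continuous_map_cases_le[OF snd])
      show "continuous_map ?D euclideanreal (\<lambda>x. 0)" by simp
      let ?D1 = "subtopology ?D {x. x \<in> topspace ?D \<and> snd x \<le> 0}"
      have "continuous_map ?D1 (prod_topology unit_interval (M j)) (\<lambda>z. (- snd z, fst z))"
        by (intro continuous_map_pairedI)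
           (auto simp: continuous_map_in_subtopology continuous_map_from_subtopology
              intro!: continuous_map_from_subtopology continuous_map_fst snd continuous_map_minus)
      from continuous_map_compose[OF this continuous_map_compose[OF h[OF j] \<iota>]]
      show "continuous_map ?D1 X (\<lambda>z. \<iota> (h j (- snd z, fst z)))" by (simp add: o_def)
      let ?D2 = "subtopology ?D {x. x \<in> topspace ?D \<and> 0 \<le> snd x}"
      have "continuous_map ?D2 (prod_topology (M j) unit_interval) (\<lambda>z. (fst z, snd z))"
        by (intro continuous_map_pairedI)
           (auto simp: continuous_map_in_subtopology intro!: continuous_map_from_subtopology continuous_map_fst snd)
      from continuous_map_compose[OF this c[OF j]]
      show "continuous_map ?D2 X (c j)" by (simp add: o_def)
      show "\<iota> (h j (- snd x, fst x)) = c j x" if "x \<in> topspace ?D" "snd x = 0" for x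
        using that h0[OF j] c0[OF j] by (cases x) auto
    qed
    then show ?thesis by (simp add: P_def[abs_def])
  qed
  have \<sigma>: "- 1 \<le> \<sigma> t \<and> \<sigma> t \<le> 1" if "t \<in> {0..1}" for t
    using that by (auto simp: \<sigma>_def max_def)
  have range: "- 1 \<le> (1 - s) * \<sigma> t + s * t \<and> (1 - s) * \<sigma> t + s * t \<le> 1" if "s \<in> {0..1}" "t \<in> {0..1}" for s t
  proof -
    have "(1 - s) * \<sigma> t + s * t \<le> (1 - s) * 1 + s * 1"
      using that \<sigma>[OF that(2)] by (intro add_mono mult_left_mono) auto
    moreover have "(1 - s) * (-1) + s * (-1) \<le> (1 - s) * \<sigma> t + s * t"
      using that \<sigma>[OF that(2)] by (intro add_mono mult_left_mono) auto
    ultimately show ?thesis by (auto simp: algebra_simps)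
  qed
  show ?thesis
  proof (rule mapping_cone_homotopic[OF X, where GL = "\<lambda>(s, l). \<iota> l"
        and G = "\<lambda>j (s, m, t). P j (m, (1 - s) * \<sigma> t + s * t)"])
    show "continuous_map (prod_topology unit_interval L) X (\<lambda>(s, l). \<iota> l)"
      using continuous_map_compose[OF continuous_map_snd \<iota>] by (simp add: o_def case_prod_unfold)
    show "continuous_map (prod_topology unit_interval (prod_topology (M j) unit_interval)) X
         (\<lambda>(s, m, t). P j (m, (1 - s) * \<sigma> t + s * t))" if j: "j < k" for j
    proof -
      let ?T = "prod_topology unit_interval (prod_topology (M j) unit_interval)"
      have s: "continuous_map ?T euclideanreal fst"
        using continuous_map_fst[of unit_interval "prod_topology (M j) unit_interval"]
        by (simp add: continuous_map_in_subtopology)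
      have t: "continuous_map ?T euclideanreal (\<lambda>x. snd (snd x))"
        using continuous_map_compose[OF continuous_map_snd continuous_map_snd, of unit_interval "M j" unit_interval]
        by (simp add: continuous_map_in_subtopology o_def)
      have m: "continuous_map ?T (M j) (\<lambda>x. fst (snd x))"
        using continuous_map_compose[OF continuous_map_snd continuous_map_fst, of unit_interval "M j" unit_interval]
        by (simp add: o_def)
      have "continuous_map ?T (prod_topology (M j) (top_of_set {-1..1}))
          (\<lambda>x. (fst (snd x), (1 - fst x) * \<sigma> (snd (snd x)) + fst x * snd (snd x)))"
        by (intro continuous_map_pairedI m)
           (use range in \<open>auto simp: continuous_map_in_subtopology \<sigma>_def intro!: continuous_intros s t\<close>)
      from continuous_map_compose[OF this P[OF j]] show ?thesis
        by (simp add: o_def case_prod_unfold)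
    qed
    show "(\<lambda>(s, m, t). P j (m, (1 - s) * \<sigma> t + s * t)) (s, m, 0) = (\<lambda>(s, l). \<iota> l) (s, f j m)"
      if "j < k" "m \<in> topspace (M j)" "s \<in> {0..1}" for j m s
      using that h0 by (simp add: P_def \<sigma>_def)
    show "(\<lambda>(s, m, t). P j (m, (1 - s) * \<sigma> t + s * t)) (s, m, 1) = (\<lambda>(s, m, t). P j (m, (1 - s) * \<sigma> t + s * t)) (s, m', 1)"
      if "j < k" "m \<in> topspace (M j)" "m' \<in> topspace (M j)" "s \<in> {0..1}" for j m m' s
      using c1[OF that(1-3)] by (simp add: P_def \<sigma>_def)
    show "(\<lambda>(s, m, t). P j (m, (1 - s) * \<sigma> t + s * t)) (0, m, t) = (\<Psi> \<circ> \<Phi>) (c j (m, t))"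
      if j: "j < k" and m: "m \<in> topspace (M j)" and t: "t \<in> {0..1}" for j m t
    \<comment> \<open>The composite follows \<open>h\<close> up to \<open>t = 1/2\<close>, returns
      along it until \<open>t = 3/4\<close> since the upper half is stretched twice, and climbs the
      cone afterwards. The two branches of \<open>\<sigma>\<close> meet at \<open>1/2\<close>, and
      the second one changes sign at \<open>3/4\<close>.\<close>
    proof (cases "t \<le> 1/2")
      case True
      then have "(\<Psi> \<circ> \<Phi>) (c j (m, t)) = \<iota> (h j (2*t, m))"
        using \<Phi>(2)[OF j m t] \<Psi>(1)[OF hL[OF j m]] t by simp
      then show ?thesis using True t by (auto simp: P_def \<sigma>_def max_absorb1)
    next
      case False
      have "(\<Psi> \<circ> \<Phi>) (c j (m, t)) = \<Psi> (d j (m, 2*t - 1))"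
        using False \<Phi>(2)[OF j m t] by simp
      also have "\<dots> = (if 2*t - 1 \<le> 1/2 then \<iota> (h j (1 - 2*(2*t-1), m)) else c j (m, 2*(2*t-1) - 1))"
        using False t by (intro \<Psi>(2)[OF j m]) auto
      finally show ?thesis using False t by (auto simp: P_def \<sigma>_def max_def algebra_simps)
    qed
    show "(\<lambda>(s, m, t). P j (m, (1 - s) * \<sigma> t + s * t)) (1, m, t) = id (c j (m, t))"
      if "j < k" "m \<in> topspace (M j)" "t \<in> {0..1}" for j m t
      using that h0 c0 by (auto simp: P_def)
  qed (use \<Phi>(1) \<Psi>(1) in auto)
qed

text \<open>To be applied with the inclusions of the links as \<open>f\<close> and constant maps as
  \<open>g\<close>.\<close>

theorem mapping_cone_homotopy_invariant:
  assumes X: "mapping_cone k L M f X \<iota> c" and W: "mapping_cone k L M g W \<kappa> d"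
    and fg: "\<And>j. j < k \<Longrightarrow> homotopic_with (\<lambda>_. True) (M j) L (f j) (g j)"
  shows "X homotopy_equivalent_space W"
proof -
  have "\<forall>j. \<exists>h. j < k \<longrightarrow> continuous_map (prod_topology unit_interval (M j)) L h \<and>
      (\<forall>m. h (0, m) = f j m) \<and> (\<forall>m. h (1, m) = g j m)"
    using fg unfolding homotopic_with_def by blast
  from choice[OF this] obtain h where h: "\<And>j. j < k \<Longrightarrow> continuous_map (prod_topology unit_interval (M j)) L (h j)"
    and h0: "\<And>j m. j < k \<Longrightarrow> h j (0, m) = f j m" and h1: "\<And>j m. j < k \<Longrightarrow> h j (1, m) = g j m"
    by blast
  \<comment> \<open>Stated for fresh cones and a fresh homotopy because it is needed twice: from
    \<open>X\<close> to \<open>W\<close> along \<open>h\<close>, and from \<open>W\<close> to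
    \<open>X\<close> along the reversed homotopy \<open>h'\<close>.\<close>
  have ext: "\<exists>F. continuous_map X W F \<and> (\<forall>l\<in>topspace L. F (\<iota> l) = \<kappa> l) \<and>
      (\<forall>j<k. \<forall>m\<in>topspace (M j). \<forall>t\<in>{0..1}.
         F (c j (m, t)) = (if t \<le> 1/2 then \<kappa> (h j (2*t, m)) else d j (m, 2*t - 1)))"
    if X: "mapping_cone k L M f X \<iota> c" and W: "mapping_cone k L M g W \<kappa> d"
      and h: "\<And>j. j < k \<Longrightarrow> continuous_map (prod_topology unit_interval (M j)) L (h j)"
      and h0: "\<And>j m. j < k \<Longrightarrow> h j (0, m) = f j m" and h1: "\<And>j m. j < k \<Longrightarrow> h j (1, m) = g j m"
    for f g h and X :: "'z topology" and W :: "'w topology" and \<iota> \<kappa> c d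
  proof -
    have \<kappa>: "continuous_map L W \<kappa>" and d: "\<And>j. j < k \<Longrightarrow> continuous_map (prod_topology (M j) unit_interval) W (d j)"
      using mapping_cone_continuous[OF W] by auto
    have d0: "d j (m, 0) = \<kappa> (g j m)" if "j < k" "m \<in> topspace (M j)" for j m
      using W that by (auto simp: mapping_cone_def)
    have d1: "d j (m, 1) = d j (m', 1)" if "j < k" "m \<in> topspace (M j)" "m' \<in> topspace (M j)" for j m m'
      using W that unfolding mapping_cone_def by blast
    obtain F where "continuous_map X W F" "\<And>l. l \<in> topspace L \<Longrightarrow> F (\<iota> l) = \<kappa> l"
      "\<And>j m t. \<lbrakk>j < k; m \<in> topspace (M j); t \<in> {0..1}\<rbrakk> \<Longrightarrow>
        F (c j (m, t)) = (\<lambda>(m, t). if t \<le> 1/2 then \<kappa> (h j (2*t, m)) else d j (m, 2*t - 1)) (m, t)"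
    proof (rule mapping_cone_extend[OF X \<kappa>, where g = "\<lambda>j (m, t). if t \<le> 1/2 then \<kappa> (h j (2*t, m)) else d j (m, 2*t - 1)"])
      show "continuous_map (prod_topology (M j) unit_interval) W
          (\<lambda>(m, t). if t \<le> 1/2 then \<kappa> (h j (2*t, m)) else d j (m, 2*t - 1))" if j: "j < k" for j
      proof -
        let ?D = "prod_topology (M j) unit_interval"
        have snd: "continuous_map ?D euclideanreal snd"
          using continuous_map_snd[of "M j" unit_interval] by (simp add: continuous_map_in_subtopology)
        have "continuous_map ?D W (\<lambda>z. if snd z \<le> 1/2 then \<kappa> (h j (2 * snd z, fst z)) else d j (fst z, 2 * snd z - 1))"
        proof (rule continuous_map_cases_le[OF snd])
          show "continuous_map ?D euclideanreal (\<lambda>x. 1/2)" by simp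
          let ?D1 = "subtopology ?D {x. x \<in> topspace ?D \<and> snd x \<le> 1/2}"
          have "continuous_map ?D1 (prod_topology unit_interval (M j)) (\<lambda>z. (2 * snd z, fst z))"
            by (intro continuous_map_pairedI)
               (auto simp: continuous_map_in_subtopology
                  intro!: continuous_map_from_subtopology continuous_map_fst snd continuous_map_real_mult_left)
          from continuous_map_compose[OF this continuous_map_compose[OF h[OF j] \<kappa>]]
          show "continuous_map ?D1 W (\<lambda>z. \<kappa> (h j (2 * snd z, fst z)))" by (simp add: o_def)
          let ?D2 = "subtopology ?D {x. x \<in> topspace ?D \<and> 1/2 \<le> snd x}"
          have "continuous_map ?D2 (prod_topology (M j) unit_interval) (\<lambda>z. (fst z, 2 * snd z - 1))"
            by (intro continuous_map_pairedI)
               (auto simp: continuous_map_in_subtopology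
                  intro!: continuous_map_from_subtopology continuous_map_fst snd continuous_map_real_mult_left continuous_map_diff)
          from continuous_map_compose[OF this d[OF j]]
          show "continuous_map ?D2 W (\<lambda>z. d j (fst z, 2 * snd z - 1))" by (simp add: o_def)
          show "\<kappa> (h j (2 * snd x, fst x)) = d j (fst x, 2 * snd x - 1)" if "x \<in> topspace ?D" "snd x = 1/2" for x
          proof -
            have "2 * snd x = 1" "fst x \<in> topspace (M j)" using that by auto
            then show ?thesis using h1[OF j] d0[OF j] by simp
          qed
        qed
        then show ?thesis by (simp add: case_prod_unfold)
      qed
    qed (use h0 in auto, use d1 in blast)
    then show ?thesis by (intro exI[of _ F]) auto
  qed
  obtain \<Phi> where \<Phi>: "continuous_map X W \<Phi>" "\<And>l. l \<in> topspace L \<Longrightarrow> \<Phi> (\<iota> l) = \<kappa> l"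
      "\<And>j m t. \<lbrakk>j < k; m \<in> topspace (M j); t \<in> {0..1}\<rbrakk> \<Longrightarrow>
         \<Phi> (c j (m, t)) = (if t \<le> 1/2 then \<kappa> (h j (2*t, m)) else d j (m, 2*t - 1))"
    using ext[OF X W h h0 h1] by (meson atLeastAtMost_iff)
  define h' where "h' j z = h j (1 - fst z, snd z)" for j and z :: "real \<times> 'a"
  have h': "continuous_map (prod_topology unit_interval (M j)) L (h' j)" if "j < k" for j
  proof -
    have "continuous_map (prod_topology unit_interval (M j)) euclideanreal fst"
      using continuous_map_fst[of unit_interval "M j"] by (simp add: continuous_map_in_subtopology)
    then have "continuous_map (prod_topology unit_interval (M j)) (prod_topology unit_interval (M j)) (\<lambda>z. (1 - fst z, snd z))"
      by (intro continuous_map_pairedI continuous_map_snd)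
         (auto simp: continuous_map_in_subtopology intro!: continuous_map_diff)
    from continuous_map_compose[OF this h[OF that]] show ?thesis
      by (simp add: o_def h'_def[abs_def])
  qed
  obtain \<Psi> where \<Psi>: "continuous_map W X \<Psi>" "\<And>l. l \<in> topspace L \<Longrightarrow> \<Psi> (\<kappa> l) = \<iota> l"
      "\<And>j m t. \<lbrakk>j < k; m \<in> topspace (M j); t \<in> {0..1}\<rbrakk> \<Longrightarrow>
         \<Psi> (d j (m, t)) = (if t \<le> 1/2 then \<iota> (h' j (2*t, m)) else c j (m, 2*t - 1))"
    using ext[OF W X h'] h0 h1 unfolding h'_def by (force simp: h0 h1)
  have "homotopic_with (\<lambda>_. True) X X (\<Psi> \<circ> \<Phi>) id"
    by (rule mapping_cone_left_inverse[OF X W h]) (use h0 h1 \<Phi> \<Psi> in \<open>auto simp: h'_def\<close>)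
  moreover have "homotopic_with (\<lambda>_. True) W W (\<Phi> \<circ> \<Psi>) id"
    by (rule mapping_cone_left_inverse[OF W X h']) (use h0 h1 \<Phi> \<Psi> in \<open>auto simp: h'_def\<close>)
  ultimately show ?thesis
    unfolding homotopy_equivalent_space_def using \<Phi>(1) \<Psi>(1) by blast
qed


section \<open>Pointed homotopy equivalences and wedge sums\<close>

definition pointed_equivalent :: "'a topology \<Rightarrow> 'a \<Rightarrow> 'b topology \<Rightarrow> 'b \<Rightarrow> bool" where
  "pointed_equivalent X a Z b \<longleftrightarrow> a \<in> topspace X \<and> b \<in> topspace Z \<and>
     (\<exists>f g. continuous_map X Z f \<and> continuous_map Z X g \<and> f a = b \<and> g b = a \<and>
        homotopic_with (\<lambda>h. h a = a) X X (g \<circ> f) id \<and> homotopic_with (\<lambda>h. h b = b) Z Z (f \<circ> g) id)"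

lemma pointed_equivalent_sym: "pointed_equivalent X a Z b \<Longrightarrow> pointed_equivalent Z b X a"
  unfolding pointed_equivalent_def by blast

text \<open>First \<open>k\<close> is contracted in the middle, then \<open>g\<close> and
  \<open>f\<close> cancel. This serves both the composition of equivalences and the passage from
  one-sided to two-sided inverses.\<close>

lemma homotopic_conjugate:
  assumes "continuous_map X Z f" "continuous_map Z X g" "f a = b" "g b = a"
    and "homotopic_with (\<lambda>h. h a = a) X X (g \<circ> f) id"
    and "homotopic_with (\<lambda>h. h b = b) Z Z k id"
  shows "homotopic_with (\<lambda>h. h a = a) X X (g \<circ> k \<circ> f) id"
proof -
  have "homotopic_with (\<lambda>h. h b = a) Z X (g \<circ> k) (g \<circ> id)"
    by (rule homotopic_with_compose_continuous_map_left[OF assms(6,2)]) (use assms in auto)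
  then have "homotopic_with (\<lambda>h. h a = a) X X (g \<circ> k \<circ> f) (g \<circ> id \<circ> f)"
    by (rule homotopic_with_compose_continuous_map_right[OF _ assms(1)]) (use assms in auto)
  then show ?thesis
    using homotopic_with_trans[OF _ assms(5)] by simp
qed

lemma pointed_equivalent_trans:
  assumes "pointed_equivalent X a Z b" "pointed_equivalent Z b U c"
  shows "pointed_equivalent X a U c"
proof -
  obtain f g where f: "continuous_map X Z f" "continuous_map Z X g" "f a = b" "g b = a"
    "homotopic_with (\<lambda>h. h a = a) X X (g \<circ> f) id" "homotopic_with (\<lambda>h. h b = b) Z Z (f \<circ> g) id"
    using assms(1) unfolding pointed_equivalent_def by blast
  obtain f' g' where f': "continuous_map Z U f'" "continuous_map U Z g'" "f' b = c" "g' c = b"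
    "homotopic_with (\<lambda>h. h b = b) Z Z (g' \<circ> f') id" "homotopic_with (\<lambda>h. h c = c) U U (f' \<circ> g') id"
    using assms(2) unfolding pointed_equivalent_def by blast
  have "homotopic_with (\<lambda>h. h a = a) X X ((g \<circ> g') \<circ> (f' \<circ> f)) id"
    using homotopic_conjugate[OF f(1-5) f'(5)] by (simp add: o_assoc)
  moreover have "homotopic_with (\<lambda>h. h c = c) U U ((f' \<circ> f) \<circ> (g \<circ> g')) id"
    using homotopic_conjugate[OF f'(2,1,4,3,6) f(6)] by (simp add: o_assoc)
  ultimately show ?thesis
    using assms f f' unfolding pointed_equivalent_def
    by (intro conjI exI[of _ "f' \<circ> f"] exI[of _ "g \<circ> g'"]) (auto intro: continuous_map_compose)
qed

lemma pointed_equivalent_homeomorphic: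
  assumes "homeomorphic_map X Z f" "a \<in> topspace X"
  shows "pointed_equivalent X a Z (f a)"
proof -
  obtain g where fg: "homeomorphic_maps X Z f g"
    using assms(1) by (auto simp: homeomorphic_map_maps)
  have fa: "f a \<in> topspace Z" "g (f a) = a"
    using fg assms(2) by (auto simp: homeomorphic_maps_def continuous_map_def)
  have "homotopic_with (\<lambda>h. h a = a) X X (g \<circ> f) id"
    using fg fa by (intro homotopic_with_equal) (auto simp: homeomorphic_maps_def continuous_map_compose)
  moreover have "homotopic_with (\<lambda>h. h (f a) = f a) Z Z (f \<circ> g) id"
    using fg fa by (intro homotopic_with_equal) (auto simp: homeomorphic_maps_def continuous_map_compose)
  ultimately show ?thesis
    using fg fa assms(2) unfolding pointed_equivalent_def homeomorphic_maps_def by blast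
qed

section \<open>Whiskers and nondegenerate base points\<close>

definition whisker :: "'a topology \<Rightarrow> 'a \<Rightarrow> ('a \<times> real) topology" where
  "whisker X a = subtopology (prod_topology X unit_interval) {z. snd z = 0 \<or> fst z = a}"

text \<open>The condition of a neighbourhood deformation retract: \<open>h\<close> pulls the
  neighbourhood \<open>u \<ge> 0\<close> of \<open>a\<close> into \<open>a\<close>. The function may
  be negative elsewhere, so that its positive part is a cut-off that can serve as height on a
  whisker.\<close>

definition well_pointed :: "'a topology \<Rightarrow> 'a \<Rightarrow> bool" where
  "well_pointed X a \<longleftrightarrow> a \<in> topspace X \<and> closedin X {a} \<and>
     (\<exists>h u. continuous_map (prod_topology unit_interval X) X h \<and>
        (\<forall>x\<in>topspace X. h (0, x) = x) \<and> (\<forall>t\<in>{0..1}. h (t, a) = a) \<and>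
        continuous_map X euclideanreal u \<and> u a = 1 \<and>
        (\<forall>x\<in>topspace X. u x \<le> 1 \<and> (0 \<le> u x \<longrightarrow> h (1, x) = a)))"

lemma topspace_whisker:
  "topspace (whisker X a) = {z. fst z \<in> topspace X \<and> 0 \<le> snd z \<and> snd z \<le> 1 \<and> (snd z = 0 \<or> fst z = a)}"
  by (auto simp: whisker_def)

lemma continuous_map_whisker:
  "continuous_map (whisker X a) X fst" "continuous_map (whisker X a) euclideanreal snd"
proof -
  show "continuous_map (whisker X a) X fst"
    unfolding whisker_def by (rule continuous_map_subtopology_fst)
  have "continuous_map (whisker X a) unit_interval snd"
    unfolding whisker_def by (rule continuous_map_subtopology_snd)
  then show "continuous_map (whisker X a) euclideanreal snd"
    by (simp add: continuous_map_in_subtopology)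
qed

lemma continuous_map_into_whisker:
  assumes "continuous_map U X p" "continuous_map U euclideanreal r"
    and "\<And>z. z \<in> topspace U \<Longrightarrow> 0 \<le> r z \<and> r z \<le> 1 \<and> (r z = 0 \<or> p z = a)"
  shows "continuous_map U (whisker X a) (\<lambda>z. (p z, r z))"
  using assms unfolding whisker_def continuous_map_in_subtopology
  by (auto intro!: continuous_map_pairedI simp: continuous_map_in_subtopology)

lemma continuous_map_from_unit_interval:
  "continuous_map (prod_topology unit_interval U) euclideanreal fst"
  using continuous_map_fst[of unit_interval U] by (simp add: continuous_map_in_subtopology)

lemma homotopic_withI:
  assumes "continuous_map (prod_topology unit_interval X) Z h"
    and "\<And>x. x \<in> topspace X \<Longrightarrow> h (0, x) = f x" "\<And>x. x \<in> topspace X \<Longrightarrow> h (1, x) = g x"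
    and "a \<in> topspace X" "\<And>t. t \<in> {0..1} \<Longrightarrow> h (t, a) = b"
  shows "homotopic_with (\<lambda>k. k a = b) X Z f g"
  by (subst homotopic_with) (use assms in auto)

text \<open>The projection \<open>fst\<close> acquires a homotopy inverse: \<open>h\<close> moves
  the neighbourhood of \<open>a\<close> onto \<open>a\<close> while the positive part of
  \<open>u\<close> pushes it up the whisker, so that \<open>a\<close> itself reaches the free
  end.\<close>

lemma pointed_equivalent_whisker:
  assumes "well_pointed X a"
  shows "pointed_equivalent X a (whisker X a) (a, 1)"
proof -
  obtain h u where a: "a \<in> topspace X"
    and h: "continuous_map (prod_topology unit_interval X) X h"
    and h0: "\<And>x. x \<in> topspace X \<Longrightarrow> h (0, x) = x" and ha: "\<And>t. t \<in> {0..1} \<Longrightarrow> h (t, a) = a"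
    and u: "continuous_map X euclideanreal u" "u a = 1" "\<And>x. x \<in> topspace X \<Longrightarrow> u x \<le> 1"
      "\<And>x. \<lbrakk>x \<in> topspace X; 0 \<le> u x\<rbrakk> \<Longrightarrow> h (1, x) = a"
    using assms unfolding well_pointed_def by auto
  let ?W = "whisker X a"
  define f where "f x = (h (1, x), max 0 (u x))" for x
  have h1: "continuous_map X X (\<lambda>x. h (1, x))"
  proof -
    have "continuous_map X (prod_topology unit_interval X) (\<lambda>x. (1, x))"
      by (intro continuous_map_pairedI) (auto simp: continuous_map_in_subtopology)
    from continuous_map_compose[OF this h] show ?thesis by (simp add: o_def)
  qed
  have f: "continuous_map X ?W f"
    unfolding f_def
  proof (rule continuous_map_into_whisker[OF h1])
    show "continuous_map X euclideanreal (\<lambda>x. max 0 (u x))"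
      by (intro continuous_intros u(1)) auto
    show "0 \<le> max 0 (u x) \<and> max 0 (u x) \<le> 1 \<and> (max 0 (u x) = 0 \<or> h (1, x) = a)" if "x \<in> topspace X" for x
      using u(3,4)[OF that] by (auto simp: max_def)
  qed
  have fa: "f a = (a, 1)" using ha[of 1] u(2) by (simp add: f_def)
  have aW: "(a, 1) \<in> topspace ?W" using a by (simp add: topspace_whisker)
  have 1: "homotopic_with (\<lambda>h. h a = a) X X id (fst \<circ> f)"
    by (rule homotopic_withI[OF h]) (use h0 ha a in \<open>auto simp: f_def\<close>)
  have hx: "continuous_map (prod_topology unit_interval ?W) X (\<lambda>z. h (k (fst z), fst (snd z)))"
    if "continuous_map unit_interval unit_interval k" for k
  proof -
    have "continuous_map (prod_topology unit_interval ?W) unit_interval (\<lambda>z. k (fst z))"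
      using continuous_map_compose[OF continuous_map_fst that] by (simp add: o_def)
    moreover have "continuous_map (prod_topology unit_interval ?W) X (\<lambda>z. fst (snd z))"
      using continuous_map_compose[OF continuous_map_snd continuous_map_whisker(1)] by (simp add: o_def)
    ultimately have "continuous_map (prod_topology unit_interval ?W) (prod_topology unit_interval X)
        (\<lambda>z. (k (fst z), fst (snd z)))"
      by (rule continuous_map_pairedI)
    from continuous_map_compose[OF this h] show ?thesis by (simp add: o_def)
  qed
  have sW: "continuous_map (prod_topology unit_interval ?W) euclideanreal (\<lambda>z. snd (snd z))"
    using continuous_map_compose[OF continuous_map_snd continuous_map_whisker(2)] by (simp add: o_def)
  have uW: "continuous_map (prod_topology unit_interval ?W) euclideanreal (\<lambda>z. u (fst (snd z)))"
    using continuous_map_compose[OF continuous_map_compose[OF continuous_map_snd continuous_map_whisker(1)] u(1)]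
    by (simp add: o_def)
  have 2: "homotopic_with (\<lambda>h. h (a, 1) = (a, 1)) ?W ?W id (\<lambda>z. (h (1, fst z), snd z))"
  proof (rule homotopic_withI[where h = "\<lambda>z. (h (fst z, fst (snd z)), snd (snd z))"])
    show "continuous_map (prod_topology unit_interval ?W) ?W (\<lambda>z. (h (fst z, fst (snd z)), snd (snd z)))"
      by (rule continuous_map_into_whisker[OF hx[of "\<lambda>t. t"] sW])
         (use ha in \<open>auto simp: topspace_whisker\<close>)
  qed (use h0 ha aW in \<open>auto simp: topspace_whisker\<close>)
  \<comment> \<open>After the body has been moved by \<open>h\<close>, only heights change: they
    rise towards the cut-off value, which is \<open>1\<close> over \<open>a\<close>, and the maximum
    keeps the free end in place throughout.\<close>
  have 3: "homotopic_with (\<lambda>h. h (a, 1) = (a, 1)) ?W ?W (\<lambda>z. (h (1, fst z), snd z)) (f \<circ> fst)"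
  proof (rule homotopic_withI[where h = "\<lambda>z. (h (1, fst (snd z)), max (snd (snd z)) (fst z * max 0 (u (fst (snd z)))))"])
    show "continuous_map (prod_topology unit_interval ?W) ?W
       (\<lambda>z. (h (1, fst (snd z)), max (snd (snd z)) (fst z * max 0 (u (fst (snd z))))))"
    proof (rule continuous_map_into_whisker)
      show "continuous_map (prod_topology unit_interval ?W) X (\<lambda>z. h (1, fst (snd z)))"
        by (rule hx[of "\<lambda>t. 1"]) auto
      show "continuous_map (prod_topology unit_interval ?W) euclideanreal
          (\<lambda>z. max (snd (snd z)) (fst z * max 0 (u (fst (snd z)))))"
        by (intro continuous_intros sW uW continuous_map_from_unit_interval) auto
      fix z assume z: "z \<in> topspace (prod_topology unit_interval ?W)"
      obtain \<tau> x s where [simp]: "z = (\<tau>, x, s)" by (metis prod.collapse)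
      have "\<tau> \<in> {0..1}" "x \<in> topspace X" "0 \<le> s" "s \<le> 1" "s = 0 \<or> x = a"
        using z by (auto simp: topspace_whisker)
      moreover have "\<tau> * max 0 (u x) \<le> 1 * 1"
        using u(3)[of x] calculation by (intro mult_mono) auto
      ultimately show "0 \<le> max (snd (snd z)) (fst z * max 0 (u (fst (snd z)))) \<and>
         max (snd (snd z)) (fst z * max 0 (u (fst (snd z)))) \<le> 1 \<and>
         (max (snd (snd z)) (fst z * max 0 (u (fst (snd z)))) = 0 \<or> h (1, fst (snd z)) = a)"
        using u(4)[of x] ha[of 1] by (cases "0 \<le> u x") (auto simp: max_def)
    qed
  qed (use h0 ha aW u in \<open>auto simp: topspace_whisker f_def max_def intro: order_antisym\<close>)
  have "homotopic_with (\<lambda>h. h (a, 1) = (a, 1)) ?W ?W (f \<circ> fst) id"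
    using homotopic_with_trans[OF 2 3] by (rule homotopic_with_symD)
  then show ?thesis
    unfolding pointed_equivalent_def
    using a aW f fa continuous_map_whisker(1) homotopic_with_symD[OF 1]
    by (intro conjI exI[of _ f] exI[of _ fst]) auto
qed

text \<open>The body and the whisker are closed pieces meeting in one point, the former because
  height is continuous, the latter because \<open>{a}\<close> is closed. The factor \<open>T\<close>
  carries the time of a homotopy.\<close>

lemma continuous_map_whisker_paste:
  assumes cl: "closedin X {a}"
    and p: "continuous_map (prod_topology T X) U p"
    and r: "continuous_map (prod_topology T unit_interval) U r"
    and pr: "\<And>t. t \<in> topspace T \<Longrightarrow> p (t, a) = r (t, 0)"
  shows "continuous_map (prod_topology T (whisker X a)) U
     (\<lambda>z. if snd (snd z) = 0 then p (fst z, fst (snd z)) else r (fst z, snd (snd z)))"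
proof -
  let ?D = "prod_topology T (whisker X a)"
  have x: "continuous_map ?D X (\<lambda>z. fst (snd z))"
    using continuous_map_compose[OF continuous_map_snd continuous_map_whisker(1)] by (simp add: o_def)
  have s: "continuous_map ?D euclideanreal (\<lambda>z. snd (snd z))"
    using continuous_map_compose[OF continuous_map_snd continuous_map_whisker(2)] by (simp add: o_def)
  have s': "continuous_map ?D unit_interval (\<lambda>z. snd (snd z))"
    using s by (auto simp: continuous_map_in_subtopology topspace_whisker)
  have "continuous_map ?D (prod_topology T X) (\<lambda>z. (fst z, fst (snd z)))"
    by (intro continuous_map_pairedI continuous_map_fst x)
  from continuous_map_compose[OF this p] have p': "continuous_map ?D U (\<lambda>z. p (fst z, fst (snd z)))"
    by (simp add: o_def)
  have "continuous_map ?D (prod_topology T unit_interval) (\<lambda>z. (fst z, snd (snd z)))"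
    by (intro continuous_map_pairedI continuous_map_fst s')
  from continuous_map_compose[OF this r] have r': "continuous_map ?D U (\<lambda>z. r (fst z, snd (snd z)))"
    by (simp add: o_def)
  show ?thesis
  proof (rule pasting_lemma_closed[where I = "{True, False}"
        and T = "\<lambda>b. if b then {z \<in> topspace ?D. snd (snd z) \<in> {0}} else {z \<in> topspace ?D. fst (snd z) \<in> {a}}"
        and f = "\<lambda>b z. if b then p (fst z, fst (snd z)) else r (fst z, snd (snd z))"])
    show "closedin ?D (if i then {z \<in> topspace ?D. snd (snd z) \<in> {0}} else {z \<in> topspace ?D. fst (snd z) \<in> {a}})"
      if "i \<in> {True, False}" for i
      using closedin_continuous_map_preimage[OF s, of "{0}"] closedin_continuous_map_preimage[OF x cl] by auto
    show "continuous_map (subtopology ?D (if i then {z \<in> topspace ?D. snd (snd z) \<in> {0}} else {z \<in> topspace ?D. fst (snd z) \<in> {a}})) U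
         (\<lambda>z. if i then p (fst z, fst (snd z)) else r (fst z, snd (snd z)))" if "i \<in> {True, False}" for i
      using p' r' by (cases i) (simp_all add: continuous_map_from_subtopology)
    fix z assume z: "z \<in> topspace ?D"
    then have z': "snd (snd z) = 0 \<or> fst (snd z) = a" "fst z \<in> topspace T"
      by (cases z; force simp: topspace_whisker)+
    then show "\<exists>j. j \<in> {True, False} \<and>
       z \<in> (if j then {z \<in> topspace ?D. snd (snd z) \<in> {0}} else {z \<in> topspace ?D. fst (snd z) \<in> {a}}) \<and>
       (if snd (snd z) = 0 then p (fst z, fst (snd z)) else r (fst z, snd (snd z))) =
       (if j then p (fst z, fst (snd z)) else r (fst z, snd (snd z)))"
      using z by (intro exI[of _ "snd (snd z) = 0"]) (auto simp del: topspace_prod_topology)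
  next
    fix i j z
    assume "z \<in> topspace ?D \<inter> (if i then {z \<in> topspace ?D. snd (snd z) \<in> {0}} else {z \<in> topspace ?D. fst (snd z) \<in> {a}}) \<inter>
       (if j then {z \<in> topspace ?D. snd (snd z) \<in> {0}} else {z \<in> topspace ?D. fst (snd z) \<in> {a}})"
    then have "i = j \<or> snd (snd z) = 0 \<and> fst (snd z) = a \<and> fst z \<in> topspace T"
      by (cases z; cases i; cases j) auto
    then show "(if i then p (fst z, fst (snd z)) else r (fst z, snd (snd z))) =
        (if j then p (fst z, fst (snd z)) else r (fst z, snd (snd z)))"
      using pr[of "fst z"] by (cases i; cases j) auto
  qed simp
qed

text \<open>A free map has no reason to send \<open>a\<close> to \<open>b\<close>. The lower half of
  the whisker is spent on a path from \<open>f a\<close> to \<open>b\<close> and the upper half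
  covers the target whisker, so the free ends correspond.\<close>

definition whisker_map :: "('a \<Rightarrow> 'b) \<Rightarrow> (real \<Rightarrow> 'b) \<Rightarrow> 'a \<times> real \<Rightarrow> 'b \<times> real" where
  "whisker_map f \<gamma> z = (if snd z = 0 then (f (fst z), 0) else (\<gamma> (min 1 (2 * snd z)), max 0 (2 * snd z - 1)))"

lemma continuous_map_whisker_map:
  assumes cl: "closedin X {a}" and f: "continuous_map X Z f" and \<gamma>: "continuous_map unit_interval Z \<gamma>"
    and ends: "\<gamma> 0 = f a" "\<gamma> 1 = b"
  shows "continuous_map (whisker X a) (whisker Z b) (whisker_map f \<gamma>)"
proof -
  let ?T = "unit_interval"
  have "continuous_map (prod_topology ?T X) (whisker Z b) (\<lambda>z. (f (snd z), 0))"
    using continuous_map_compose[OF continuous_map_snd f]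
    by (intro continuous_map_into_whisker) (auto simp: o_def)
  moreover have "continuous_map (prod_topology ?T unit_interval) (whisker Z b)
      (\<lambda>z. (\<gamma> (min 1 (2 * snd z)), max 0 (2 * snd z - 1)))"
  proof (rule continuous_map_into_whisker)
    have s: "continuous_map (prod_topology ?T unit_interval) euclideanreal snd"
      using continuous_map_snd[of ?T unit_interval] by (simp add: continuous_map_in_subtopology)
    have "continuous_map (prod_topology ?T unit_interval) euclideanreal (\<lambda>z. min 1 (2 * snd z))"
      by (intro continuous_map_real_min continuous_map_real_mult_left s) simp
    then have "continuous_map (prod_topology ?T unit_interval) unit_interval (\<lambda>z. min 1 (2 * snd z))"
      by (rule continuous_map_into_subtopology) auto
    from continuous_map_compose[OF this \<gamma>]
    show "continuous_map (prod_topology ?T unit_interval) Z (\<lambda>z. \<gamma> (min 1 (2 * snd z)))"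
      by (simp add: o_def)
    show "continuous_map (prod_topology ?T unit_interval) euclideanreal (\<lambda>z. max 0 (2 * snd z - 1))"
      by (intro continuous_map_real_max continuous_map_diff continuous_map_real_mult_left s) simp_all
  qed (use ends in \<open>auto simp: max_def min_def\<close>)
  ultimately have "continuous_map (prod_topology ?T (whisker X a)) (whisker Z b)
     (\<lambda>z. if snd (snd z) = 0 then (\<lambda>z. (f (snd z), 0)) (fst z, fst (snd z))
        else (\<lambda>z. (\<gamma> (min 1 (2 * snd z)), max 0 (2 * snd z - 1))) (fst z, snd (snd z)))"
    by (rule continuous_map_whisker_paste[OF cl]) (use ends in auto)
  then have 1: "continuous_map (prod_topology ?T (whisker X a)) (whisker Z b) (\<lambda>z. whisker_map f \<gamma> (snd z))"
    by (rule continuous_map_eq) (auto simp: whisker_map_def)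
  have "continuous_map (whisker X a) (prod_topology ?T (whisker X a)) (\<lambda>z. (0, z))"
    by (intro continuous_map_pairedI) (auto simp: continuous_map_in_subtopology)
  from continuous_map_compose[OF this 1] show ?thesis
    by (simp add: o_def)
qed

text \<open>\<open>\<delta>\<close> has to undo \<open>\<gamma>\<close> up to the motion of
  \<open>a\<close> under the homotopy \<open>H\<close> from \<open>g \<circ> f\<close> to the
  identity: it is \<open>g \<circ> \<gamma>\<close> reversed, followed by the track of
  \<open>a\<close> under \<open>H\<close>.\<close>

lemma whisker_map_left_inverse:
  assumes a: "a \<in> topspace X" and cl: "closedin X {a}"
    and f: "continuous_map X Z f" and g: "continuous_map Z X g"
    and gf: "homotopic_with (\<lambda>_. True) X X (g \<circ> f) id"
    and \<gamma>: "continuous_map unit_interval Z \<gamma>" "\<gamma> 0 = f a" "\<gamma> 1 = b"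
  obtains \<delta> where "continuous_map unit_interval X \<delta>" "\<delta> 0 = g b" "\<delta> 1 = a"
    "homotopic_with (\<lambda>h. h (a, 1) = (a, 1)) (whisker X a) (whisker X a) (whisker_map g \<delta> \<circ> whisker_map f \<gamma>) id"
proof -
  obtain H where H: "continuous_map (prod_topology unit_interval X) X H"
    and H0: "\<And>x. H (0, x) = g (f x)" and H1: "\<And>x. H (1, x) = x"
    using gf unfolding homotopic_with_def by auto
  have Ha: "continuous_map T X (\<lambda>z. H (k z, a))" if "continuous_map T unit_interval k" for T :: "'z topology" and k
  proof -
    have "continuous_map T (prod_topology unit_interval X) (\<lambda>z. (k z, a))"
      using that a by (intro continuous_map_pairedI) auto
    from continuous_map_compose[OF this H] show ?thesis by (simp add: o_def)
  qed
  have g\<gamma>: "continuous_map T X (\<lambda>z. g (\<gamma> (k z)))" if "continuous_map T unit_interval k" for T :: "'z topology" and k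
    using continuous_map_compose[OF that continuous_map_compose[OF \<gamma>(1) g]] by (simp add: o_def)
  define \<delta> where "\<delta> r = (if r \<le> 1/2 then g (\<gamma> (1 - 2 * r)) else H (2 * r - 1, a))" for r :: real
  define B where "B y = (if y \<le> -1 then g (\<gamma> (- 1 - y)) else H (min 1 (y + 1), a), max 0 y)" for y :: real
  \<comment> \<open>\<open>B\<close> runs backwards along \<open>g \<circ> \<gamma>\<close>, then along the homotopy at \<open>a\<close> and finally along the
    whisker. The composite and the identity restrict to \<open>B \<circ> \<sigma>\<close> and \<open>B\<close> on the whisker.\<close>
  define \<sigma> :: "real \<Rightarrow> real" where "\<sigma> s = max (- 1 - 2 * s) (min (8 * s - 6) (4 * s - 3))" for s
  have id: "continuous_map (subtopology (top_of_set S) R) euclideanreal (\<lambda>y. y)"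
     "continuous_map (top_of_set S) euclideanreal (\<lambda>y. y)" for S R :: "real set"
    by (simp_all add: continuous_map_from_subtopology)
  have "continuous_map unit_interval X (\<lambda>r. if r \<le> 1/2 then g (\<gamma> (1 - 2 * r)) else H (2 * r - 1, a))"
  proof (rule continuous_map_cases_le)
    show "g (\<gamma> (1 - 2 * r)) = H (2 * r - 1, a)" if "r = 1/2" for r
      unfolding that using H0 \<gamma>(2) by simp
  qed (auto intro!: g\<gamma> Ha continuous_intros id simp: continuous_map_in_subtopology)
  then have \<delta>: "continuous_map unit_interval X \<delta>" by (simp add: \<delta>_def[abs_def])
  have \<delta>01: "\<delta> 0 = g b" "\<delta> 1 = a" using \<gamma> H1 by (auto simp: \<delta>_def)
  have B: "continuous_map (top_of_set {-2..1}) (whisker X a) B"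
    unfolding B_def[abs_def]
  proof (rule continuous_map_into_whisker)
    show "continuous_map (top_of_set {-2..1}) X (\<lambda>y. if y \<le> -1 then g (\<gamma> (- 1 - y)) else H (min 1 (y + 1), a))"
    proof (rule continuous_map_cases_le)
      show "g (\<gamma> (- 1 - y)) = H (min 1 (y + 1), a)" if "y = -1" for y
        unfolding that using H0 \<gamma>(2) by simp
    qed (auto intro!: g\<gamma> Ha continuous_intros id simp: continuous_map_in_subtopology)
    show "continuous_map (top_of_set {-2..1}) euclideanreal (\<lambda>y. max 0 y)"
      by (intro continuous_intros id)
  qed (auto simp: H1 max_def)
  have \<sigma>: "\<sigma> s \<in> {-2..1}" if "s \<in> {0..1}" for s
    using that by (auto simp: \<sigma>_def max_def min_def)
  have range: "(1 - t) * \<sigma> s + t * s \<in> {-2..1}" if "s \<in> {0..1}" "t \<in> {0..1}" for s t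
  proof -
    have "(1 - t) * \<sigma> s + t * s \<le> (1 - t) * 1 + t * 1"
      using that \<sigma>[OF that(1)] by (intro add_mono mult_left_mono) auto
    moreover have "(1 - t) * (-2) + t * (-2) \<le> (1 - t) * \<sigma> s + t * s"
      using that \<sigma>[OF that(1)] by (intro add_mono mult_left_mono) auto
    ultimately show ?thesis by (auto simp: algebra_simps)
  qed
  let ?K = "\<lambda>z. if snd (snd z) = 0 then (\<lambda>z. (H z, 0)) (fst z, fst (snd z))
      else (\<lambda>z. B ((1 - fst z) * \<sigma> (snd z) + fst z * snd z)) (fst z, snd (snd z))"
  have K: "continuous_map (prod_topology unit_interval (whisker X a)) (whisker X a) ?K"
  proof (rule continuous_map_whisker_paste[OF cl])
    show "continuous_map (prod_topology unit_interval X) (whisker X a) (\<lambda>z. (H z, 0))"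
      by (rule continuous_map_into_whisker[OF H]) auto
    have "continuous_map (prod_topology unit_interval unit_interval) euclideanreal snd"
      using continuous_map_snd[of unit_interval unit_interval] by (simp add: continuous_map_in_subtopology)
    then have "continuous_map (prod_topology unit_interval unit_interval) (top_of_set {-2..1})
       (\<lambda>z. (1 - fst z) * \<sigma> (snd z) + fst z * snd z)"
      using continuous_map_from_unit_interval range
      by (auto simp: continuous_map_in_subtopology \<sigma>_def intro!: continuous_intros)
    from continuous_map_compose[OF this B]
    show "continuous_map (prod_topology unit_interval unit_interval) (whisker X a)
       (\<lambda>z. B ((1 - fst z) * \<sigma> (snd z) + fst z * snd z))" by (simp add: o_def)
    \<comment> \<open>At the foot of the whisker the parameter is \<open>t - 1\<close>, where
      \<open>B\<close> is on the track of \<open>a\<close>; this is why the homotopy on the body and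
      the reparametrization on the whisker fit together.\<close>
    show "(H (t, a), 0) = B ((1 - fst (t, 0::real)) * \<sigma> (snd (t, 0)) + fst (t, 0) * snd (t, 0))"
      if "t \<in> topspace unit_interval" for t
      using that H0 \<gamma>(2) by (auto simp: B_def \<sigma>_def)
  qed
  have "homotopic_with (\<lambda>h. h (a, 1) = (a, 1)) (whisker X a) (whisker X a) (whisker_map g \<delta> \<circ> whisker_map f \<gamma>) id"
  proof (rule homotopic_withI[OF K])
    fix z assume z: "z \<in> topspace (whisker X a)"
    obtain x s where [simp]: "z = (x, s)" by (cases z)
    have s: "0 \<le> s" "s \<le> 1" "s = 0 \<or> x = a" using z by (auto simp: topspace_whisker)
    show "?K (1, z) = id z"
      using s H1 by (auto simp: B_def)
    show "?K (0, z) = (whisker_map g \<delta> \<circ> whisker_map f \<gamma>) z"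
    proof (cases "s = 0")
      case True
      then show ?thesis using H0 by (simp add: whisker_map_def)
    next
      case False
      \<comment> \<open>The path \<open>\<gamma>\<close> ends at \<open>1/2\<close>. The rest of the
        whisker is stretched to unit length, where \<open>\<delta>\<close> occupies the first half,
        hence \<open>3/4\<close>; and \<open>\<delta>\<close> itself changes from the reversed path
        to \<open>H\<close> in the middle, hence \<open>5/8\<close>.\<close>
      consider "s \<le> 1/2" | "1/2 < s" "s \<le> 5/8" | "5/8 < s" "s \<le> 3/4" | "3/4 < s" by linarith
      then show ?thesis
      proof cases
        case 1
        then have "whisker_map f \<gamma> z = (\<gamma> (2 * s), 0)" "\<sigma> s = - 1 - 2 * s"
          using False by (auto simp: whisker_map_def \<sigma>_def)
        then show ?thesis using False s by (simp add: B_def whisker_map_def)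
      next
        case 2
        then have "whisker_map f \<gamma> z = (b, 2 * s - 1)" "\<sigma> s = 8 * s - 6"
          using False \<gamma>(3) by (auto simp: whisker_map_def \<sigma>_def)
        then show ?thesis using False s 2 by (simp add: B_def whisker_map_def \<delta>_def)
      next
        case 3
        then have "whisker_map f \<gamma> z = (b, 2 * s - 1)" "\<sigma> s = 8 * s - 6"
          using False \<gamma>(3) by (auto simp: whisker_map_def \<sigma>_def)
        then show ?thesis using False s 3 by (simp add: B_def whisker_map_def \<delta>_def)
      next
        case 4
        then have "whisker_map f \<gamma> z = (b, 2 * s - 1)" "\<sigma> s = 4 * s - 3"
          using False \<gamma>(3) by (auto simp: whisker_map_def \<sigma>_def)
        then show ?thesis using False s 4 by (simp add: B_def whisker_map_def \<delta>_def)
      qed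
    qed
  next
    show "(a, 1) \<in> topspace (whisker X a)" using a by (simp add: topspace_whisker)
    show "?K (t, a, 1) = (a, 1)" if "t \<in> {0..1}" for t
      using H1 by (simp add: B_def \<sigma>_def)
  qed
  then show ?thesis using \<delta> \<delta>01 that by blast
qed

text \<open>The preceding lemma produces only one-sided inverses. Applied once more, to
  \<open>\<delta>\<close>, it yields \<open>?F'\<close> with \<open>?F' \<circ> ?G\<close> homotopic
  to the identity; as \<open>?G \<circ> ?F\<close> is so too, \<open>?F\<close> and
  \<open>?F'\<close> are homotopic and \<open>?G\<close> is a two-sided inverse.\<close>

lemma pointed_equivalent_whiskers:
  assumes XY: "X homotopy_equivalent_space Z" and pc: "path_connected_space Z"
    and a: "a \<in> topspace X" "closedin X {a}" and b: "b \<in> topspace Z" "closedin Z {b}"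
  shows "pointed_equivalent (whisker X a) (a, 1) (whisker Z b) (b, 1)"
proof -
  obtain f g where f: "continuous_map X Z f" and g: "continuous_map Z X g"
    and gf: "homotopic_with (\<lambda>x. True) X X (g \<circ> f) id" and fg: "homotopic_with (\<lambda>x. True) Z Z (f \<circ> g) id"
    using XY unfolding homotopy_equivalent_space_def by blast
  have "f a \<in> topspace Z" using f a by (auto simp: continuous_map_def)
  then obtain \<gamma> where \<gamma>: "continuous_map unit_interval Z \<gamma>" "\<gamma> 0 = f a" "\<gamma> 1 = b"
    using path_connected_space_imp_path_component_of[OF pc _ b(1)]
    by (force simp: path_component_of_def pathin_def)
  obtain \<delta> where \<delta>: "continuous_map unit_interval X \<delta>" "\<delta> 0 = g b" "\<delta> 1 = a"
    and 1: "homotopic_with (\<lambda>h. h (a, 1) = (a, 1)) (whisker X a) (whisker X a) (whisker_map g \<delta> \<circ> whisker_map f \<gamma>) id"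
    using whisker_map_left_inverse[OF a f g gf \<gamma>] .
  obtain \<gamma>' where \<gamma>': "continuous_map unit_interval Z \<gamma>'" "\<gamma>' 0 = f a" "\<gamma>' 1 = b"
    and 2: "homotopic_with (\<lambda>h. h (b, 1) = (b, 1)) (whisker Z b) (whisker Z b) (whisker_map f \<gamma>' \<circ> whisker_map g \<delta>) id"
    using whisker_map_left_inverse[OF b g f fg \<delta>] .
  let ?F = "whisker_map f \<gamma>" and ?G = "whisker_map g \<delta>" and ?F' = "whisker_map f \<gamma>'"
  have F: "continuous_map (whisker X a) (whisker Z b) ?F" "?F (a, 1) = (b, 1)"
    using continuous_map_whisker_map[OF a(2) f \<gamma>] \<gamma>(3) by (auto simp: whisker_map_def)
  have F': "continuous_map (whisker X a) (whisker Z b) ?F'" "?F' (a, 1) = (b, 1)"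
    using continuous_map_whisker_map[OF a(2) f \<gamma>'] \<gamma>'(3) by (auto simp: whisker_map_def)
  have G: "continuous_map (whisker Z b) (whisker X a) ?G" "?G (b, 1) = (a, 1)"
    using continuous_map_whisker_map[OF b(2) g \<delta>] \<delta>(3) by (auto simp: whisker_map_def)
  have "homotopic_with (\<lambda>h. h (b, 1) = (b, 1)) (whisker Z b) (whisker Z b) (?F' \<circ> ?G \<circ> (?F \<circ> ?G)) (id \<circ> (?F \<circ> ?G))"
    by (rule homotopic_with_compose_continuous_map_right[OF 2])
       (use F G in \<open>auto intro: continuous_map_compose\<close>)
  then have 3: "homotopic_with (\<lambda>h. h (b, 1) = (b, 1)) (whisker Z b) (whisker Z b) (?F \<circ> ?G) (?F' \<circ> (?G \<circ> ?F) \<circ> ?G)"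
    by (auto dest: homotopic_with_symD simp: o_assoc)
  have 4: "homotopic_with (\<lambda>h. h (b, 1) = (b, 1)) (whisker Z b) (whisker Z b) (?F' \<circ> (?G \<circ> ?F) \<circ> ?G) id"
    using homotopic_conjugate[OF G(1) F'(1) G(2) F'(2) 2 1] .
  show ?thesis
    unfolding pointed_equivalent_def
    using F G 1 homotopic_with_trans[OF 3 4] a(1) b(1)
    by (intro conjI exI[of _ ?F] exI[of _ ?G]) (auto simp: topspace_whisker)
qed

text \<open>Once whiskers are grown, closed base points suffice for a pointed equivalence;
  nondegeneracy enters in removing the whiskers again.\<close>

theorem pointed_equivalent_of_homotopy_equivalent:
  assumes "X homotopy_equivalent_space Z" "path_connected_space Z" "well_pointed X a" "well_pointed Z b"
  shows "pointed_equivalent X a Z b"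
proof -
  have "pointed_equivalent (whisker X a) (a, 1) (whisker Z b) (b, 1)"
  proof (rule pointed_equivalent_whiskers[OF assms(1,2)])
    show "a \<in> topspace X" "closedin X {a}" using assms(3) unfolding well_pointed_def by blast+
    show "b \<in> topspace Z" "closedin Z {b}" using assms(4) unfolding well_pointed_def by blast+
  qed
  then show ?thesis
    using pointed_equivalent_trans[OF pointed_equivalent_trans[OF pointed_equivalent_whisker[OF assms(3)]]
        pointed_equivalent_sym[OF pointed_equivalent_whisker[OF assms(4)]]] by simp
qed

section \<open>Wedge sums of pointed equivalent spaces\<close>

lemma joint_quotient_wedge:
  assumes "Xs \<noteq> []" "\<And>i. i < length Xs \<Longrightarrow> snd (Xs ! i) \<in> topspace (fst (Xs ! i))"
  shows "joint_quotient {..<length Xs} (\<lambda>i. fst (Xs ! i)) (wedge Xs) (\<lambda>i x. wedge_proj Xs (i, x))"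
proof -
  have "\<forall>(X, p) \<in> set Xs. p \<in> topspace X"
  proof (intro ballI, clarify)
    fix X p assume "(X, p) \<in> set Xs"
    then obtain i where "i < length Xs" "Xs ! i = (X, p)" by (auto simp: in_set_conv_nth)
    then show "p \<in> topspace X" using assms(2)[of i] by simp
  qed
  then show ?thesis
    using quotient_map_wedge_proj[OF assms(1)] by (simp add: joint_quotient_def)
qed

text \<open>Homotopies of the summands that keep the base points fixed agree on \<open>None\<close>
  at every time, and therefore glue. It is needed for both composites of a pair of inverse maps
  between wedges.\<close>

lemma wedge_map_homotopic:
  assumes Xs: "Xs \<noteq> []" and p: "\<And>i. i < length Xs \<Longrightarrow> snd (Xs ! i) \<in> topspace (fst (Xs ! i))"
    and k: "\<And>i. i < length Xs \<Longrightarrow> homotopic_with (\<lambda>h. h (snd (Xs ! i)) = snd (Xs ! i)) (fst (Xs ! i)) (fst (Xs ! i)) (k i) id"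
    and K: "\<And>i x. \<lbrakk>i < length Xs; x \<in> topspace (fst (Xs ! i))\<rbrakk> \<Longrightarrow> K (wedge_proj Xs (i, x)) = wedge_proj Xs (i, k i x)"
  shows "homotopic_with (\<lambda>_. True) (wedge Xs) (wedge Xs) K id"
proof -
  let ?q = "\<lambda>i x. wedge_proj Xs (i, x)" and ?X = "\<lambda>i. fst (Xs ! i)" and ?p = "\<lambda>i. snd (Xs ! i)"
  note jq0 = joint_quotient_wedge[OF Xs p]
  note lc = unit_interval_locally_compact_Hausdorff
  have jq: "joint_quotient {..<length Xs} (\<lambda>j. prod_topology unit_interval (?X j)) (prod_topology unit_interval (wedge Xs))
     (\<lambda>j (t, a). (t, ?q j a))"
    by (rule joint_quotient_prod[OF jq0 lc])
  have "\<forall>i. \<exists>h. i < length Xs \<longrightarrow> continuous_map (prod_topology unit_interval (?X i)) (?X i) h \<and>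
      (\<forall>x. h (0, x) = k i x) \<and> (\<forall>x. h (1, x) = x) \<and> (\<forall>t\<in>{0..1}. h (t, ?p i) = ?p i)"
    using k unfolding homotopic_with_def by fastforce
  from choice[OF this] obtain h where h: "\<And>i. i < length Xs \<Longrightarrow> continuous_map (prod_topology unit_interval (?X i)) (?X i) (h i)"
    and h0: "\<And>i x. i < length Xs \<Longrightarrow> h i (0, x) = k i x" and h1: "\<And>i x. i < length Xs \<Longrightarrow> h i (1, x) = x"
    and hp: "\<And>i t. i < length Xs \<Longrightarrow> t \<in> {0..1} \<Longrightarrow> h i (t, ?p i) = ?p i"
    by blast
  have "\<exists>F. continuous_map (prod_topology unit_interval (wedge Xs)) (wedge Xs) F \<and>
     (\<forall>j\<in>{..<length Xs}. \<forall>a\<in>topspace (prod_topology unit_interval (?X j)). F ((\<lambda>(t, a). (t, ?q j a)) a) = ?q j (h j a))"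
  proof (rule joint_quotient_extend[OF jq, of "wedge Xs" "\<lambda>j a. ?q j (h j a)"])
    show "continuous_map (prod_topology unit_interval (?X j)) (wedge Xs) (\<lambda>a. ?q j (h j a))" if "j \<in> {..<length Xs}" for j
      using continuous_map_compose[OF h joint_quotient_continuous[OF jq0]] that by (simp add: o_def)
    show "?q i (h i a) = ?q j (h j b)"
      if "i \<in> {..<length Xs}" "j \<in> {..<length Xs}" "a \<in> topspace (prod_topology unit_interval (?X i))"
        "b \<in> topspace (prod_topology unit_interval (?X j))" "(\<lambda>(t, a). (t, ?q i a)) a = (\<lambda>(t, a). (t, ?q j a)) b" for i j a b
      using that hp by (cases a; cases b) (auto simp: wedge_proj_def split: if_splits)
  qed (intro exI conjI ballI; assumption?; simp only:)
  then obtain F where F: "continuous_map (prod_topology unit_interval (wedge Xs)) (wedge Xs) F"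
    "\<And>j t x. \<lbrakk>j < length Xs; t \<in> {0..1}; x \<in> topspace (?X j)\<rbrakk> \<Longrightarrow> F (t, ?q j x) = ?q j (h j (t, x))"
    by force
  have "F (0, w) = K w \<and> F (1, w) = w" if w: "w \<in> topspace (wedge Xs)" for w
  proof -
    obtain i x where "i < length Xs" "x \<in> topspace (?X i)" "w = ?q i x"
      using joint_quotient_surj[OF jq0 w] by (metis lessThan_iff)
    then show ?thesis using F(2) h0 h1 K by simp
  qed
  then show ?thesis
    by (subst homotopic_with) (use F(1) in auto)
qed

theorem wedge_homotopy_equivalent:
  assumes len: "length Xs = length Ys" and Xs: "Xs \<noteq> []"
    and eq: "\<And>i. i < length Xs \<Longrightarrow> pointed_equivalent (fst (Xs ! i)) (snd (Xs ! i)) (fst (Ys ! i)) (snd (Ys ! i))"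
  shows "wedge Xs homotopy_equivalent_space wedge Ys"
proof -
  let ?X = "\<lambda>i. fst (Xs ! i)" and ?a = "\<lambda>i. snd (Xs ! i)" and ?Z = "\<lambda>i. fst (Ys ! i)" and ?b = "\<lambda>i. snd (Ys ! i)"
  have Ys: "Ys \<noteq> []" using len Xs by auto
  have a: "\<And>i. i < length Xs \<Longrightarrow> ?a i \<in> topspace (?X i)" and b: "\<And>i. i < length Ys \<Longrightarrow> ?b i \<in> topspace (?Z i)"
    using eq len by (auto simp: pointed_equivalent_def)
  note jX = joint_quotient_wedge[OF Xs a] and jY = joint_quotient_wedge[OF Ys b]
  have "\<forall>i. \<exists>f g. i < length Xs \<longrightarrow> continuous_map (?X i) (?Z i) f \<and> continuous_map (?Z i) (?X i) g \<and>
     f (?a i) = ?b i \<and> g (?b i) = ?a i \<and>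
        homotopic_with (\<lambda>h. h (?a i) = ?a i) (?X i) (?X i) (g \<circ> f) id \<and> homotopic_with (\<lambda>h. h (?b i) = ?b i) (?Z i) (?Z i) (f \<circ> g) id"
    using eq unfolding pointed_equivalent_def by blast
  from choice[OF this] obtain f where "\<forall>i. \<exists>g. i < length Xs \<longrightarrow> continuous_map (?X i) (?Z i) (f i) \<and> continuous_map (?Z i) (?X i) g \<and>
     f i (?a i) = ?b i \<and> g (?b i) = ?a i \<and>
        homotopic_with (\<lambda>h. h (?a i) = ?a i) (?X i) (?X i) (g \<circ> f i) id \<and> homotopic_with (\<lambda>h. h (?b i) = ?b i) (?Z i) (?Z i) (f i \<circ> g) id"
    by blast
  from choice[OF this] obtain g where f: "\<And>i. i < length Xs \<Longrightarrow> continuous_map (?X i) (?Z i) (f i)" "\<And>i. i < length Xs \<Longrightarrow> f i (?a i) = ?b i"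
    and g: "\<And>i. i < length Xs \<Longrightarrow> continuous_map (?Z i) (?X i) (g i)" "\<And>i. i < length Xs \<Longrightarrow> g i (?b i) = ?a i"
    and gf: "\<And>i. i < length Xs \<Longrightarrow> homotopic_with (\<lambda>h. h (?a i) = ?a i) (?X i) (?X i) (g i \<circ> f i) id"
    and fg: "\<And>i. i < length Xs \<Longrightarrow> homotopic_with (\<lambda>h. h (?b i) = ?b i) (?Z i) (?Z i) (f i \<circ> g i) id"
    by blast
  have ext: "\<exists>F. continuous_map (wedge Xs) (wedge Ys) F \<and>
      (\<forall>i<length Xs. \<forall>x\<in>topspace (fst (Xs ! i)). F (wedge_proj Xs (i, x)) = wedge_proj Ys (i, f i x))"
    if Xs: "Xs \<noteq> []" and Ys: "Ys \<noteq> []" and len: "length Xs = length Ys"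
      and a: "\<And>i. i < length Xs \<Longrightarrow> snd (Xs ! i) \<in> topspace (fst (Xs ! i))"
      and b: "\<And>i. i < length Ys \<Longrightarrow> snd (Ys ! i) \<in> topspace (fst (Ys ! i))"
      and f: "\<And>i. i < length Xs \<Longrightarrow> continuous_map (fst (Xs ! i)) (fst (Ys ! i)) (f i)"
        "\<And>i. i < length Xs \<Longrightarrow> f i (snd (Xs ! i)) = snd (Ys ! i)"
    for Xs :: "('x topology \<times> 'x) list" and Ys :: "('y topology \<times> 'y) list" and f
  proof (rule joint_quotient_extend[OF joint_quotient_wedge[OF Xs a], of "wedge Ys" "\<lambda>i x. wedge_proj Ys (i, f i x)"])
    show "continuous_map (fst (Xs ! j)) (wedge Ys) (\<lambda>x. wedge_proj Ys (j, f j x))" if "j \<in> {..<length Xs}" for j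
      using continuous_map_compose[OF f(1) joint_quotient_continuous[OF joint_quotient_wedge[OF Ys b]]] that len
      by (simp add: o_def)
    show "wedge_proj Ys (i, f i x) = wedge_proj Ys (j, f j y)"
      if "i \<in> {..<length Xs}" "j \<in> {..<length Xs}" "wedge_proj Xs (i, x) = wedge_proj Xs (j, y)" for i j x y
      using that f(2) by (auto simp: wedge_proj_def split: if_splits)
  qed auto
  obtain F where F: "continuous_map (wedge Xs) (wedge Ys) F"
    "\<And>i x. i < length Xs \<Longrightarrow> x \<in> topspace (?X i) \<Longrightarrow> F (wedge_proj Xs (i, x)) = wedge_proj Ys (i, f i x)"
    using ext[OF Xs Ys len a b f] by blast
  obtain G where G: "continuous_map (wedge Ys) (wedge Xs) G"
    "\<And>i x. i < length Ys \<Longrightarrow> x \<in> topspace (?Z i) \<Longrightarrow> G (wedge_proj Ys (i, x)) = wedge_proj Xs (i, g i x)"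
    using ext[OF Ys Xs len[symmetric] b a, of g] g len by auto
  have fY: "f i x \<in> topspace (?Z i)" if "i < length Xs" "x \<in> topspace (?X i)" for i x
    using f(1)[OF that(1)] that(2) by (auto simp: continuous_map_def)
  have gX: "g i x \<in> topspace (?X i)" if "i < length Xs" "x \<in> topspace (?Z i)" for i x
    using g(1)[OF that(1)] that(2) by (auto simp: continuous_map_def)
  have "homotopic_with (\<lambda>_. True) (wedge Xs) (wedge Xs) (G \<circ> F) id"
    by (rule wedge_map_homotopic[OF Xs a gf]) (use F G fY len in auto)
  moreover have "homotopic_with (\<lambda>_. True) (wedge Ys) (wedge Ys) (F \<circ> G) id"
    by (rule wedge_map_homotopic[OF Ys b, where k = "\<lambda>i. f i \<circ> g i"]) (use F G gX len fg in auto)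
  ultimately show ?thesis
    unfolding homotopy_equivalent_space_def using F(1) G(1) by blast
qed


section \<open>Realizations of finite simplicial complexes\<close>

definition simplicial :: "'a set set \<Rightarrow> bool" where
  "simplicial K \<longleftrightarrow> finite (\<Union>K) \<and> (\<forall>\<sigma>\<in>K. \<forall>\<tau>\<subseteq>\<sigma>. \<tau> \<in> K)"

lemma simplicial_subset: "\<lbrakk>simplicial K; \<sigma> \<in> K; \<tau> \<subseteq> \<sigma>\<rbrakk> \<Longrightarrow> \<tau> \<in> K"
  by (auto simp: simplicial_def)

lemma simplicial_finite: "\<lbrakk>simplicial K; \<sigma> \<in> K\<rbrakk> \<Longrightarrow> finite \<sigma>"
  by (meson Union_upper finite_subset simplicial_def)

lemma topspace_realization:
  "topspace (realization K) = {x. (\<forall>v. 0 \<le> x v) \<and> {v. x v \<noteq> 0} \<in> K \<and> (\<Sum>v | x v \<noteq> 0. x v) = 1}"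
  by (simp add: realization_def)

lemma in_realization_iff:
  assumes "simplicial K"
  shows "x \<in> topspace (realization K) \<longleftrightarrow> (\<forall>v. 0 \<le> x v) \<and> {v. x v \<noteq> 0} \<in> K \<and> sum x (\<Union>K) = 1"
proof -
  have "sum x (\<Union>K) = (\<Sum>v | x v \<noteq> 0. x v)" if "{v. x v \<noteq> 0} \<in> K"
    by (rule sum.mono_neutral_right) (use assms that in \<open>auto simp: simplicial_def\<close>)
  then show ?thesis by (auto simp: topspace_realization)
qed

lemma realization_support: "x \<in> topspace (realization K) \<Longrightarrow> {v. x v \<noteq> 0} \<in> K"
  by (simp add: topspace_realization)

lemma realization_nonneg: "x \<in> topspace (realization K) \<Longrightarrow> 0 \<le> x v"
  by (simp add: topspace_realization)

lemma realization_sum: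
  assumes "x \<in> topspace (realization K)" "finite S" "{v. x v \<noteq> 0} \<subseteq> S"
  shows "sum x S = 1"
proof -
  have "sum x S = (\<Sum>v | x v \<noteq> 0. x v)"
    by (rule sum.mono_neutral_right) (use assms in auto)
  then show ?thesis using assms(1) by (simp add: topspace_realization)
qed

lemma in_realizationI:
  assumes "\<And>v. 0 \<le> x v" "{v. x v \<noteq> 0} \<in> K" "finite S" "{v. x v \<noteq> 0} \<subseteq> S" "sum x S = 1"
  shows "x \<in> topspace (realization K)"
proof -
  have "sum x S = (\<Sum>v | x v \<noteq> 0. x v)"
    by (rule sum.mono_neutral_right) (use assms in auto)
  then show ?thesis using assms by (simp add: topspace_realization)
qed

lemma continuous_map_realization: "continuous_map (realization K) euclideanreal (\<lambda>x. x v)"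
  unfolding realization_def
  by (rule continuous_map_from_subtopology) (rule continuous_map_product_projection, simp)

lemma continuous_map_into_realization:
  assumes "\<And>v. continuous_map X euclideanreal (\<lambda>z. f z v)"
    and "\<And>z. z \<in> topspace X \<Longrightarrow> f z \<in> topspace (realization K)"
  shows "continuous_map X (realization K) f"
  unfolding realization_def
proof (rule continuous_map_into_subtopology)
  show "continuous_map X (powertop_real UNIV) f"
    using assms(1) by (simp add: continuous_map_componentwise_UNIV)
qed (use assms(2) in \<open>auto simp: topspace_realization\<close>)

lemma Hausdorff_realization: "Hausdorff_space (realization K)"
  unfolding realization_def
  by (rule Hausdorff_space_subtopology) (simp add: Hausdorff_space_product_topology)

text \<open>The realization is a finite union of closed simplices \<open>?T \<sigma>\<close> inside
  a cube, which is compact by Tychonoff's theorem even if the vertex type is infinite.\<close>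

lemma compact_realization:
  assumes K: "simplicial K"
  shows "compact_space (realization K)"
proof -
  let ?P = "powertop_real UNIV :: ('a \<Rightarrow> real) topology"
  let ?S = "{x :: 'a \<Rightarrow> real. (\<forall>v. 0 \<le> x v) \<and> {v. x v \<noteq> 0} \<in> K \<and> (\<Sum>v | x v \<noteq> 0. x v) = 1}"
  let ?T = "\<lambda>\<sigma>. (\<Inter>v. {x \<in> topspace ?P. x v \<in> {0..}}) \<inter> (\<Inter>v\<in>-\<sigma>. {x \<in> topspace ?P. x v \<in> {0}}) \<inter>
     {x \<in> topspace ?P. sum x \<sigma> \<in> {1}}"
  have cont: "continuous_map ?P euclideanreal (\<lambda>x. x v)" for v
    by (rule continuous_map_product_projection) simp
  have fin: "finite K"
    using K finite_subset[of K "Pow (\<Union>K)"] by (auto simp: simplicial_def)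
  have "?S = (\<Union>\<sigma>\<in>K. ?T \<sigma>)"
  proof (intro equalityI subsetI)
    fix x assume "x \<in> ?S"
    then show "x \<in> (\<Union>\<sigma>\<in>K. ?T \<sigma>)" by (intro UN_I[of "{v. x v \<noteq> 0}"]) auto
  next
    fix x assume "x \<in> (\<Union>\<sigma>\<in>K. ?T \<sigma>)"
    then obtain \<sigma> where \<sigma>: "\<sigma> \<in> K" "\<And>v. 0 \<le> x v" "\<And>v. v \<notin> \<sigma> \<Longrightarrow> x v = 0" "sum x \<sigma> = 1" by auto
    then have "x \<in> topspace (realization K)"
      using simplicial_subset[OF K \<sigma>(1), of "{v. x v \<noteq> 0}"] simplicial_finite[OF K \<sigma>(1)]
      by (intro in_realizationI[where S = \<sigma>]) auto
    then show "x \<in> ?S" by (simp add: topspace_realization)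
  qed
  moreover have "closedin ?P (?T \<sigma>)" if "\<sigma> \<in> K" for \<sigma>
  proof (intro closedin_Int)
    show "closedin ?P (\<Inter>v. {x \<in> topspace ?P. x v \<in> {0..}})"
      by (intro closedin_INT closedin_continuous_map_preimage[OF cont]) auto
    show "closedin ?P {x \<in> topspace ?P. sum x \<sigma> \<in> {1}}"
      by (intro closedin_continuous_map_preimage[where Y = euclideanreal] continuous_map_sum cont)
         (use simplicial_finite[OF K that] in auto)
    show "closedin ?P (\<Inter>v\<in>-\<sigma>. {x \<in> topspace ?P. x v \<in> {0}})"
    proof (cases "-\<sigma> = {}")
      case False
      then show ?thesis by (intro closedin_INT closedin_continuous_map_preimage[OF cont]) auto
    next
      case True
      have "\<sigma> = UNIV" using True by auto
      then show ?thesis using closedin_topspace[of ?P] by simp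
    qed
  qed
  ultimately have "closedin ?P ?S"
    using fin by (auto intro: closedin_Union)
  moreover have "?S \<subseteq> PiE UNIV (\<lambda>_. {0..1})"
  proof
    fix x assume "x \<in> ?S"
    then have x: "x \<in> topspace (realization K)" by (simp add: topspace_realization)
    have "x v \<le> 1" for v
    proof (cases "x v = 0")
      case False
      have "x v \<le> (\<Sum>v | x v \<noteq> 0. x v)"
        using False x simplicial_finite[OF K realization_support[OF x]] realization_nonneg[OF x]
        by (intro member_le_sum) auto
      then show ?thesis using x by (simp add: topspace_realization)
    qed simp
    then show "x \<in> PiE UNIV (\<lambda>_. {0..1})" using realization_nonneg[OF x] by auto
  qed
  moreover have "compactin ?P (PiE UNIV (\<lambda>_. {0..1}))"
    by (simp add: compactin_PiE)
  ultimately have "compactin ?P ?S"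
    by (meson closed_compactin)
  then show ?thesis
    unfolding realization_def by (simp add: compact_space_subtopology)
qed

lemma realization_mono: "K \<subseteq> K' \<Longrightarrow> topspace (realization K) \<subseteq> topspace (realization K')"
  by (auto simp: topspace_realization)

lemma continuous_map_realization_mono:
  assumes "K \<subseteq> K'" "continuous_map X (realization K) f"
  shows "continuous_map X (realization K') f"
proof (rule continuous_map_into_realization)
  show "continuous_map X euclideanreal (\<lambda>z. f z v)" for v
    using continuous_map_compose[OF assms(2) continuous_map_realization] by (simp add: o_def)
  show "f z \<in> topspace (realization K')" if "z \<in> topspace X" for z
    using assms(2) that realization_mono[OF assms(1)] by (auto simp: continuous_map_def)
qed

lemma in_realization_segment:
  assumes K: "simplicial K" and x: "x \<in> topspace (realization K)" and y: "y \<in> topspace (realization K)"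
    and xy: "{v. x v \<noteq> 0} \<union> {v. y v \<noteq> 0} \<in> K" and t: "0 \<le> t" "t \<le> 1"
  shows "(\<lambda>v. (1 - t) * x v + t * y v) \<in> topspace (realization K)"
proof (rule in_realizationI[where S = "{v. x v \<noteq> 0} \<union> {v. y v \<noteq> 0}"])
  show "finite ({v. x v \<noteq> 0} \<union> {v. y v \<noteq> 0})"
    using simplicial_finite[OF K xy] .
  show "{v. (1 - t) * x v + t * y v \<noteq> 0} \<in> K"
    by (rule simplicial_subset[OF K xy]) auto
  have "sum x ({v. x v \<noteq> 0} \<union> {v. y v \<noteq> 0}) = 1" "sum y ({v. x v \<noteq> 0} \<union> {v. y v \<noteq> 0}) = 1"
    using realization_sum[OF x simplicial_finite[OF K xy]] realization_sum[OF y simplicial_finite[OF K xy]] by auto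
  then show "(\<Sum>v\<in>{v. x v \<noteq> 0} \<union> {v. y v \<noteq> 0}. (1 - t) * x v + t * y v) = 1"
    by (simp add: sum.distrib flip: sum_distrib_left)
qed (use t realization_nonneg[OF x] realization_nonneg[OF y] in auto)

text \<open>Contiguity: if the carriers of both images lie in a common face, so does the segment
  between them, and the straight-line homotopy stays in the polyhedron.\<close>

lemma homotopic_realization:
  assumes K: "simplicial K" and f: "continuous_map X (realization K) f" and g: "continuous_map X (realization K) g"
    and fg: "\<And>x. x \<in> topspace X \<Longrightarrow> {v. f x v \<noteq> 0} \<union> {v. g x v \<noteq> 0} \<in> K"
  shows "homotopic_with (\<lambda>_. True) X (realization K) f g"
proof -
  let ?h = "\<lambda>z v. (1 - fst z) * f (snd z) v + fst z * g (snd z) v"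
  have "continuous_map (prod_topology unit_interval X) (realization K) ?h"
  proof (rule continuous_map_into_realization)
    have "continuous_map (prod_topology unit_interval X) euclideanreal (\<lambda>z. f (snd z) v)"
         "continuous_map (prod_topology unit_interval X) euclideanreal (\<lambda>z. g (snd z) v)" for v
      using continuous_map_compose[OF continuous_map_snd continuous_map_compose[OF f continuous_map_realization]]
        continuous_map_compose[OF continuous_map_snd continuous_map_compose[OF g continuous_map_realization]]
      by (simp_all add: o_def)
    then show "continuous_map (prod_topology unit_interval X) euclideanreal (\<lambda>z. ?h z v)" for v
      by (intro continuous_map_add continuous_map_real_mult continuous_map_diff continuous_map_from_unit_interval) auto
    fix z assume "z \<in> topspace (prod_topology unit_interval X)"
    then have z: "0 \<le> fst z" "fst z \<le> 1" "snd z \<in> topspace X" by auto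
    then have "f (snd z) \<in> topspace (realization K)" "g (snd z) \<in> topspace (realization K)"
      using f g by (auto simp: continuous_map_def)
    then show "?h z \<in> topspace (realization K)"
      using in_realization_segment[OF K _ _ fg[OF z(3)] z(1,2)] by simp
  qed
  then show ?thesis
    by (subst homotopic_with) auto
qed

definition vertex :: "'a \<Rightarrow> 'a \<Rightarrow> real" where
  "vertex v = (\<lambda>w. if w = v then 1 else 0)"

lemma vertex_support: "{w. vertex v w \<noteq> 0} = {v}"
  by (auto simp: vertex_def)

lemma vertex_in_realization: "{v} \<in> K \<Longrightarrow> vertex v \<in> topspace (realization K)"
  by (rule in_realizationI[where S = "{v}"]) (auto simp: vertex_def)

lemma path_component_realization:
  assumes "simplicial K" "x \<in> topspace (realization K)" "y \<in> topspace (realization K)"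
    and "{v. x v \<noteq> 0} \<union> {v. y v \<noteq> 0} \<in> K"
  shows "path_component_of (realization K) x y"
proof -
  have "homotopic_with (\<lambda>_. True) (discrete_topology {()}) (realization K) (\<lambda>_. x) (\<lambda>_. y)"
    by (rule homotopic_realization) (use assms in auto)
  moreover have "discrete_topology {()} \<noteq> trivial_topology"
    by (metis insert_not_empty topspace_discrete_topology)
  ultimately show ?thesis by (simp add: homotopic_constant_maps)
qed

lemma continuous_map_Min:
  assumes "finite A" "A \<noteq> {}" "\<And>a. a \<in> A \<Longrightarrow> continuous_map X euclideanreal (\<lambda>x. f x a)"
  shows "continuous_map X euclideanreal (\<lambda>x. Min (f x ` A))"
  using assms
proof (induction rule: finite_ne_induct)
  case (insert a A)
  then have "continuous_map X euclideanreal (\<lambda>x. min (f x a) (Min (f x ` A)))"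
    by (intro continuous_map_real_min) auto
  then show ?case using insert by simp
qed simp

text \<open>From any point in the open star of the carrier of \<open>a\<close> the segment to
  \<open>a\<close> stays in the polyhedron. Hence every point, not only a vertex, is a nondegenerate
  base point.\<close>

lemma well_pointed_realization:
  assumes K: "simplicial K" and a: "a \<in> topspace (realization K)"
  shows "well_pointed (realization K) a"
proof -
  let ?R = "realization K" and ?A = "{v. a v \<noteq> 0}"
  have A: "?A \<in> K" "finite ?A"
    using a simplicial_finite[OF K realization_support[OF a]] realization_support[OF a] by auto
  have "?A \<noteq> {}"
  proof
    assume "?A = {}"
    then have "sum a ?A = 0" by simp
    then show False using a by (simp add: topspace_realization)
  qed
  note A = A this
  have apos: "0 < a v" if "v \<in> ?A" for v
    using that realization_nonneg[OF a, of v] by simp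
  \<comment> \<open>\<open>m\<close> is positive on the open star of the carrier of \<open>a\<close>, and \<open>m x = 1\<close> only for \<open>x = a\<close>.\<close>
  define m where "m x = Min ((\<lambda>v. x v / a v) ` ?A)" for x
  have m: "continuous_map ?R euclideanreal m"
    unfolding m_def
    by (rule continuous_map_Min[OF A(2,3)])
       (use A in \<open>auto intro!: continuous_map_real_divide continuous_map_realization\<close>)
  have ma: "m a = 1"
  proof -
    have "(\<lambda>v. a v / a v) ` ?A = {1}" using A(3) by (auto simp: image_iff)
    then show ?thesis by (simp add: m_def)
  qed
  have m_le: "m x * a v \<le> x v" if "v \<in> ?A" for x v
  proof -
    have "m x \<le> x v / a v" unfolding m_def using that A(2) by (intro Min_le) auto
    then show ?thesis using apos[OF that] by (simp add: pos_le_divide_eq)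
  qed
  have m0: "0 \<le> m x" if "x \<in> topspace ?R" for x
    unfolding m_def using A realization_nonneg[OF that] realization_nonneg[OF a] by (auto simp: Min_ge_iff)
  have m1: "m x \<le> 1" if x: "x \<in> topspace ?R" for x
  proof -
    let ?S = "{v. x v \<noteq> 0} \<union> ?A"
    have fin: "finite ?S" using A(2) simplicial_finite[OF K realization_support[OF x]] by simp
    have "m x * sum a ?S \<le> sum x ?S"
      unfolding sum_distrib_left
    proof (rule sum_mono)
      show "m x * a v \<le> x v" for v
        using m_le[of v x] realization_nonneg[OF x, of v] by (cases "a v = 0") auto
    qed
    then show ?thesis
      using realization_sum[OF x fin] realization_sum[OF a fin] by auto
  qed
  \<comment> \<open>The weight given to \<open>a\<close>: it vanishes where \<open>m\<close> does,
    so nothing moves outside the open star, and at time \<open>1\<close> it reaches \<open>1\<close>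
    as soon as \<open>m x \<ge> 1/2\<close>. This explains the choice of \<open>2 * m x - 1\<close>
    for the function in \<open>well_pointed\<close>.\<close>
  define s where "s t x = t * min 1 (2 * m x)" for t x
  define h where "h z = (\<lambda>v. (1 - s (fst z) (snd z)) * snd z v + s (fst z) (snd z) * a v)" for z
  let ?D = "prod_topology unit_interval ?R"
  have coord: "continuous_map ?D euclideanreal (\<lambda>z. snd z v)" for v
    using continuous_map_compose[OF continuous_map_snd continuous_map_realization] by (simp add: o_def)
  have mD: "continuous_map ?D euclideanreal (\<lambda>z. m (snd z))"
    using continuous_map_compose[OF continuous_map_snd m] by (simp add: o_def)
  have sD: "continuous_map ?D euclideanreal (\<lambda>z. s (fst z) (snd z))"
    unfolding s_def
    by (intro continuous_map_real_mult continuous_map_real_min continuous_map_from_unit_interval mD) auto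
  have hc: "continuous_map ?D ?R h"
  proof (rule continuous_map_into_realization)
    show "continuous_map ?D euclideanreal (\<lambda>z. h z v)" for v
      unfolding h_def
      by (intro continuous_map_add continuous_map_real_mult continuous_map_diff coord sD) auto
    fix z assume "z \<in> topspace ?D"
    then have z: "0 \<le> fst z" "fst z \<le> 1" "snd z \<in> topspace ?R" by auto
    have s: "0 \<le> s (fst z) (snd z)" "s (fst z) (snd z) \<le> 1"
      using z m0[OF z(3)] by (auto simp: s_def mult_le_one)
    show "h z \<in> topspace ?R"
    proof (cases "m (snd z) = 0")
      case True
      then show ?thesis using z by (simp add: h_def s_def)
    next
      case False
      have "?A \<subseteq> {v. snd z v \<noteq> 0}"
      proof
        fix v assume v: "v \<in> ?A"
        have "0 < m (snd z) * a v" using False m0[OF z(3)] apos[OF v] by simp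
        then show "v \<in> {v. snd z v \<noteq> 0}" using m_le[OF v, of "snd z"] by auto
      qed
      then have "{v. snd z v \<noteq> 0} \<union> ?A \<in> K"
        using realization_support[OF z(3)] by (simp add: Un_absorb2)
      then show ?thesis unfolding h_def using in_realization_segment[OF K z(3) a _ s] by simp
    qed
  qed
  have h0: "h (0, x) = x" for x by (simp add: h_def s_def)
  have ha: "h (t, a) = a" for t by (auto simp: h_def algebra_simps)
  have uc: "continuous_map ?R euclideanreal (\<lambda>x. 2 * m x - 1)"
    by (intro continuous_map_diff continuous_map_real_mult_left m) simp
  have u: "2 * m x - 1 \<le> 1" "0 \<le> 2 * m x - 1 \<Longrightarrow> h (1, x) = a" if "x \<in> topspace ?R" for x
    using m1[OF that] by (auto simp: h_def s_def)
  have cl: "closedin ?R {a}"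
    by (simp add: closedin_Hausdorff_sing_eq Hausdorff_realization a)
  show ?thesis
    unfolding well_pointed_def
  proof (intro conjI exI[of _ h] exI[of _ "\<lambda>x. 2 * m x - 1"] ballI impI)
    show "2 * m a - 1 = 1" using ma by simp
  qed (use a cl hc h0 ha uc u in simp_all)
qed

text \<open>The homotopy from the retraction to the identity may move points of \<open>K'\<close>.
  This weaker form is transitive, and suffices both for homotopy equivalences and for deforming
  inclusions.\<close>

definition deformation_retract :: "'a set set \<Rightarrow> 'a set set \<Rightarrow> bool" where
  "deformation_retract K K' \<longleftrightarrow> K' \<subseteq> K \<and>
     (\<exists>r. continuous_map (realization K) (realization K') r \<and> (\<forall>x\<in>topspace (realization K'). r x = x) \<and>
        homotopic_with (\<lambda>_. True) (realization K) (realization K) r id)"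

lemma deformation_retract_refl: "deformation_retract K K"
  unfolding deformation_retract_def by (intro conjI exI[of _ id]) auto

lemma deformation_retract_trans:
  assumes "deformation_retract K K'" "deformation_retract K' K''"
  shows "deformation_retract K K''"
proof -
  obtain r where r: "K' \<subseteq> K" "continuous_map (realization K) (realization K') r" "\<And>x. x \<in> topspace (realization K') \<Longrightarrow> r x = x"
    "homotopic_with (\<lambda>_. True) (realization K) (realization K) r id"
    using assms(1) by (auto simp: deformation_retract_def)
  obtain r' where r': "K'' \<subseteq> K'" "continuous_map (realization K') (realization K'') r'" "\<And>x. x \<in> topspace (realization K'') \<Longrightarrow> r' x = x"
    "homotopic_with (\<lambda>_. True) (realization K') (realization K') r' id"
    using assms(2) by (auto simp: deformation_retract_def)
  have "homotopic_with (\<lambda>_. True) (realization K) (realization K') (r' \<circ> r) (id \<circ> r)"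
    by (rule homotopic_with_compose_continuous_map_right[OF r'(4) r(2)]) simp
  moreover have "continuous_map (realization K') (realization K) id"
    by (rule continuous_map_realization_mono[OF r(1)]) simp
  ultimately have "homotopic_with (\<lambda>_. True) (realization K) (realization K) (id \<circ> (r' \<circ> r)) (id \<circ> (id \<circ> r))"
    by (rule homotopic_with_compose_continuous_map_left) simp
  then have "homotopic_with (\<lambda>_. True) (realization K) (realization K) (r' \<circ> r) id"
    using homotopic_with_trans[OF _ r(4)] by simp
  moreover have "(r' \<circ> r) x = x" if "x \<in> topspace (realization K'')" for x
    using that realization_mono[OF r'(1)] r(3)[of x] r'(3)[of x] by auto
  ultimately show ?thesis
    unfolding deformation_retract_def
    using r(1) r'(1) continuous_map_compose[OF r(2) r'(2)] by (intro conjI exI[of _ "r' \<circ> r"]) auto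
qed

lemma deformation_retract_homotopy_equivalent:
  assumes "deformation_retract K K'"
  shows "realization K homotopy_equivalent_space realization K'"
proof -
  obtain r where r: "K' \<subseteq> K" "continuous_map (realization K) (realization K') r" "\<And>x. x \<in> topspace (realization K') \<Longrightarrow> r x = x"
    "homotopic_with (\<lambda>_. True) (realization K) (realization K) r id"
    using assms by (auto simp: deformation_retract_def)
  have "continuous_map (realization K') (realization K) id"
    by (rule continuous_map_realization_mono[OF r(1)]) simp
  then show ?thesis
    using r by (intro deformation_retract_imp_homotopy_equivalent_space) (auto simp: retraction_maps_def)
qed

text \<open>If the link of the face \<open>e\<close> is a cone with apex \<open>u\<close>, then pushing the mass common to all
  vertices of \<open>e\<close> to \<open>u\<close> removes the open star of \<open>e\<close>.\<close>

lemma deformation_retract_cone_link: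
  assumes K: "simplicial K" and e: "finite e" "e \<noteq> {}" "u \<notin> e"
    and cone: "\<And>\<sigma>. \<lbrakk>\<sigma> \<in> K; e \<subseteq> \<sigma>\<rbrakk> \<Longrightarrow> insert u \<sigma> \<in> K"
  shows "deformation_retract K {\<sigma> \<in> K. \<not> e \<subseteq> \<sigma>}"
proof -
  let ?K' = "{\<sigma> \<in> K. \<not> e \<subseteq> \<sigma>}"
  define m where "m x = Min (x ` e)" for x :: "'a \<Rightarrow> real"
  \<comment> \<open>The factor \<open>card e\<close> preserves the total mass, because the minimum
    is taken off every vertex of \<open>e\<close>; the vertices attaining it drop to
    \<open>0\<close>, so the image avoids the open star of \<open>e\<close>.\<close>
  define r where "r x = (\<lambda>v. x v - (if v \<in> e then m x else 0) + (if v = u then card e * m x else 0))" for x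
  have m: "continuous_map (realization K) euclideanreal m"
    unfolding m_def by (rule continuous_map_Min[OF e(1,2)]) (rule continuous_map_realization)
  have m_le: "m x \<le> x v" if "v \<in> e" for x v
    unfolding m_def using that e(1) by simp
  have m_arg: "\<exists>v\<in>e. m x = x v" for x
  proof -
    have "Min (x ` e) \<in> x ` e" using e(1,2) by (intro Min_in) auto
    then obtain v where "v \<in> e" "Min (x ` e) = x v" by blast
    then show ?thesis unfolding m_def by blast
  qed
  have m0: "0 \<le> m x" if "x \<in> topspace (realization K)" for x
    using m_arg[of x] realization_nonneg[OF that] by auto
  have supp: "insert u {v. x v \<noteq> 0} \<in> K" if x: "x \<in> topspace (realization K)" and "m x \<noteq> 0" for x
  proof (rule cone[OF realization_support[OF x]])
    have "0 < m x" using m0[OF x] that(2) by simp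
    then show "e \<subseteq> {v. x v \<noteq> 0}" using m_le[of _ x] by force
  qed
  have union: "{v. r x v \<noteq> 0} \<union> {v. x v \<noteq> 0} \<in> K" if x: "x \<in> topspace (realization K)" for x
  proof (cases "m x = 0")
    case True
    then have "r x = x" by (auto simp: r_def)
    then show ?thesis using realization_support[OF x] by simp
  next
    case False
    have "e \<subseteq> {v. x v \<noteq> 0}" using m_le[of _ x] m0[OF x] False by force
    then have "{v. r x v \<noteq> 0} \<union> {v. x v \<noteq> 0} \<subseteq> insert u {v. x v \<noteq> 0}"
      by (auto simp: r_def split: if_splits)
    then show ?thesis using simplicial_subset[OF K supp[OF x False]] by blast
  qed
  have rK': "r x \<in> topspace (realization ?K')" if x: "x \<in> topspace (realization K)" for x
  proof (rule in_realizationI)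
    let ?S = "insert u ({v. x v \<noteq> 0} \<union> e)"
    show fin: "finite ?S"
      using e(1) simplicial_finite[OF K realization_support[OF x]] by simp
    show "0 \<le> r x v" for v
      using m_le[of v x] m0[OF x] realization_nonneg[OF x, of v] by (auto simp: r_def)
    show "{v. r x v \<noteq> 0} \<subseteq> ?S"
      by (auto simp: r_def split: if_splits)
    obtain v where v: "v \<in> e" "m x = x v" using m_arg by blast
    then have "r x v = 0" using e(3) by (auto simp: r_def)
    then have "\<not> e \<subseteq> {v. r x v \<noteq> 0}" using v by auto
    then show "{v. r x v \<noteq> 0} \<in> ?K'"
      using simplicial_subset[OF K union[OF x]] by auto
    have "sum (r x) ?S = sum x ?S - (\<Sum>v\<in>?S. if v \<in> e then m x else 0) + (\<Sum>v\<in>?S. if v = u then card e * m x else 0)"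
      unfolding r_def by (simp only: sum.distrib sum_subtractf)
    also have "(\<Sum>v\<in>?S. if v \<in> e then m x else 0) = card e * m x"
    proof -
      have "(\<Sum>v\<in>?S. if v \<in> e then m x else 0) = (\<Sum>v\<in>e. m x)"
        using fin by (intro sum.mono_neutral_cong_right) auto
      then show ?thesis by simp
    qed
    also have "(\<Sum>v\<in>?S. if v = u then card e * m x else 0) = card e * m x"
      using fin by (simp add: sum.delta)
    also have "sum x ?S = 1"
      by (rule realization_sum[OF x fin]) auto
    finally show "sum (r x) ?S = 1" by simp
  qed
  have r: "continuous_map (realization K) (realization ?K') r"
  proof (rule continuous_map_into_realization[OF _ rK'])
    show "continuous_map (realization K) euclideanreal (\<lambda>x. r x v)" for v
      unfolding r_def
      by (cases "v \<in> e"; cases "v = u")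
         (auto intro!: continuous_map_add continuous_map_diff continuous_map_real_mult_left continuous_map_realization m)
  qed
  have "homotopic_with (\<lambda>_. True) (realization K) (realization K) r id"
  proof (rule homotopic_realization[OF K])
    show "continuous_map (realization K) (realization K) r"
      by (rule continuous_map_realization_mono[OF _ r]) auto
  qed (use union in auto)
  moreover have "r x = x" if x: "x \<in> topspace (realization ?K')" for x
  proof -
    obtain v where "v \<in> e" "x v = 0" using realization_support[OF x] by auto
    moreover have "x \<in> topspace (realization K)" using realization_mono[of ?K' K] x by auto
    ultimately have "m x = 0" using m_le[of v x] m0[of x] by simp
    then show ?thesis by (auto simp: r_def)
  qed
  ultimately show ?thesis
    unfolding deformation_retract_def using r by (intro conjI exI[of _ r]) auto
qed


section \<open>Independence complexes and folds\<close>

text \<open>A point \<open>x\<close> is joined to \<open>g (f x)\<close> by its track under the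
  homotopy, and \<open>g\<close> transports the paths of \<open>Z\<close>.\<close>

lemma path_connected_homotopy_equivalent:
  assumes XZ: "X homotopy_equivalent_space Z" and Z: "path_connected_space Z"
  shows "path_connected_space X"
proof -
  obtain f g where f: "continuous_map X Z f" and g: "continuous_map Z X g"
    and gf: "homotopic_with (\<lambda>x. True) X X (g \<circ> f) id"
    using XZ unfolding homotopy_equivalent_space_def by blast
  obtain H where H: "continuous_map (prod_topology unit_interval X) X H"
    and H0: "\<And>x. H (0, x) = g (f x)" and H1: "\<And>x. H (1, x) = x"
    using gf unfolding homotopic_with_def by auto
  have 1: "path_component_of X (g (f x)) x" if x: "x \<in> topspace X" for x
  proof -
    have "continuous_map unit_interval (prod_topology unit_interval X) (\<lambda>t. (t, x))"
      using x by (intro continuous_map_pairedI) auto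
    from continuous_map_compose[OF this H] show ?thesis
      unfolding path_component_of_def pathin_def using H0 H1
      by (intro exI[of _ "\<lambda>t. H (t, x)"]) (auto simp: o_def)
  qed
  have 2: "path_component_of X (g z) (g z')" if z: "z \<in> topspace Z" "z' \<in> topspace Z" for z z'
  proof -
    obtain \<gamma> where \<gamma>: "pathin Z \<gamma>" "\<gamma> 0 = z" "\<gamma> 1 = z'"
      using path_connected_space_imp_path_component_of[OF Z z] by (auto simp: path_component_of_def)
    then show ?thesis
      unfolding path_component_of_def pathin_def using continuous_map_compose[OF _ g, of unit_interval \<gamma>]
      by (intro exI[of _ "g \<circ> \<gamma>"]) (auto simp: pathin_def)
  qed
  show ?thesis
    unfolding path_connected_space_iff_path_component
  proof (intro ballI)
    fix x y assume xy: "x \<in> topspace X" "y \<in> topspace X"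
    then have "f x \<in> topspace Z" "f y \<in> topspace Z" using f by (auto simp: continuous_map_def)
    then have "path_component_of X (g (f x)) (g (f y))" by (rule 2)
    then show "path_component_of X x y"
      using path_component_of_trans[OF path_component_of_sym[OF 1[OF xy(1)]]] path_component_of_trans 1[OF xy(2)] by metis
  qed
qed

text \<open>The adjacency lives on the whole vertex type and only vertex sets vary. All independence
  complexes then share one type of points, and the inclusion of an induced subgraph is the identity
  on barycentric coordinates.\<close>

locale graph_relation =
  fixes adj :: "'a \<Rightarrow> 'a \<Rightarrow> bool"
  assumes adj_sym: "adj u v \<Longrightarrow> adj v u" and adj_irrefl: "\<not> adj v v"
begin

definition ind_complex :: "'a set \<Rightarrow> 'a set set" where
  "ind_complex A = {\<sigma>. \<sigma> \<subseteq> A \<and> (\<forall>u\<in>\<sigma>. \<forall>v\<in>\<sigma>. \<not> adj u v)}"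

abbreviation ind_space :: "'a set \<Rightarrow> ('a \<Rightarrow> real) topology" where
  "ind_space A \<equiv> realization (ind_complex A)"

lemma Union_ind_complex: "\<Union>(ind_complex A) = A"
proof
  show "A \<subseteq> \<Union>(ind_complex A)"
  proof
    fix v assume "v \<in> A"
    then have "{v} \<in> ind_complex A" by (auto simp: ind_complex_def adj_irrefl)
    then show "v \<in> \<Union>(ind_complex A)" by blast
  qed
qed (auto simp: ind_complex_def)

lemma simplicial_ind_complex: "finite A \<Longrightarrow> simplicial (ind_complex A)"
  unfolding simplicial_def Union_ind_complex by (auto simp: ind_complex_def)

lemma ind_complex_mono: "A \<subseteq> B \<Longrightarrow> ind_complex A \<subseteq> ind_complex B"
  by (auto simp: ind_complex_def)

lemma insert_in_ind_complex:
  "\<lbrakk>\<sigma> \<in> ind_complex A; u \<in> A; \<And>y. y \<in> \<sigma> \<Longrightarrow> \<not> adj u y\<rbrakk> \<Longrightarrow> insert u \<sigma> \<in> ind_complex A"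
  using adj_sym adj_irrefl unfolding ind_complex_def by blast

lemma singleton_in_ind_complex: "v \<in> A \<Longrightarrow> {v} \<in> ind_complex A"
  by (auto simp: ind_complex_def adj_irrefl)

lemma ind_space_nonempty: "A \<noteq> {} \<Longrightarrow> topspace (ind_space A) \<noteq> {}"
  using vertex_in_realization[OF singleton_in_ind_complex] by blast

lemma in_ind_space_iff:
  assumes "finite A"
  shows "x \<in> topspace (ind_space A) \<longleftrightarrow> (\<forall>v. 0 \<le> x v) \<and> (\<forall>v. v \<notin> A \<longrightarrow> x v = 0) \<and>
     (\<forall>u v. x u \<noteq> 0 \<longrightarrow> x v \<noteq> 0 \<longrightarrow> \<not> adj u v) \<and> sum x A = 1"
proof -
  have "{v. x v \<noteq> 0} \<in> ind_complex A \<longleftrightarrow> (\<forall>v. v \<notin> A \<longrightarrow> x v = 0) \<and> (\<forall>u v. x u \<noteq> 0 \<longrightarrow> x v \<noteq> 0 \<longrightarrow> \<not> adj u v)"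
    by (auto simp: ind_complex_def)
  then show ?thesis
    by (simp add: in_realization_iff[OF simplicial_ind_complex[OF assms]] Union_ind_complex)
qed

definition dominated :: "'a set \<Rightarrow> 'a \<Rightarrow> 'a \<Rightarrow> bool" where
  "dominated A u v \<longleftrightarrow> u \<in> A \<and> v \<in> A \<and> u \<noteq> v \<and> \<not> adj u v \<and> (\<forall>w\<in>A. adj u w \<longrightarrow> adj v w)"

text \<open>A face containing \<open>v\<close> contains no neighbour of \<open>v\<close>, hence none
  of \<open>u\<close>, so the link of \<open>v\<close> is a cone with apex \<open>u\<close>.\<close>

lemma deformation_retract_fold:
  assumes A: "finite A" and uv: "dominated A u v"
  shows "deformation_retract (ind_complex A) (ind_complex (A - {v}))"
proof -
  have "deformation_retract (ind_complex A) {\<sigma> \<in> ind_complex A. \<not> {v} \<subseteq> \<sigma>}"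
  proof (rule deformation_retract_cone_link[where u = u])
    fix \<sigma> assume \<sigma>: "\<sigma> \<in> ind_complex A" "{v} \<subseteq> \<sigma>"
    then show "insert u \<sigma> \<in> ind_complex A"
      using uv adj_sym adj_irrefl unfolding ind_complex_def dominated_def by blast
  qed (use uv simplicial_ind_complex[OF A] in \<open>auto simp: dominated_def\<close>)
  moreover have "{\<sigma> \<in> ind_complex A. \<not> {v} \<subseteq> \<sigma>} = ind_complex (A - {v})"
    by (auto simp: ind_complex_def)
  ultimately show ?thesis by simp
qed

inductive folds_to :: "'a set \<Rightarrow> 'a set \<Rightarrow> bool" where
  folds_to_refl: "folds_to A A"
| folds_to_step: "\<lbrakk>dominated A u v; folds_to (A - {v}) B\<rbrakk> \<Longrightarrow> folds_to A B"

lemma folds_to_subset: "folds_to A B \<Longrightarrow> B \<subseteq> A"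
  by (induction rule: folds_to.induct) auto

lemma deformation_retract_folds_to:
  "\<lbrakk>folds_to A B; finite A\<rbrakk> \<Longrightarrow> deformation_retract (ind_complex A) (ind_complex B)"
proof (induction rule: folds_to.induct)
  case (folds_to_refl A)
  show ?case by (rule deformation_retract_refl)
next
  case (folds_to_step A u v B)
  then show ?case
    using deformation_retract_trans[OF deformation_retract_fold] by simp
qed

lemma homotopy_equivalent_folds_to:
  "\<lbrakk>folds_to A B; finite A\<rbrakk> \<Longrightarrow> ind_space A homotopy_equivalent_space ind_space B"
  by (rule deformation_retract_homotopy_equivalent) (rule deformation_retract_folds_to)

lemma contractible_ind_space:
  assumes A: "finite A" and w: "w \<in> A" "\<And>u. u \<in> A \<Longrightarrow> \<not> adj w u"
  shows "contractible_space (ind_space A)"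
proof -
  have "homotopic_with (\<lambda>_. True) (ind_space A) (ind_space A) id (\<lambda>_. vertex w)"
  proof (rule homotopic_realization[OF simplicial_ind_complex[OF A]])
    show "continuous_map (ind_space A) (ind_space A) (\<lambda>_. vertex w)"
      using vertex_in_realization[OF singleton_in_ind_complex[OF w(1)]] by simp
    fix x assume "x \<in> topspace (ind_space A)"
    then have "{v. x v \<noteq> 0} \<in> ind_complex A" by (rule realization_support)
    then have "insert w {v. x v \<noteq> 0} \<in> ind_complex A"
      using w adj_sym adj_irrefl unfolding ind_complex_def by blast
    then show "{v. id x v \<noteq> 0} \<union> {v. vertex w v \<noteq> 0} \<in> ind_complex A"
      by (simp add: vertex_support Un_commute)
  qed simp
  then show ?thesis unfolding contractible_space_def by blast
qed

lemma contractible_folds_to: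
  assumes "finite A" "folds_to A B" "w \<in> B" "\<And>u. u \<in> B \<Longrightarrow> \<not> adj w u"
  shows "contractible_space (ind_space A)"
proof -
  have "finite B" using assms(1) folds_to_subset[OF assms(2)] finite_subset by blast
  then have "contractible_space (ind_space B)" using assms(3,4) by (rule contractible_ind_space)
  then show ?thesis
    using homotopy_equivalent_folds_to[OF assms(2,1)] homotopy_equivalent_space_contractibility by blast
qed

text \<open>Inside \<open>M\<close> the inclusion deforms to the retraction onto \<open>M'\<close>,
  which then factors through the contractible \<open>H\<close>. This \<open>H\<close> may use
  vertices of \<open>L\<close> outside \<open>M\<close>, so the link itself need not be
  contractible. Path-connectedness moves the resulting constant to the prescribed
  \<open>p\<close>.\<close>

lemma null_homotopic_inclusion:
  assumes L: "finite L" "path_connected_space (ind_space L)" "p \<in> topspace (ind_space L)"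
    and M: "M \<noteq> {}" "M \<subseteq> L" "folds_to M M'" and H: "M' \<subseteq> H" "H \<subseteq> L" "contractible_space (ind_space H)"
  shows "homotopic_with (\<lambda>_. True) (ind_space M) (ind_space L) (\<lambda>x. x) (\<lambda>_. p)"
proof -
  have "finite M" using L(1) M(2) finite_subset by blast
  then obtain r where r: "continuous_map (ind_space M) (ind_space M') r"
    "homotopic_with (\<lambda>_. True) (ind_space M) (ind_space M) r id"
    using deformation_retract_folds_to[OF M(3)] by (auto simp: deformation_retract_def)
  have incM: "continuous_map (ind_space M) (ind_space L) id"
    by (rule continuous_map_realization_mono[OF ind_complex_mono[OF M(2)]]) simp
  have incH: "continuous_map (ind_space H) (ind_space L) id"
    by (rule continuous_map_realization_mono[OF ind_complex_mono[OF H(2)]]) simp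
  have "continuous_map (ind_space M) (ind_space H) r"
    by (rule continuous_map_realization_mono[OF ind_complex_mono[OF H(1)] r(1)])
  then obtain c where c: "homotopic_with (\<lambda>_. True) (ind_space M) (ind_space L) (id \<circ> r) (\<lambda>_. c)"
    using nullhomotopic_through_contractible_space[OF _ incH H(3)] by blast
  have "homotopic_with (\<lambda>_. True) (ind_space M) (ind_space L) (id \<circ> r) (id \<circ> id)"
    by (rule homotopic_with_compose_continuous_map_left[OF r(2) incM]) simp
  then have 1: "homotopic_with (\<lambda>_. True) (ind_space M) (ind_space L) (\<lambda>x. x) (\<lambda>_. c)"
    using homotopic_with_trans[OF homotopic_with_symD c] by (simp add: id_def o_def)
  obtain m where "m \<in> topspace (ind_space M)" using ind_space_nonempty[OF M(1)] by blast
  moreover have "continuous_map (ind_space M) (ind_space L) (\<lambda>_. c)"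
    using homotopic_with_imp_continuous_maps[OF 1] by blast
  ultimately have "c \<in> topspace (ind_space L)" by (auto simp: continuous_map_def)
  then have "path_component_of (ind_space L) c p"
    by (rule path_connected_space_imp_path_component_of[OF L(2) _ L(3)])
  then have "homotopic_with (\<lambda>_. True) (ind_space M) (ind_space L) (\<lambda>_. c) (\<lambda>_. p)"
    by (simp add: homotopic_constant_maps)
  then show ?thesis by (rule homotopic_with_trans[OF 1])
qed

text \<open>Folds in the link of \<open>v\<close> are realized in the whole complex by removing edges at \<open>v\<close>.\<close>

lemma homotopy_equivalent_delete_vertex:
  assumes A: "finite A" and v: "v \<in> A"
    and folds: "folds_to {u \<in> A. u \<noteq> v \<and> \<not> adj v u} B" and w: "w \<in> B" "\<And>u. u \<in> B \<Longrightarrow> \<not> adj w u"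
  shows "ind_space A homotopy_equivalent_space ind_space (A - {v})"
proof -
  \<comment> \<open>The complex in which the link of \<open>v\<close> is cut down to the independent
    sets inside \<open>M\<close>, while all faces avoiding \<open>v\<close> are kept. It is in
    general not an independence complex of an induced subgraph.\<close>
  let ?K = "\<lambda>M. {\<sigma> \<in> ind_complex A. v \<in> \<sigma> \<longrightarrow> \<sigma> - {v} \<subseteq> M}"
  have K: "simplicial (?K M)" for M
  proof -
    have "\<Union>(?K M) \<subseteq> A" by (auto simp: ind_complex_def)
    then have "finite (\<Union>(?K M))" using A finite_subset by blast
    then show ?thesis
      unfolding simplicial_def ind_complex_def by blast
  qed
  have "deformation_retract (?K M) (?K B)" if "folds_to M B" "M \<subseteq> {u \<in> A. u \<noteq> v \<and> \<not> adj v u}" for M B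
    using that
  proof (induction rule: folds_to.induct)
    case (folds_to_refl M)
    then show ?case by (intro deformation_retract_refl)
  next
    case (folds_to_step M u x B)
    \<comment> \<open>Folding \<open>x\<close> away in the link of \<open>v\<close> amounts to
      removing the open star of the simplex \<open>{v, x}\<close>, whose own link is a cone with
      apex \<open>u\<close>.\<close>
    have "deformation_retract (?K M) {\<sigma> \<in> ?K M. \<not> {v, x} \<subseteq> \<sigma>}"
    proof (rule deformation_retract_cone_link[OF K, where u = u])
      show "u \<notin> {v, x}" using folds_to_step by (auto simp: dominated_def)
      fix \<sigma> assume \<sigma>: "\<sigma> \<in> ?K M" "{v, x} \<subseteq> \<sigma>"
      have u: "u \<in> A" "u \<in> M" "\<not> adj v u" using folds_to_step by (auto simp: dominated_def)
      have "\<not> adj u y" if "y \<in> \<sigma>" for y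
      proof (cases "y = v")
        case True
        then show ?thesis using u(3) adj_sym by blast
      next
        case False
        then have "y \<in> M" using \<sigma> that by auto
        moreover have "\<not> adj x y" using \<sigma> that by (auto simp: ind_complex_def)
        ultimately show ?thesis using folds_to_step(1) unfolding dominated_def by blast
      qed
      then have "insert u \<sigma> \<in> ind_complex A"
        using \<sigma>(1) u(1) by (intro insert_in_ind_complex) auto
      then show "insert u \<sigma> \<in> ?K M" using \<sigma> u by auto
    qed auto
    moreover have "{\<sigma> \<in> ?K M. \<not> {v, x} \<subseteq> \<sigma>} = ?K (M - {x})"
      using folds_to_step by (auto simp: dominated_def)
    moreover have "deformation_retract (?K (M - {x})) (?K B)"
      using folds_to_step.prems by (intro folds_to_step.IH) blast
    ultimately show ?case
      using deformation_retract_trans[of "?K M" "?K (M - {x})" "?K B"] by simp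
  qed
  from this[OF folds] have 1: "deformation_retract (?K {u \<in> A. u \<noteq> v \<and> \<not> adj v u}) (?K B)" by simp
  have 2: "?K {u \<in> A. u \<noteq> v \<and> \<not> adj v u} = ind_complex A"
    by (auto simp: ind_complex_def)
  \<comment> \<open>Once the link of \<open>v\<close> is a cone with apex \<open>w\<close>, the open
    star of \<open>v\<close> itself can be removed.\<close>
  have 3: "deformation_retract (?K B) {\<sigma> \<in> ?K B. \<not> {v} \<subseteq> \<sigma>}"
  proof (rule deformation_retract_cone_link[OF K, where u = w])
    have w': "w \<in> A" "w \<noteq> v" "\<not> adj v w" using w(1) folds_to_subset[OF folds] by auto
    then show "w \<notin> {v}" by simp
    fix \<sigma> assume \<sigma>: "\<sigma> \<in> ?K B" "{v} \<subseteq> \<sigma>"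
    then have "\<not> adj w y" if "y \<in> \<sigma>" for y
      using that w(2)[of y] w'(3) adj_sym[of w v] by (cases "y = v") auto
    then have "insert w \<sigma> \<in> ind_complex A"
      using \<sigma>(1) w'(1) by (intro insert_in_ind_complex) auto
    then show "insert w \<sigma> \<in> ?K B" using \<sigma> w(1) by auto
  qed auto
  have 4: "{\<sigma> \<in> ?K B. \<not> {v} \<subseteq> \<sigma>} = ind_complex (A - {v})"
    by (auto simp: ind_complex_def)
  show ?thesis
    using deformation_retract_homotopy_equivalent[OF deformation_retract_trans[OF 1 3]]
    unfolding 2 4 .
qed

definition edge_disjoint_from :: "'a \<Rightarrow> 'a \<Rightarrow> 'a set \<Rightarrow> bool" where
  "edge_disjoint_from x y A \<longleftrightarrow> adj x y \<and> x \<notin> A \<and> y \<notin> A \<and> (\<forall>a\<in>A. \<not> adj x a \<and> \<not> adj y a)"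

text \<open>The complex is the join of that of \<open>A\<close> with the two points \<open>x\<close>
  and \<open>y\<close>, that is, a suspension.\<close>

lemma ind_complex_add_edge:
  assumes "edge_disjoint_from x y A"
  shows "\<sigma> \<in> ind_complex (insert x (insert y A)) \<longleftrightarrow>
    \<sigma> - {x, y} \<in> ind_complex A \<and> \<not> (x \<in> \<sigma> \<and> y \<in> \<sigma>)"
proof -
  have "\<not> adj a x \<and> \<not> adj a y" if "a \<in> A" for a
    using that assms adj_sym unfolding edge_disjoint_from_def by blast
  then show ?thesis
    using assms adj_irrefl adj_sym unfolding edge_disjoint_from_def ind_complex_def by auto blast+
qed

text \<open>Every point has weight \<open>0\<close> at one of \<open>x\<close> and \<open>y\<close>
  and so can be moved straight to the other; a vertex of \<open>A\<close> links the two
  poles.\<close>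

lemma path_connected_add_edge:
  assumes A: "finite A" "A \<noteq> {}" and xy: "edge_disjoint_from x y A"
  shows "path_connected_space (ind_space (insert x (insert y A)))"
proof -
  let ?B = "insert x (insert y A)"
  have B: "simplicial (ind_complex ?B)" using A by (intro simplicial_ind_complex) auto
  have neq: "x \<noteq> y" using xy adj_irrefl by (auto simp: edge_disjoint_from_def)
  obtain z where z: "z \<in> A" using A by blast
  have pole: "path_component_of (ind_space ?B) p (vertex q)"
    if p: "p \<in> topspace (ind_space ?B)" and q: "q \<in> {x, y}" "q' \<in> {x, y}" "q \<noteq> q'" "p q' = 0" for p q q'
  proof (rule path_component_realization[OF B p])
    show "vertex q \<in> topspace (ind_space ?B)"
      using q by (intro vertex_in_realization singleton_in_ind_complex) auto
    have "{v. p v \<noteq> 0} - {x, y} \<in> ind_complex A"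
      using realization_support[OF p] ind_complex_add_edge[OF xy] by metis
    moreover have "insert q {v. p v \<noteq> 0} - {x, y} = {v. p v \<noteq> 0} - {x, y}" using q by auto
    moreover have "\<not> (x \<in> insert q {v. p v \<noteq> 0} \<and> y \<in> insert q {v. p v \<noteq> 0})"
      using q neq by auto
    ultimately show "{v. p v \<noteq> 0} \<union> {v. vertex q v \<noteq> 0} \<in> ind_complex ?B"
      by (simp add: vertex_support ind_complex_add_edge[OF xy])
  qed
  have vert: "vertex v \<in> topspace (ind_space ?B)" if "v \<in> ?B" for v
    by (rule vertex_in_realization[OF singleton_in_ind_complex[OF that]])
  have zx: "z \<noteq> x" "z \<noteq> y" using z xy by (auto simp: edge_disjoint_from_def)
  have "path_component_of (ind_space ?B) (vertex z) (vertex x)"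
    using zx z neq by (intro pole[where q' = y] vert) (auto simp: vertex_def)
  moreover have "path_component_of (ind_space ?B) (vertex z) (vertex y)"
    using zx z neq by (intro pole[where q' = x] vert) (auto simp: vertex_def)
  ultimately have yx: "path_component_of (ind_space ?B) (vertex y) (vertex x)"
    using path_component_of_sym path_component_of_trans by metis
  have all: "path_component_of (ind_space ?B) p (vertex x)" if p: "p \<in> topspace (ind_space ?B)" for p
  proof (cases "p y = 0")
    case True
    then show ?thesis using neq by (intro pole[where q' = y] p) auto
  next
    case False
    moreover have "\<not> (x \<in> {v. p v \<noteq> 0} \<and> y \<in> {v. p v \<noteq> 0})"
      using realization_support[OF p] ind_complex_add_edge[OF xy] by metis
    ultimately have "p x = 0" by simp
    then have "path_component_of (ind_space ?B) p (vertex y)"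
      using neq by (intro pole[where q' = x] p) auto
    then show ?thesis using yx path_component_of_trans by metis
  qed
  show ?thesis
    unfolding path_connected_space_iff_path_component
    using all path_component_of_sym path_component_of_trans by metis
qed

end


section \<open>Suspensions and cones in independence complexes\<close>

context graph_relation begin

text \<open>Height is encoded in the weights of \<open>x\<close> and \<open>y\<close>. The resulting
  map out of the cylinder over \<open>X\<close> has the same fibres as \<open>susp_proj\<close>, so
  it descends to a continuous bijection from a compact space to a Hausdorff space.\<close>

lemma suspension_add_edge:
  assumes A: "finite A" "A \<noteq> {}" and xy: "edge_disjoint_from x y A" and X: "X homeomorphic_space ind_space A"
  shows "suspension X homeomorphic_space ind_space (insert x (insert y A))"
proof -
  let ?B = "insert x (insert y A)"
  obtain \<phi> where \<phi>: "homeomorphic_map X (ind_space A) \<phi>"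
    using X by (auto simp: homeomorphic_space)
  have \<phi>c: "continuous_map X (ind_space A) \<phi>" and inj: "inj_on \<phi> (topspace X)"
    and surj: "\<phi> ` topspace X = topspace (ind_space A)"
    using \<phi> homeomorphic_imp_continuous_map homeomorphic_imp_injective_map homeomorphic_imp_surjective_map by blast+
  have neq: "x \<noteq> y" "x \<notin> A" "y \<notin> A" and nonadj: "\<And>a. a \<in> A \<Longrightarrow> \<not> adj x a \<and> \<not> adj y a"
    using xy adj_irrefl by (auto simp: edge_disjoint_from_def)
  have ne: "topspace X \<noteq> {}"
  proof
    assume "topspace X = {}"
    then have "topspace (ind_space A) = {}" unfolding surj[symmetric] by (rule ssubst) simp
    with ind_space_nonempty[OF A(2)] show False by (rule notE)
  qed
  have \<phi>A: "\<phi> p \<in> topspace (ind_space A)" if "p \<in> topspace X" for p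
    using surj that by auto
  have \<phi>_out: "\<phi> p v = 0" if "p \<in> topspace X" "v \<notin> A" for p v
    using \<phi>A[OF that(1)] that(2) by (auto simp: in_ind_space_iff[OF A(1)])
  define Q where "Q z = (\<lambda>v. if v = x then max 0 (1 - 2 * snd z) else if v = y then max 0 (2 * snd z - 1)
      else (1 - \<bar>2 * snd z - 1\<bar>) * \<phi> (fst z) v)" for z
  let ?D = "prod_topology X unit_interval"
  have sndc: "continuous_map ?D euclideanreal snd"
    using continuous_map_snd[of X unit_interval] by (simp add: continuous_map_in_subtopology)
  have \<phi>v: "continuous_map ?D euclideanreal (\<lambda>z. \<phi> (fst z) v)" for v
    using continuous_map_compose[OF continuous_map_fst continuous_map_compose[OF \<phi>c continuous_map_realization]]
    by (simp add: o_def)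
  have Qin: "Q (p, t) \<in> topspace (ind_space ?B)" if p: "p \<in> topspace X" and t: "0 \<le> t" "t \<le> 1" for p t
  proof -
    have \<phi>p: "\<And>v. 0 \<le> \<phi> p v" "\<And>u v. \<lbrakk>\<phi> p u \<noteq> 0; \<phi> p v \<noteq> 0\<rbrakk> \<Longrightarrow> \<not> adj u v" "sum (\<phi> p) A = 1"
      using \<phi>A[OF p] by (auto simp: in_ind_space_iff[OF A(1)])
    have "(\<Sum>v\<in>A. Q (p, t) v) = (\<Sum>v\<in>A. (1 - \<bar>2 * t - 1\<bar>) * \<phi> p v)"
      using neq by (intro sum.cong) (auto simp: Q_def)
    also have "\<dots> = 1 - \<bar>2 * t - 1\<bar>"
      using \<phi>p(3) by (simp flip: sum_distrib_left)
    finally have "sum (Q (p, t)) ?B = max 0 (1 - 2 * t) + (max 0 (2 * t - 1) + (1 - \<bar>2 * t - 1\<bar>))"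
      using A neq by (simp add: Q_def)
    then have 1: "sum (Q (p, t)) ?B = 1" by (auto simp: max_def abs_if)
    have 2: "0 \<le> Q (p, t) v" for v
      using \<phi>p(1)[of v] t by (auto simp: Q_def)
    have 3: "Q (p, t) v = 0" if "v \<notin> ?B" for v
      using \<phi>_out[OF p, of v] that by (auto simp: Q_def)
    have 4: "\<not> adj u v" if uv: "Q (p, t) u \<noteq> 0" "Q (p, t) v \<noteq> 0" for u v
    proof -
      have xy0: "Q (p, t) x = 0 \<or> Q (p, t) y = 0" using neq by (auto simp: Q_def)
      have "u \<in> ?B" "v \<in> ?B" using 3 uv by blast+
      moreover have "\<not> adj u v" if "u \<in> A" "v \<in> A"
      proof -
        have "u \<noteq> x" "u \<noteq> y" "v \<noteq> x" "v \<noteq> y" using that neq by auto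
        then have "\<phi> p u \<noteq> 0" "\<phi> p v \<noteq> 0" using uv by (auto simp: Q_def)
        then show ?thesis by (rule \<phi>p(2))
      qed
      moreover have "\<not> adj a x" "\<not> adj a y" if "a \<in> A" for a
        using nonadj[OF that] adj_sym by blast+
      ultimately show ?thesis
        using uv xy0 nonadj adj_irrefl by (metis insert_iff)
    qed
    show ?thesis
      using 1 2 3 4 A(1) by (subst in_ind_space_iff) auto
  qed
  have Qc: "continuous_map ?D (ind_space ?B) Q"
  proof (rule continuous_map_into_realization)
    show "continuous_map ?D euclideanreal (\<lambda>z. Q z v)" for v
      unfolding Q_def
      by (cases "v = x"; cases "v = y")
         (auto intro!: continuous_map_real_max continuous_map_real_mult continuous_map_diff continuous_map_real_abs
            continuous_map_real_mult_left sndc \<phi>v)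
    show "Q z \<in> topspace (ind_space ?B)" if "z \<in> topspace ?D" for z
      using that Qin by (cases z) auto
  qed
  have time: "t = t'" if "Q (p, t) = Q (p', t')" for p p' t t'
  proof -
    have "max 0 (1 - 2 * t) = max 0 (1 - 2 * t')" "max 0 (2 * t - 1) = max 0 (2 * t' - 1)"
      using fun_cong[OF that, of x] fun_cong[OF that, of y] neq by (auto simp: Q_def)
    then show ?thesis by (auto simp: max_def split: if_splits)
  qed
  have kernel: "Q z = Q z' \<longleftrightarrow> susp_proj z = susp_proj z'" if z: "z \<in> topspace ?D" "z' \<in> topspace ?D" for z z'
  proof -
    obtain p t p' t' where zz: "z = (p, t)" "z' = (p', t')" by (cases z; cases z')
    have p: "p \<in> topspace X" "p' \<in> topspace X" and t: "0 \<le> t" "t \<le> 1" using z zz by auto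
    show ?thesis
    proof
      assume Q: "Q z = Q z'"
      have tt: "t' = t" using time Q zz by metis
      have "p = p'" if "0 < t" "t < 1"
      proof (rule inj_onD[OF inj _ p])
        show "\<phi> p = \<phi> p'"
        proof
          fix v
          show "\<phi> p v = \<phi> p' v"
          proof (cases "v \<in> A")
            case True
            then have "v \<noteq> x" "v \<noteq> y" using neq by auto
            then have "(1 - \<bar>2 * t - 1\<bar>) * \<phi> p v = (1 - \<bar>2 * t - 1\<bar>) * \<phi> p' v"
              using fun_cong[OF Q, of v] zz tt by (simp add: Q_def)
            moreover have "1 - \<bar>2 * t - 1\<bar> \<noteq> 0" using that by (auto simp: abs_if)
            ultimately show ?thesis by simp
          qed (use \<phi>_out p in auto)
        qed
      qed
      then show "susp_proj z = susp_proj z'"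
        using zz tt t by (auto simp: susp_proj_def)
    next
      assume "susp_proj z = susp_proj z'"
      then have "t = t' \<and> (t = 0 \<or> t = 1 \<or> p = p')"
        using zz by (auto simp: susp_proj_def split: if_splits)
      then show "Q z = Q z'"
        using zz neq by (auto simp: Q_def)
    qed
  qed
  have Qsurj: "topspace (ind_space ?B) \<subseteq> Q ` topspace ?D"
  proof
    fix z assume z: "z \<in> topspace (ind_space ?B)"
    have z': "\<And>v. 0 \<le> z v" "\<And>v. v \<notin> ?B \<Longrightarrow> z v = 0" "\<And>u v. \<lbrakk>z u \<noteq> 0; z v \<noteq> 0\<rbrakk> \<Longrightarrow> \<not> adj u v"
      and "sum z ?B = 1"
      using z A(1) by (auto simp: in_ind_space_iff)
    then have sum: "z x + z y + sum z A = 1" using A neq by simp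
    have xy0: "z x = 0 \<or> z y = 0" using z'(3)[of x y] xy by (auto simp: edge_disjoint_from_def)
    have sA: "0 \<le> sum z A" using z'(1) by (simp add: sum_nonneg)
    define c where "c = sum z A"
    \<comment> \<open>One of \<open>z x\<close> and \<open>z y\<close> vanishes, so the height can
      be recovered from their difference.\<close>
    define t where "t = (1 - z x + z y) / 2"
    have t: "0 \<le> t" "t \<le> 1" and tx: "max 0 (1 - 2 * t) = z x" and ty: "max 0 (2 * t - 1) = z y" and tc: "1 - \<bar>2 * t - 1\<bar> = c"
      using z'(1)[of x] z'(1)[of y] sum sA xy0 by (auto simp: t_def c_def field_simps)
    have "\<exists>w\<in>topspace (ind_space A). \<forall>v\<in>A. c * w v = z v"
    proof (cases "c = 0")
      case True
      then have "z v = 0" if "v \<in> A" for v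
        using that A(1) z'(1) by (simp add: c_def sum_nonneg_eq_0_iff)
      moreover obtain w where "w \<in> topspace (ind_space A)" using ind_space_nonempty[OF A(2)] by blast
      ultimately show ?thesis using True by (intro bexI[of _ w]) auto
    next
      case False
      then have c: "0 < c" using sA by (simp add: c_def)
      let ?w = "\<lambda>v. if v \<in> A then z v / c else 0"
      have "sum ?w A = 1" using c by (simp add: c_def flip: sum_divide_distrib)
      then have "?w \<in> topspace (ind_space A)"
        using z' c by (auto simp: in_ind_space_iff[OF A(1)])
      then show ?thesis using c by (intro bexI[of _ ?w]) auto
    qed
    then obtain w where w: "w \<in> topspace (ind_space A)" "\<And>v. v \<in> A \<Longrightarrow> c * w v = z v" by blast
    then obtain p where p: "p \<in> topspace X" "w = \<phi> p" using surj by blast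
    have "Q (p, t) v = z v" for v
      using w(2)[of v] z'(2)[of v] \<phi>_out[OF p(1), of v] p(2) tx ty tc neq
      by (cases "v \<in> A") (auto simp: Q_def)
    then have "z = Q (p, t)" by auto
    then show "z \<in> Q ` topspace ?D" using p t by (intro image_eqI[of _ _ "(p, t)"]) auto
  qed
  have quot: "quotient_map ?D (suspension X) susp_proj" by (rule quotient_map_susp_proj[OF ne])
  have ker: "Q z = Q z'" if "z \<in> topspace ?D" "z' \<in> topspace ?D" "susp_proj z = susp_proj z'" for z z'
    using kernel[OF that(1,2)] that(3) by simp
  have "\<exists>\<psi>. continuous_map (suspension X) (ind_space ?B) \<psi> \<and>
      \<psi> ` topspace (suspension X) = Q ` topspace ?D \<and> (\<forall>z\<in>topspace ?D. \<psi> (susp_proj z) = Q z)"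
    by (rule quotient_map_lift_exists[OF quot Qc ker]) blast+
  then obtain \<psi> where \<psi>: "continuous_map (suspension X) (ind_space ?B) \<psi>"
    "\<psi> ` topspace (suspension X) = Q ` topspace ?D" "\<And>z. z \<in> topspace ?D \<Longrightarrow> \<psi> (susp_proj z) = Q z"
    by blast
  have "compact_space X"
    using X compact_realization[OF simplicial_ind_complex[OF A(1)]] homeomorphic_compact_space by blast
  then have "compact_space ?D" by (simp add: compact_space_prod_topology compact_space_subtopology)
  then have comp: "compact_space (suspension X)"
    using image_compactin[OF _ quotient_imp_continuous_map[OF quot], of "topspace ?D"]
    by (simp only: compact_space_def quotient_imp_surjective_map[OF quot])
  have "inj_on \<psi> (topspace (suspension X))"
  proof (rule inj_onI)
    fix a b assume ab: "a \<in> topspace (suspension X)" "b \<in> topspace (suspension X)" and eq: "\<psi> a = \<psi> b"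
    have S: "topspace (suspension X) = susp_proj ` topspace ?D"
      by (rule quotient_imp_surjective_map[OF quot, symmetric])
    obtain z where z: "z \<in> topspace ?D" "a = susp_proj z" using ab(1) unfolding S by (rule imageE)
    obtain z' where z': "z' \<in> topspace ?D" "b = susp_proj z'" using ab(2) unfolding S by (rule imageE)
    have "Q z = Q z'" using eq z z' \<psi>(3) by simp
    then show "a = b" using kernel[OF z(1) z'(1)] z(2) z'(2) by simp
  qed
  moreover have "\<psi> ` topspace (suspension X) = topspace (ind_space ?B)"
    using \<psi>(2) Qsurj continuous_map_image_subset_topspace[OF \<psi>(1)] by simp
  ultimately have "homeomorphic_map (suspension X) (ind_space ?B) \<psi>"
    by (intro continuous_imp_homeomorphic_map[OF \<psi>(1) comp Hausdorff_realization])
  then show ?thesis by (auto simp: homeomorphic_space)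
qed

text \<open>The barycentric weight of \<open>v j\<close> is the height in the cone over its link. No
  face contains two of the pairwise adjacent \<open>v j\<close>, so the cones meet only in
  \<open>L\<close>. An empty link would lose the apex, since a cone is parametrised by
  \<open>M j\<close> times an interval.\<close>

lemma ind_space_mapping_cone:
  assumes A: "finite A" and v: "\<And>j. j < k \<Longrightarrow> v j \<in> A" "\<And>i j. \<lbrakk>i < k; j < k; i \<noteq> j\<rbrakk> \<Longrightarrow> adj (v i) (v j)"
    and L: "L = A - v ` {..<k}" and M: "\<And>j. j < k \<Longrightarrow> M j = {u \<in> A. u \<noteq> v j \<and> \<not> adj (v j) u}"
    and ne: "\<And>j. j < k \<Longrightarrow> M j \<noteq> {}"
  shows "mapping_cone k (ind_space L) (\<lambda>j. ind_space (M j)) (\<lambda>j m. m) (ind_space A) (\<lambda>l. l)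
     (\<lambda>j z w. (1 - snd z) * fst z w + (if w = v j then snd z else 0))"
proof -
  let ?c = "\<lambda>j z w. (1 - snd z) * fst z w + (if w = v j then snd z else (0::real))"
  have LA: "L \<subseteq> A" "finite L" using L A by auto
  have MA: "M j \<subseteq> A" "finite (M j)" "v j \<notin> M j" if "j < k" for j using M[OF that] A by auto
  have MsubL: "M j \<subseteq> L" if "j < k" for j
    using that v adj_sym unfolding L M[OF that] by blast
  have vM: "v i \<notin> M j" if "i < k" "j < k" for i j
    using MsubL[OF that(2)] that(1) L by auto
  have Mout: "m w = 0" if "j < k" "m \<in> topspace (ind_space (M j))" "w \<notin> M j" for j m w
    using that by (simp add: in_ind_space_iff MA)
  have c_in: "?c j (m, t) \<in> topspace (ind_space A)"
    if j: "j < k" and m: "m \<in> topspace (ind_space (M j))" and t: "0 \<le> t" "t \<le> 1" for j m t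
  proof -
    have m': "\<And>w. 0 \<le> m w" "\<And>w. w \<notin> M j \<Longrightarrow> m w = 0" "\<And>w w'. \<lbrakk>m w \<noteq> 0; m w' \<noteq> 0\<rbrakk> \<Longrightarrow> \<not> adj w w'" "sum m (M j) = 1"
      using m by (auto simp: in_ind_space_iff MA[OF j])
    have 1: "0 \<le> ?c j (m, t) w" for w using m'(1)[of w] t by simp
    have 2: "?c j (m, t) w = 0" if "w \<notin> A" for w
      using m'(2)[of w] that MA(1)[OF j] v(1)[OF j] by auto
    have 3: "\<not> adj w w'" if "?c j (m, t) w \<noteq> 0" "?c j (m, t) w' \<noteq> 0" for w w'
    proof -
      have "m w \<noteq> 0 \<or> w = v j" "m w' \<noteq> 0 \<or> w' = v j" using that by (auto split: if_splits)
      moreover have "\<not> adj (v j) u" if "m u \<noteq> 0" for u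
        using that m'(2)[of u] M[OF j] by auto
      ultimately show ?thesis using m'(3) adj_sym adj_irrefl by metis
    qed
    have "sum (?c j (m, t)) A = (1 - t) * sum m A + (\<Sum>w\<in>A. if w = v j then t else 0)"
      unfolding fst_conv snd_conv sum.distrib sum_distrib_left ..
    also have "sum m A = sum m (M j)"
      using A MA(1)[OF j] m'(2) by (intro sum.mono_neutral_right) auto
    also have "(\<Sum>w\<in>A. if w = v j then t else 0) = t"
      using A v(1)[OF j] by simp
    finally have "sum (?c j (m, t)) A = 1" using m'(4) by simp
    then show ?thesis using 1 2 3 by (subst in_ind_space_iff[OF A]) blast
  qed
  have lin: "l \<in> topspace (ind_space A)" if "l \<in> topspace (ind_space L)" for l
    using realization_mono[OF ind_complex_mono[OF LA(1)]] that by blast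
  have c_cont: "continuous_map (prod_topology (ind_space (M j)) unit_interval) (ind_space A) (?c j)" if j: "j < k" for j
  proof (rule continuous_map_into_realization)
    let ?D = "prod_topology (ind_space (M j)) unit_interval"
    have s: "continuous_map ?D euclideanreal snd"
      using continuous_map_snd[of "ind_space (M j)" unit_interval] by (simp add: continuous_map_in_subtopology)
    have "continuous_map ?D euclideanreal (\<lambda>z. fst z w)" for w
      using continuous_map_compose[OF continuous_map_fst continuous_map_realization] by (simp add: o_def)
    then show "continuous_map ?D euclideanreal (\<lambda>z. ?c j z w)" for w
      using s by (cases "w = v j") (auto intro!: continuous_map_add continuous_map_real_mult continuous_map_diff)
    show "?c j z \<in> topspace (ind_space A)" if "z \<in> topspace ?D" for z
      using c_in[OF j, of "fst z" "snd z"] that unfolding fst_conv snd_conv by (simp add: mem_Times_iff)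
  qed
  have c_apex: "?c j (m, t) (v j) = t" "\<And>i. \<lbrakk>i < k; i \<noteq> j\<rbrakk> \<Longrightarrow> ?c j (m, t) (v i) = 0"
    if "j < k" "m \<in> topspace (ind_space (M j))" for j m t
  proof -
    show "?c j (m, t) (v j) = t" using Mout[OF that vM] that(1) by simp
    show "?c j (m, t) (v i) = 0" if i: "i < k" "i \<noteq> j" for i
    proof -
      have "v i \<noteq> v j" using v(2)[OF i(1) \<open>j < k\<close> i(2)] adj_irrefl by metis
      then show ?thesis using Mout[OF \<open>j < k\<close> \<open>m \<in> _\<close> vM[OF i(1) \<open>j < k\<close>]] by simp
    qed
  qed
  show ?thesis
    unfolding mapping_cone_def
  proof (intro conjI)
    show "joint_quotient {..k} (\<lambda>j. prod_topology (if j < k then ind_space (M j) else ind_space L) unit_interval)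
        (ind_space A) (\<lambda>j z. if j < k then ?c j z else fst z)"
    proof (rule joint_quotient_compact)
      show "compact_space (prod_topology (if j < k then ind_space (M j) else ind_space L) unit_interval)" for j
      proof -
        have "compact_space (if j < k then ind_space (M j) else ind_space L)"
          using MA[of j] LA by (auto intro: compact_realization simplicial_ind_complex)
        then show ?thesis by (simp add: compact_space_prod_topology compact_space_subtopology)
      qed
      show "Hausdorff_space (ind_space A)" by (rule Hausdorff_realization)
      show "continuous_map (prod_topology (if j < k then ind_space (M j) else ind_space L) unit_interval)
          (ind_space A) (\<lambda>z. if j < k then ?c j z else fst z)" for j
      proof (cases "j < k")
        case True
        then show ?thesis using c_cont[OF True] by simp
      next
        case False
        have "continuous_map (prod_topology (ind_space L) unit_interval) (ind_space A) fst"
          by (rule continuous_map_realization_mono[OF ind_complex_mono[OF LA(1)] continuous_map_fst])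
        then show ?thesis using False by simp
      qed
      fix x assume x: "x \<in> topspace (ind_space A)"
      have x': "\<And>w. 0 \<le> x w" "\<And>w. w \<notin> A \<Longrightarrow> x w = 0" "\<And>w w'. \<lbrakk>x w \<noteq> 0; x w' \<noteq> 0\<rbrakk> \<Longrightarrow> \<not> adj w w'" "sum x A = 1"
        using x by (auto simp: in_ind_space_iff[OF A])
      show "\<exists>j\<in>{..k}. x \<in> (\<lambda>z. if j < k then ?c j z else fst z) `
          topspace (prod_topology (if j < k then ind_space (M j) else ind_space L) unit_interval)"
      proof (cases "\<exists>j<k. x (v j) \<noteq> 0")
        case False
        then have xL: "x w = 0" if "w \<notin> L" for w using that x'(2)[of w] L by auto
        have "sum x L = sum x A" using xL LA A by (intro sum.mono_neutral_left) auto
        then have "x \<in> topspace (ind_space L)"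
          using x' xL by (subst in_ind_space_iff[OF LA(2)]) auto
        then show ?thesis by (intro bexI[of _ k] image_eqI[of _ _ "(x, 0)"]) auto
      next
        case True
        then obtain j where j: "j < k" "x (v j) \<noteq> 0" by blast
        define t where "t = x (v j)"
        have xM: "x w = 0" if "w \<notin> M j" "w \<noteq> v j" for w
          using that x'(2)[of w] x'(3)[OF j(2), of w] M[OF j(1)] by auto
        have "sum x A = sum x (insert (v j) (M j))"
          using xM A MA[OF j(1)] v(1)[OF j(1)] by (intro sum.mono_neutral_right) auto
        then have sum: "t + sum x (M j) = 1" using x'(4) MA[OF j(1)] by (simp add: t_def)
        have s0: "0 \<le> sum x (M j)" using x'(1) by (simp add: sum_nonneg)
        have t: "0 < t" "t \<le> 1" using j(2) x'(1)[of "v j"] sum s0 by (auto simp: t_def)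
        have "\<exists>m\<in>topspace (ind_space (M j)). \<forall>w\<in>M j. (1 - t) * m w = x w"
        \<comment> \<open>At the apex the remaining mass is \<open>0\<close> and cannot be
          normalised; any point of the nonempty link will do.\<close>
        proof (cases "t = 1")
          case True
          then have "x w = 0" if "w \<in> M j" for w
            using that sum MA[OF j(1)] x'(1) by (simp add: sum_nonneg_eq_0_iff)
          moreover obtain m where "m \<in> topspace (ind_space (M j))"
            using ind_space_nonempty[OF ne[OF j(1)]] by blast
          ultimately show ?thesis using True by (intro bexI[of _ m]) auto
        next
          case False
          then have t1: "0 < 1 - t" using t by simp
          let ?m = "\<lambda>w. if w \<in> M j then x w / (1 - t) else 0"
          have "sum ?m (M j) = 1" using t1 sum by (simp flip: sum_divide_distrib)
          then have "?m \<in> topspace (ind_space (M j))"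
            using x' t1 by (auto simp: in_ind_space_iff[OF MA(2)[OF j(1)]])
          then show ?thesis using t1 by (intro bexI[of _ ?m]) auto
        qed
        then obtain m where m: "m \<in> topspace (ind_space (M j))" "\<And>w. w \<in> M j \<Longrightarrow> (1 - t) * m w = x w" by blast
        have "?c j (m, t) w = x w" for w
          using m(2)[of w] Mout[OF j(1) m(1), of w] xM[of w] MA(3)[OF j(1)]
          by (cases "w \<in> M j"; cases "w = v j") (auto simp: t_def)
        then have "x = ?c j (m, t)" by auto
        then show ?thesis using j(1) m(1) t by (intro bexI[of _ j] image_eqI[of _ _ "(m, t)"]) auto
      qed
    qed simp
    show "inj_on (\<lambda>l. l) (topspace (ind_space L))" by simp
    show "\<forall>j<k. continuous_map (ind_space (M j)) (ind_space L) (\<lambda>m. m)"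
      using continuous_map_realization_mono[OF ind_complex_mono[OF MsubL] continuous_map_id] by (simp add: id_def)
    show "\<forall>j<k. \<forall>m\<in>topspace (ind_space (M j)). ?c j (m, 0) = m" by auto
    show "\<forall>j<k. \<forall>m\<in>topspace (ind_space (M j)). \<forall>m'\<in>topspace (ind_space (M j)). ?c j (m, 1) = ?c j (m', 1)" by auto
    show "\<forall>j<k. \<forall>m\<in>topspace (ind_space (M j)). \<forall>t\<in>{0<..1}. ?c j (m, t) \<notin> (\<lambda>l. l) ` topspace (ind_space L)"
    proof (intro allI impI ballI)
      fix j m and t :: real assume j: "j < k" and m: "m \<in> topspace (ind_space (M j))" and t: "t \<in> {0<..1}"
      have "v j \<notin> L" using j L by auto
      then show "?c j (m, t) \<notin> (\<lambda>l. l) ` topspace (ind_space L)"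
        using c_apex(1)[OF j m, of t] t by (auto simp: in_ind_space_iff[OF LA(2)])
    qed
    show "\<forall>j<k. \<forall>j'<k. \<forall>m\<in>topspace (ind_space (M j)). \<forall>m'\<in>topspace (ind_space (M j')). \<forall>t\<in>{0<..1}. \<forall>t'\<in>{0<..1}.
        ?c j (m, t) = ?c j' (m', t') \<longrightarrow> j = j' \<and> t = t' \<and> (t < 1 \<longrightarrow> m = m')"
    proof (intro allI impI ballI)
      fix j j' m m' and t t' :: real
      assume j: "j < k" "j' < k" and m: "m \<in> topspace (ind_space (M j))" "m' \<in> topspace (ind_space (M j'))"
        and t: "t \<in> {0<..1}" "t' \<in> {0<..1}" and eq: "?c j (m, t) = ?c j' (m', t')"
      have jj: "j = j'"
      proof (rule ccontr)
        assume "j \<noteq> j'"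
        then have "?c j' (m', t') (v j) = 0" using c_apex(2)[OF j(2) m(2) j(1)] by simp
        then show False using fun_cong[OF eq, of "v j"] c_apex(1)[OF j(1) m(1), of t] t by simp
      qed
      have tt: "t = t'"
        using fun_cong[OF eq, of "v j"] c_apex(1)[OF j(1) m(1), of t] c_apex(1)[OF j(2) m(2), of t'] jj by simp
      moreover have "m w = m' w" if "t < 1" for w
      proof -
        have "(1 - t) * m w = (1 - t) * m' w"
          using fun_cong[OF eq, of w] unfolding fst_conv snd_conv jj tt by simp
        then show ?thesis using that by simp
      qed
      ultimately show "j = j' \<and> t = t' \<and> (t < 1 \<longrightarrow> m = m')" using jj by auto
    qed
  qed
qed

end

text \<open>The order matches \<open>mapping_cone\<close>: cones first, the base with index
  \<open>k\<close>. The base point \<open>South\<close> is the end at height \<open>0\<close>, where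
  a cone meets the base.\<close>

definition suspension_wedge ::
    "nat \<Rightarrow> 'a topology \<Rightarrow> 'a \<Rightarrow> (nat \<Rightarrow> 'a topology) \<Rightarrow> ('a susp_point topology \<times> 'a susp_point) list" where
  "suspension_wedge k L p M = map (\<lambda>j. (suspension (base_copy (M j)), South)) [0..<k] @ [(base_copy L, Base p)]"

lemma suspension_wedge_nth:
  "length (suspension_wedge k L p M) = Suc k"
  "suspension_wedge k L p M ! k = (base_copy L, Base p)"
  "j < k \<Longrightarrow> suspension_wedge k L p M ! j = (suspension (base_copy (M j)), South)"
  by (simp_all add: suspension_wedge_def nth_append)

lemma topspace_base_copy: "topspace (base_copy X) = Base ` topspace X"
  unfolding base_copy_def by (rule topspace_final_topology) simp

text \<open>A cone attached by a constant map has its bottom collapsed to the base point, and is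
  therefore a suspension hanging at \<open>p\<close>.\<close>

lemma wedge_mapping_cone:
  assumes ne: "\<And>j. j < k \<Longrightarrow> topspace (M j) \<noteq> {}" and p: "p \<in> topspace L"
  defines "Xs \<equiv> suspension_wedge k L p M"
  shows "mapping_cone k L M (\<lambda>j m. p) (wedge Xs) (\<lambda>l. wedge_proj Xs (k, Base l))
     (\<lambda>j z. wedge_proj Xs (j, susp_proj (Base (fst z), snd z)))"
proof -
  have Xs: "Xs \<noteq> []" "length Xs = Suc k" "Xs ! k = (base_copy L, Base p)"
    "\<And>j. j < k \<Longrightarrow> Xs ! j = (suspension (base_copy (M j)), South)"
    unfolding Xs_def by (auto simp: suspension_wedge_nth) (simp add: suspension_wedge_def)
  have points: "snd (Xs ! i) \<in> topspace (fst (Xs ! i))" if "i < length Xs" for i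
    using that Xs p by (cases "i = k") (auto simp: topspace_base_copy topspace_suspension)
  note lc = unit_interval_locally_compact_Hausdorff
  let ?r = "\<lambda>j z. if j < k then susp_proj (Base (fst z), snd z) else Base (fst z)"
  have quot: "quotient_map (prod_topology (if j < k then M j else L) unit_interval) (fst (Xs ! j)) (?r j)"
    if "j \<in> {..<length Xs}" for j
  proof (cases "j < k")
    case True
    have "quotient_map (M j) (base_copy (M j)) Base"
      using homeomorphic_map_base_copy[of "M j"] by (simp add: homeomorphic_map_def)
    then have "quotient_map (prod_topology (M j) unit_interval) (prod_topology (base_copy (M j)) unit_interval)
       (\<lambda>(x, y). (Base x, y))"
      using lc by (intro quotient_map_prod_left) auto
    moreover have "quotient_map (prod_topology (base_copy (M j)) unit_interval) (suspension (base_copy (M j))) susp_proj"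
      by (rule quotient_map_susp_proj) (use ne[OF True] in \<open>simp add: topspace_base_copy\<close>)
    ultimately have "quotient_map (prod_topology (M j) unit_interval) (suspension (base_copy (M j))) (susp_proj \<circ> (\<lambda>(x, y). (Base x, y)))"
      by (rule quotient_map_compose)
    then show ?thesis using True Xs(4)[OF True] by (simp add: o_def case_prod_unfold)
  next
    case False
    then have j: "j = k" using that Xs(2) by simp
    have "quotient_map (prod_topology L unit_interval) L fst"
      by (simp add: quotient_map_fst) (metis atLeastAtMost_iff empty_iff order_refl zero_le_one topspace_discrete_topology topspace_euclidean_subtopology)
    moreover have "quotient_map L (base_copy L) Base"
      using homeomorphic_map_base_copy[of L] by (simp add: homeomorphic_map_def)
    ultimately have "quotient_map (prod_topology L unit_interval) (base_copy L) (Base \<circ> fst)"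
      by (rule quotient_map_compose)
    then show ?thesis using j Xs(3) by (simp add: o_def)
  qed
  have jq: "joint_quotient {..<length Xs} (\<lambda>j. prod_topology (if j < k then M j else L) unit_interval) (wedge Xs)
     (\<lambda>j z. wedge_proj Xs (j, ?r j z))"
    by (rule joint_quotient_compose[OF joint_quotient_wedge[OF Xs(1) points] quot])
  moreover have "{..<length Xs} = {..k}" using Xs(2) by auto
  moreover have "(\<lambda>j z. wedge_proj Xs (j, ?r j z)) =
     (\<lambda>j z. if j < k then wedge_proj Xs (j, susp_proj (Base (fst z), snd z)) else wedge_proj Xs (j, Base (fst z)))"
    by (intro ext) simp
  ultimately have jq': "joint_quotient {..k} (\<lambda>j. prod_topology (if j < k then M j else L) unit_interval) (wedge Xs)
     (\<lambda>j z. if j < k then wedge_proj Xs (j, susp_proj (Base (fst z), snd z)) else wedge_proj Xs (j, Base (fst z)))"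
    by simp
  \<comment> \<open>On the index set \<open>{..k}\<close> the second branch occurs only for
    \<open>j = k\<close>, so the index can be made constant, as the format of
    \<open>mapping_cone\<close> demands.\<close>
  have jq'': "joint_quotient {..k} (\<lambda>j. prod_topology (if j < k then M j else L) unit_interval) (wedge Xs)
     (\<lambda>j z. if j < k then wedge_proj Xs (j, susp_proj (Base (fst z), snd z)) else wedge_proj Xs (k, Base (fst z)))"
    unfolding joint_quotient_def
    by (rule quotient_map_eq[OF jq'[unfolded joint_quotient_def]]) auto
  have wL: "wedge_proj Xs (k, Base l) = (if l = p then None else Some (k, Base l))" for l
    using Xs(3) by (simp add: wedge_proj_def)
  have wM: "wedge_proj Xs (j, susp_proj (Base m, t)) = (if t = 0 then None else Some (j, susp_proj (Base m, t)))"
    if "j < k" for j m t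
    using Xs(4)[OF that] by (simp add: wedge_proj_def susp_proj_def)
  show ?thesis
    unfolding mapping_cone_def
  proof (intro conjI)
    show "inj_on (\<lambda>l. wedge_proj Xs (k, Base l)) (topspace L)"
      by (rule inj_onI) (auto simp: wL split: if_splits)
    show "\<forall>j<k. \<forall>j'<k. \<forall>m\<in>topspace (M j). \<forall>m'\<in>topspace (M j'). \<forall>t\<in>{0<..1}. \<forall>t'\<in>{0<..1}.
        wedge_proj Xs (j, susp_proj (Base (fst (m, t)), snd (m, t))) =
        wedge_proj Xs (j', susp_proj (Base (fst (m', t')), snd (m', t'))) \<longrightarrow> j = j' \<and> t = t' \<and> (t < 1 \<longrightarrow> m = m')"
    proof (intro allI impI ballI)
      fix j j' m m' and t t' :: real
      assume j: "j < k" "j' < k" and t: "t \<in> {0<..1}" "t' \<in> {0<..1}"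
        and eq: "wedge_proj Xs (j, susp_proj (Base (fst (m, t)), snd (m, t))) =
          wedge_proj Xs (j', susp_proj (Base (fst (m', t')), snd (m', t')))"
      have "j = j' \<and> susp_proj (Base m, t) = susp_proj (Base m', t')"
        using eq t wM[OF j(1), of m t] wM[OF j(2), of m' t'] by simp
      then show "j = j' \<and> t = t' \<and> (t < 1 \<longrightarrow> m = m')"
        using t by (auto simp: susp_proj_def split: if_splits)
    qed
    show "\<forall>j<k. \<forall>m\<in>topspace (M j). \<forall>t\<in>{0<..1}.
       wedge_proj Xs (j, susp_proj (Base (fst (m, t)), snd (m, t))) \<notin> (\<lambda>l. wedge_proj Xs (k, Base l)) ` topspace L"
      by (auto simp: wM wL split: if_splits)
    show "\<forall>j<k. \<forall>m\<in>topspace (M j). wedge_proj Xs (j, susp_proj (Base (fst (m, 0)), snd (m, 0))) = wedge_proj Xs (k, Base p)"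
      by (simp add: wM wL)
  qed (use jq'' p in \<open>auto simp: susp_proj_def\<close>)
qed


section \<open>Wedge decompositions\<close>

context graph_relation begin

text \<open>Since every point of a realization is a nondegenerate base point, an equivalence of the
  spaces is enough and \<open>x\<close> and \<open>z\<close> are arbitrary.\<close>

lemma pointed_equivalent_ind_spaces:
  assumes X: "X homeomorphic_space ind_space B" "x \<in> topspace X" and B: "finite B" "folds_to B C"
    and Z: "Z homeomorphic_space ind_space C" "z \<in> topspace Z" and C: "path_connected_space (ind_space C)"
  shows "pointed_equivalent X x Z z"
proof -
  obtain \<phi> where \<phi>: "homeomorphic_map X (ind_space B) \<phi>" using X(1) by (auto simp: homeomorphic_space)
  obtain \<psi> where \<psi>: "homeomorphic_map Z (ind_space C) \<psi>" using Z(1) by (auto simp: homeomorphic_space)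
  have "finite C" using B folds_to_subset finite_subset by blast
  moreover have "\<phi> x \<in> topspace (ind_space B)" "\<psi> z \<in> topspace (ind_space C)"
    using homeomorphic_imp_surjective_map[OF \<phi>] homeomorphic_imp_surjective_map[OF \<psi>] X(2) Z(2) by blast+
  ultimately have "pointed_equivalent (ind_space B) (\<phi> x) (ind_space C) (\<psi> z)"
    using homotopy_equivalent_folds_to[OF B(2,1)] C B(1)
    by (intro pointed_equivalent_of_homotopy_equivalent well_pointed_realization simplicial_ind_complex)
  then show ?thesis
    using pointed_equivalent_trans[OF pointed_equivalent_trans[OF pointed_equivalent_homeomorphic[OF \<phi> X(2)]]
        pointed_equivalent_sym[OF pointed_equivalent_homeomorphic[OF \<psi> Z(2)]]] by simp
qed

text \<open>The extra edge between \<open>x\<close> and \<open>y\<close> turns the suspension of a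
  link back into an independence complex, so that it can be simplified by folds like the rest. Each
  summand is compared with the corresponding entry of \<open>Zs\<close> through \<open>C j\<close>,
  to which the former folds and of which the latter is a homeomorphic copy.\<close>

theorem ind_space_wedge:
  assumes A: "finite A"
    and v: "\<And>j. j < k \<Longrightarrow> v j \<in> A" "\<And>i j. \<lbrakk>i < k; j < k; i \<noteq> j\<rbrakk> \<Longrightarrow> adj (v i) (v j)"
    and L: "L = A - v ` {..<k}" "L \<noteq> {}"
    and M: "\<And>j. j < k \<Longrightarrow> M j = {u \<in> A. u \<noteq> v j \<and> \<not> adj (v j) u}" "\<And>j. j < k \<Longrightarrow> M j \<noteq> {}"
    and null: "\<And>j. j < k \<Longrightarrow> \<exists>M' H. folds_to (M j) M' \<and> M' \<subseteq> H \<and> H \<subseteq> L \<and> contractible_space (ind_space H)"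
    and xy: "\<And>j. j < k \<Longrightarrow> edge_disjoint_from x y (M j)"
    and Z: "length Zs = Suc k" "\<And>j. j \<le> k \<Longrightarrow> fst (Zs ! j) homeomorphic_space ind_space (C j)"
      "\<And>j. j \<le> k \<Longrightarrow> snd (Zs ! j) \<in> topspace (fst (Zs ! j))"
    and C: "\<And>j. j < k \<Longrightarrow> folds_to (insert x (insert y (M j))) (C j)" "folds_to L (C k)"
      "\<And>j. j \<le> k \<Longrightarrow> path_connected_space (ind_space (C j))"
  shows "ind_space A homotopy_equivalent_space wedge Zs"
proof -
  have finL: "finite L" using A L(1) by simp
  have finM: "finite (M j)" if "j < k" for j using A M(1)[OF that] by simp
  have pcL: "path_connected_space (ind_space L)"
    by (rule path_connected_homotopy_equivalent[OF homotopy_equivalent_folds_to[OF C(2) finL] C(3)]) simp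
  obtain p where p: "p \<in> topspace (ind_space L)" using ind_space_nonempty[OF L(2)] by blast
  let ?Xs = "suspension_wedge k (ind_space L) p (\<lambda>j. ind_space (M j))"
  have ne: "topspace (ind_space (M j)) \<noteq> {}" if "j < k" for j
    by (rule ind_space_nonempty[OF M(2)[OF that]])
  have "ind_space A homotopy_equivalent_space wedge ?Xs"
  proof (rule mapping_cone_homotopy_invariant)
    show "mapping_cone k (ind_space L) (\<lambda>j. ind_space (M j)) (\<lambda>j m. m) (ind_space A) (\<lambda>l. l)
       (\<lambda>j z w. (1 - snd z) * fst z w + (if w = v j then snd z else 0))"
      by (rule ind_space_mapping_cone[OF A v L(1) M])
    show "mapping_cone k (ind_space L) (\<lambda>j. ind_space (M j)) (\<lambda>j m. p) (wedge ?Xs) (\<lambda>l. wedge_proj ?Xs (k, Base l))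
       (\<lambda>j z. wedge_proj ?Xs (j, susp_proj (Base (fst z), snd z)))"
      by (rule wedge_mapping_cone[OF ne p])
    show "homotopic_with (\<lambda>_. True) (ind_space (M j)) (ind_space L) (\<lambda>m. m) (\<lambda>m. p)" if j: "j < k" for j
    proof -
      obtain M' H where MH: "folds_to (M j) M'" "M' \<subseteq> H" "H \<subseteq> L" "contractible_space (ind_space H)"
        using null[OF j] by blast
      have "M j \<subseteq> L" using M(1)[OF j] v(2)[OF j] L(1) by auto
      then show ?thesis
        by (rule null_homotopic_inclusion[OF finL pcL p M(2)[OF j] _ MH])
    qed
  qed
  also have "wedge ?Xs homotopy_equivalent_space wedge Zs"
  proof (rule wedge_homotopy_equivalent)
    show "length ?Xs = length Zs" "?Xs \<noteq> []"
      using Z(1) by (simp_all add: suspension_wedge_nth) (simp add: suspension_wedge_def)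
    fix i assume i: "i < length ?Xs"
    show "pointed_equivalent (fst (?Xs ! i)) (snd (?Xs ! i)) (fst (Zs ! i)) (snd (Zs ! i))"
    proof (cases "i < k")
      case True
      have "base_copy (ind_space (M i)) homeomorphic_space ind_space (M i)"
        using homeomorphic_map_base_copy homeomorphic_space homeomorphic_space_sym by blast
      then have "suspension (base_copy (ind_space (M i))) homeomorphic_space ind_space (insert x (insert y (M i)))"
        by (rule suspension_add_edge[OF finM[OF True] M(2)[OF True] xy[OF True]])
      then have "pointed_equivalent (suspension (base_copy (ind_space (M i)))) South (fst (Zs ! i)) (snd (Zs ! i))"
        by (rule pointed_equivalent_ind_spaces[OF _ _ _ C(1)[OF True] Z(2,3) C(3)])
           (use True finM[OF True] in \<open>auto simp: topspace_suspension\<close>)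
      then show ?thesis using True by (simp add: suspension_wedge_nth)
    next
      case False
      then have [simp]: "i = k" using i by (simp add: suspension_wedge_nth)
      have "base_copy (ind_space L) homeomorphic_space ind_space L"
        using homeomorphic_map_base_copy homeomorphic_space homeomorphic_space_sym by blast
      then have "pointed_equivalent (base_copy (ind_space L)) (Base p) (fst (Zs ! k)) (snd (Zs ! k))"
        by (rule pointed_equivalent_ind_spaces[OF _ _ finL C(2) Z(2,3) C(3)])
           (use p in \<open>auto simp: topspace_base_copy\<close>)
      then show ?thesis by (simp add: suspension_wedge_nth)
    qed
  qed
  finally show ?thesis .
qed

section \<open>Disjoint edges: iterated suspensions and spheres\<close>

fun add_edges :: "('a \<times> 'a) list \<Rightarrow> 'a set \<Rightarrow> 'a set" where
  "add_edges [] A = A"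
| "add_edges ((x, y) # ps) A = insert x (insert y (add_edges ps A))"

text \<open>The list is built from its end: each edge is separated from \<open>A\<close> and from
  all later entries, and so suspends the complex on these.\<close>

fun separate_edges :: "('a \<times> 'a) list \<Rightarrow> 'a set \<Rightarrow> bool" where
  "separate_edges [] A \<longleftrightarrow> True"
| "separate_edges ((x, y) # ps) A \<longleftrightarrow> edge_disjoint_from x y (add_edges ps A) \<and> separate_edges ps A"

lemma add_edges_eq: "add_edges ps A = A \<union> fst ` set ps \<union> snd ` set ps"
  by (induction ps A rule: add_edges.induct) auto

lemma finite_add_edges: "finite (add_edges ps A) \<longleftrightarrow> finite A"
  by (simp add: add_edges_eq)

lemma iter_suspension_add_edges:
  assumes "finite A" "A \<noteq> {}" "separate_edges ps A"
  shows "iter_suspension (length ps) (ind_space A) homeomorphic_space ind_space (add_edges ps A)"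
  using assms(3)
proof (induction ps)
  case Nil
  then show ?case
    using homeomorphic_map_base_copy[of "ind_space A"] homeomorphic_space homeomorphic_space_sym
    by (fastforce simp: iter_suspension_def)
next
  case (Cons e ps)
  obtain x y where e: "e = (x, y)" by (cases e)
  have "suspension (iter_suspension (length ps) (ind_space A)) homeomorphic_space
      ind_space (insert x (insert y (add_edges ps A)))"
    by (rule suspension_add_edge) (use Cons e assms in \<open>auto simp: finite_add_edges add_edges_eq\<close>)
  then show ?case by (simp add: e iter_suspension_def)
qed

lemma separate_edges_nth:
  assumes "separate_edges ps A" "i < length ps"
  shows "adj (fst (ps ! i)) (snd (ps ! i))"
    and "\<lbrakk>j < length ps; i \<noteq> j; u \<in> {fst (ps ! i), snd (ps ! i)}; w \<in> {fst (ps ! j), snd (ps ! j)}\<rbrakk> \<Longrightarrow> u \<noteq> w \<and> \<not> adj u w"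
proof -
  have drop: "edge_disjoint_from (fst (ps ! i)) (snd (ps ! i)) (add_edges (drop (Suc i) ps) A)"
    if "i < length ps" for i
    using assms(1) that
  proof (induction ps arbitrary: i)
    case (Cons e ps)
    then show ?case by (cases e; cases i) auto
  qed simp
  show "adj (fst (ps ! i)) (snd (ps ! i))"
    using drop[OF assms(2)] by (simp add: edge_disjoint_from_def)
  have later: "u \<noteq> w \<and> \<not> adj u w \<and> \<not> adj w u" if "i < j" "j < length ps"
    "u \<in> {fst (ps ! i), snd (ps ! i)}" "w \<in> {fst (ps ! j), snd (ps ! j)}" for i j u w
  proof -
    have "ps ! j \<in> set (drop (Suc i) ps)"
      using nth_mem[of "j - Suc i" "drop (Suc i) ps"] that by simp
    then have "w \<in> add_edges (drop (Suc i) ps) A"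
      using that by (auto simp: add_edges_eq)
    then show ?thesis
      using drop[of i] that adj_sym unfolding edge_disjoint_from_def by (metis insertE order.strict_trans singletonD)
  qed
  show "u \<noteq> w \<and> \<not> adj u w"
    if "j < length ps" "i \<noteq> j" "u \<in> {fst (ps ! i), snd (ps ! i)}" "w \<in> {fst (ps ! j), snd (ps ! j)}"
    using later[of i j u w] later[of j i w u] that assms(2) by (metis linorder_neqE_nat)
qed

text \<open>The cross-polytope, projected radially onto the sphere.\<close>

lemma nsphere_add_edges:
  assumes ps: "separate_edges ps {}" and len: "length ps = Suc k"
  shows "nsphere k homeomorphic_space ind_space (add_edges ps {})"
proof -
  define p where "p i = fst (ps ! i)" for i
  define q where "q i = snd (ps ! i)" for i
  let ?B = "add_edges ps {}"
  have B: "?B = p ` {..k} \<union> q ` {..k}"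
    unfolding add_edges_eq p_def q_def using len
    by (auto simp: set_conv_nth image_iff less_Suc_eq_le)
  have finB: "finite ?B" by (simp add: finite_add_edges)
  have pq: "adj (p i) (q i)" if "i \<le> k" for i
    using separate_edges_nth(1)[OF ps] that len by (simp add: p_def q_def)
  have sep: "u \<noteq> w \<and> \<not> adj u w" if "i \<le> k" "j \<le> k" "i \<noteq> j" "u \<in> {p i, q i}" "w \<in> {p j, q j}" for i j u w
    using separate_edges_nth(2)[OF ps, of i j u w] that len by (simp add: p_def q_def)
  have pq_neq: "p i \<noteq> q j" if "i \<le> k" "j \<le> k" for i j
    using that pq adj_irrefl sep[of i j "p i" "q j"] by (cases "i = j") (metis, simp)
  have inj: "inj_on p {..k}" "inj_on q {..k}"
    using sep by (auto intro!: inj_onI)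
  have sumB: "sum x ?B = (\<Sum>i\<le>k. x (p i) + x (q i))" for x :: "'a \<Rightarrow> real"
  proof -
    have "sum x ?B = sum x (p ` {..k}) + sum x (q ` {..k})"
      unfolding B using pq_neq by (intro sum.union_disjoint) auto
    then show ?thesis by (simp add: sum.reindex inj sum.distrib o_def)
  qed
  define N where "N x = sqrt (\<Sum>i\<le>k. (x (p i) - x (q i))\<^sup>2)" for x :: "'a \<Rightarrow> real"
  \<comment> \<open>At most one of \<open>x (p i)\<close> and \<open>x (q i)\<close> is nonzero, so
    their difference retains both; dividing by \<open>N x\<close> projects to the unit
    sphere.\<close>
  define f where "f x = (\<lambda>i. if i \<le> k then (x (p i) - x (q i)) / N x else 0)" for x
  define S where "S y = (\<Sum>i\<le>k. \<bar>y i\<bar>)" for y :: "nat \<Rightarrow> real"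
  \<comment> \<open>The inverse splits each coordinate into its positive part on \<open>p i\<close>
    and its negative part on \<open>q i\<close>, normalised by the sum of absolute values instead of
    the Euclidean norm.\<close>
  define g where "g y = (\<lambda>v. (\<Sum>i\<le>k. (if v = p i then max 0 (y i) else 0) + (if v = q i then max 0 (- y i) else 0)) / S y)"
    for y :: "nat \<Rightarrow> real"
  have x_pq: "x (p i) = 0 \<or> x (q i) = 0" if "x \<in> topspace (ind_space ?B)" "i \<le> k" for x i
    using that pq[OF that(2)] by (auto simp: in_ind_space_iff[OF finB])
  have Npos: "0 < N x" if x: "x \<in> topspace (ind_space ?B)" for x
  proof -
    have "sum x ?B = 1" using x by (simp add: in_ind_space_iff[OF finB])
    then obtain i where i: "i \<le> k" "x (p i) + x (q i) \<noteq> 0"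
      unfolding sumB by (metis (no_types, lifting) atMost_iff sum.neutral zero_neq_one)
    then have "x (p i) - x (q i) \<noteq> 0" using x_pq[OF x i(1)] by auto
    then have "0 < (x (p i) - x (q i))\<^sup>2" by simp
    also have "\<dots> \<le> (\<Sum>i\<le>k. (x (p i) - x (q i))\<^sup>2)"
      using i(1) by (intro member_le_sum) auto
    finally show ?thesis by (simp add: N_def)
  qed
  have Spos: "0 < S y" if y: "y \<in> topspace (nsphere k)" for y
  proof -
    have "(\<Sum>i\<le>k. (y i)\<^sup>2) = 1" using y by (simp add: nsphere)
    then obtain i where i: "i \<le> k" "y i \<noteq> 0"
      by (metis (no_types, lifting) atMost_iff power_zero_numeral sum.neutral zero_neq_one)
    have "0 < \<bar>y i\<bar>" using i by simp
    also have "\<dots> \<le> S y" unfolding S_def using i(1) by (intro member_le_sum) auto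
    finally show ?thesis .
  qed
  have g_p: "g y (p i) = max 0 (y i) / S y" if "i \<le> k" for y i
  proof -
    have "(\<Sum>j\<le>k. (if p i = p j then max 0 (y j) else 0) + (if p i = q j then max 0 (- y j) else 0)) =
        (\<Sum>j\<le>k. if j = i then max 0 (y j) else 0)"
      using that pq_neq inj(1) by (intro sum.cong) (auto dest: inj_onD)
    then show ?thesis using that by (simp add: g_def)
  qed
  have g_q: "g y (q i) = max 0 (- y i) / S y" if "i \<le> k" for y i
  proof -
    have "(\<Sum>j\<le>k. (if q i = p j then max 0 (y j) else 0) + (if q i = q j then max 0 (- y j) else 0)) =
        (\<Sum>j\<le>k. if j = i then max 0 (- y j) else 0)"
      using that pq_neq[symmetric] inj(2) by (intro sum.cong) (auto dest: inj_onD)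
    then show ?thesis using that by (simp add: g_def)
  qed
  have g_out: "g y v = 0" if "v \<notin> ?B" for y v
  proof -
    have "(\<Sum>j\<le>k. (if v = p j then max 0 (y j) else 0) + (if v = q j then max 0 (- y j) else 0)) = 0"
      using that unfolding B by (intro sum.neutral) auto
    then show ?thesis by (simp add: g_def)
  qed
  have f_in: "f x \<in> topspace (nsphere k)" if x: "x \<in> topspace (ind_space ?B)" for x
  proof -
    have "(\<Sum>i\<le>k. (f x i)\<^sup>2) = (\<Sum>i\<le>k. (x (p i) - x (q i))\<^sup>2) / (N x)\<^sup>2"
      by (simp add: f_def power_divide sum_divide_distrib)
    also have "(N x)\<^sup>2 = (\<Sum>i\<le>k. (x (p i) - x (q i))\<^sup>2)"
      unfolding N_def by (simp add: sum_nonneg)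
    finally have "(\<Sum>i\<le>k. (f x i)\<^sup>2) = 1"
      using Npos[OF x] by (simp add: N_def)
    then show ?thesis by (simp add: nsphere f_def)
  qed
  have g_in: "g y \<in> topspace (ind_space ?B)" if y: "y \<in> topspace (nsphere k)" for y
  proof (subst in_ind_space_iff[OF finB], intro conjI allI impI)
    show "0 \<le> g y v" for v
      using Spos[OF y] g_p[of _ y] g_q[of _ y] g_out[of v y] unfolding B
      by (cases "v \<in> p ` {..k} \<union> q ` {..k}") auto
    show "g y v = 0" if "v \<notin> ?B" for v using that by (rule g_out)
    show "\<not> adj u v" if uv: "g y u \<noteq> 0" "g y v \<noteq> 0" for u v
    proof
      assume adj: "adj u v"
      have "u \<in> ?B" "v \<in> ?B" using uv g_out by blast+
      then obtain i j where ij: "i \<le> k" "j \<le> k" "u \<in> {p i, q i}" "v \<in> {p j, q j}" unfolding B by blast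
      then have "i = j" using sep adj by blast
      moreover have "g y (p i) = 0 \<or> g y (q i) = 0" using g_p[OF ij(1)] g_q[OF ij(1)] by (auto simp: max_def)
      ultimately show False using ij uv adj adj_irrefl by auto
    qed
    have "sum (g y) ?B = (\<Sum>i\<le>k. \<bar>y i\<bar> / S y)"
      unfolding sumB by (intro sum.cong) (auto simp: g_p g_q max_def simp flip: add_divide_distrib)
    then show "sum (g y) ?B = 1"
      using Spos[OF y] by (simp add: S_def flip: sum_divide_distrib)
  qed
  have gf: "g (f x) = x" if x: "x \<in> topspace (ind_space ?B)" for x
  proof
    fix v
    have x': "\<And>v. 0 \<le> x v" "\<And>v. v \<notin> ?B \<Longrightarrow> x v = 0" "sum x ?B = 1"
      using x by (auto simp: in_ind_space_iff[OF finB])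
    have fi: "\<bar>f x i\<bar> = (x (p i) + x (q i)) / N x" if "i \<le> k" for i
      using x_pq[OF x that] x'(1)[of "p i"] x'(1)[of "q i"] Npos[OF x] that by (auto simp: f_def)
    have "S (f x) = (\<Sum>i\<le>k. (x (p i) + x (q i)) / N x)"
      unfolding S_def by (intro sum.cong) (use fi in auto)
    also have "\<dots> = 1 / N x"
      using x'(3) unfolding sumB by (simp flip: sum_divide_distrib)
    finally have SN: "S (f x) = 1 / N x" .
    have "max 0 (f x i) = x (p i) / N x" "max 0 (- f x i) = x (q i) / N x" if "i \<le> k" for i
      using x_pq[OF x that] x'(1)[of "p i"] x'(1)[of "q i"] Npos[OF x] that
      by (auto simp: f_def max_def divide_le_0_iff zero_le_divide_iff)
    then have "g (f x) (p i) = x (p i)" "g (f x) (q i) = x (q i)" if "i \<le> k" for i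
      using that Npos[OF x] by (simp_all add: g_p g_q SN)
    then show "g (f x) v = x v"
      using g_out[of v "f x"] x'(2)[of v] unfolding B by (cases "v \<in> p ` {..k} \<union> q ` {..k}") auto
  qed
  have fg: "f (g y) = y" if y: "y \<in> topspace (nsphere k)" for y
  proof
    fix i
    have y1: "(\<Sum>i\<le>k. (y i)\<^sup>2) = 1" and y0: "\<And>i. i > k \<Longrightarrow> y i = 0" using y by (auto simp: nsphere)
    have diff: "g y (p i) - g y (q i) = y i / S y" if "i \<le> k" for i
      using that by (auto simp: g_p g_q max_def simp flip: diff_divide_distrib)
    have "N (g y) = sqrt (\<Sum>i\<le>k. (y i / S y)\<^sup>2)"
      unfolding N_def using diff by simp
    also have "\<dots> = 1 / S y"
      using y1 Spos[OF y] by (simp add: power_divide real_sqrt_divide flip: sum_divide_distrib)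
    finally show "f (g y) i = y i"
      using diff[of i] Spos[OF y] y0[of i] by (auto simp: f_def)
  qed
  have "homeomorphic_maps (nsphere k) (ind_space ?B) g f"
    unfolding homeomorphic_maps_def
  proof (intro conjI ballI)
    show "continuous_map (nsphere k) (ind_space ?B) g"
    proof (rule continuous_map_into_realization)
      fix v
      have "continuous_map (nsphere k) euclideanreal (\<lambda>y. if v = p i then max 0 (y i) else 0)"
        "continuous_map (nsphere k) euclideanreal (\<lambda>y. if v = q i then max 0 (- y i) else 0)" for i
        using continuous_map_nsphere_projection
        by (cases "v = p i"; cases "v = q i"; force intro: continuous_map_real_max continuous_map_minus)+
      then show "continuous_map (nsphere k) euclideanreal (\<lambda>y. g y v)"
        unfolding g_def S_def
      proof (intro continuous_map_real_divide continuous_map_sum continuous_map_add continuous_map_real_abs)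
        fix y assume "y \<in> topspace (nsphere k)"
        then show "(\<Sum>i\<le>k. \<bar>y i\<bar>) \<noteq> 0" using Spos[of y] by (simp add: S_def)
      qed (auto intro: continuous_map_nsphere_projection)
    qed (rule g_in)
    have Nc: "continuous_map (ind_space ?B) euclideanreal N"
      unfolding N_def
      by (intro continuous_map_sqrt continuous_map_sum continuous_map_real_pow continuous_map_diff continuous_map_realization) simp
    have "continuous_map (ind_space ?B) euclideanreal (\<lambda>x. f x i)" for i
    proof (cases "i \<le> k")
      case True
      have "continuous_map (ind_space ?B) euclideanreal (\<lambda>x. (x (p i) - x (q i)) / N x)"
        by (intro continuous_map_real_divide continuous_map_diff continuous_map_realization Nc)
           (use Npos in force)
      then show ?thesis using True by (simp add: f_def)
    qed (simp add: f_def)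
    then have "continuous_map (ind_space ?B) (powertop_real UNIV) f"
      by (simp add: continuous_map_componentwise_UNIV)
    then show "continuous_map (ind_space ?B) (nsphere k) f"
      unfolding nsphere by (rule continuous_map_into_subtopology) (use f_in in \<open>auto simp: nsphere\<close>)
  qed (use gf fg in auto)
  then show ?thesis by (auto simp: homeomorphic_space_def)
qed

end


section \<open>The hexagonal strip\<close>

text \<open>One infinite graph contains all \<open>H2 n\<close> and \<open>Y n\<close> as induced
  subgraphs. Each row is a path, including row \<open>0\<close>, which supplies the auxiliary edge;
  the rungs between rows \<open>1\<close> and \<open>2\<close> are slanted by one column, those
  between rows \<open>2\<close> and \<open>3\<close> are not.\<close>

definition hex_adj :: "nat \<times> nat \<Rightarrow> nat \<times> nat \<Rightarrow> bool" where
  "hex_adj u v \<longleftrightarrow>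
     (fst u = fst v \<and> (snd v = Suc (snd u) \<or> snd u = Suc (snd v))) \<or>
     (fst u = 1 \<and> fst v = 2 \<and> snd v = Suc (snd u) \<and> odd (snd u)) \<or>
     (fst u = 2 \<and> fst v = 1 \<and> snd u = Suc (snd v) \<and> odd (snd v)) \<or>
     ((fst u = 2 \<and> fst v = 3 \<or> fst u = 3 \<and> fst v = 2) \<and> snd u = snd v \<and> odd (snd u))"

interpretation hex: graph_relation hex_adj
proof
  show "hex_adj v u" if "hex_adj u v" for u v
    using that unfolding hex_adj_def by (elim disjE conjE) simp_all
  show "\<not> hex_adj v v" for v
    by (simp add: hex_adj_def)
qed

lemma edges_H2_iff:
  assumes "u \<in> verts (H2 n)" "v \<in> verts (H2 n)"
  shows "{u, v} \<in> edges (H2 n) \<longleftrightarrow> hex_adj u v"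
proof
  assume "{u, v} \<in> edges (H2 n)"
  then consider r where "{u, v} = {(1, r), (1, r + 1)}" | r where "{u, v} = {(3, r), (3, r + 1)}"
    | r where "{u, v} = {(2, r), (2, r + 1)}"
    | t where "{u, v} = {(1, 2 * t - 1), (2, 2 * t)}" "1 \<le> t" | t where "{u, v} = {(2, 2 * t - 1), (3, 2 * t - 1)}" "1 \<le> t"
    unfolding H2_def snd_conv by blast
  then show "hex_adj u v"
  proof cases
    case 4
    then obtain t' where "t = Suc t'" by (cases t) auto
    then have "{u, v} = {(1, Suc (2 * t')), (2, Suc (Suc (2 * t')))}" using 4 by simp
    then show ?thesis unfolding doubleton_eq_iff by (elim disjE conjE) (simp_all add: hex_adj_def)
  next
    case 5
    then obtain t' where "t = Suc t'" by (cases t) auto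
    then have "{u, v} = {(2, Suc (2 * t')), (3, Suc (2 * t'))}" using 5 by simp
    then show ?thesis unfolding doubleton_eq_iff by (elim disjE conjE) (simp_all add: hex_adj_def)
  qed (unfold doubleton_eq_iff, (elim disjE conjE; simp add: hex_adj_def)+)
next
  assume adj: "hex_adj u v"
  obtain i r j s where uv: "u = (i, r)" "v = (j, s)" by (cases u; cases v)
  have odd: "\<exists>t\<ge>1. t \<le> n + 1 \<and> r = 2 * t - 1" if "odd r" "1 \<le> r" "r \<le> 2 * n + 1" for r
    using that by (intro exI[of _ "(r + 1) div 2"]) (auto elim!: oddE)
  have side: "{(1, r), (2, Suc r)} \<in> edges (H2 n)" if r: "odd r" "1 \<le> r" "r \<le> 2 * n + 1" for r
  proof -
    obtain t where "1 \<le> t" "t \<le> n + 1" "r = 2 * t - 1" using odd[OF r] by auto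
    then show ?thesis by (auto simp: H2_def)
  qed
  have side': "{(2, r), (3, r)} \<in> edges (H2 n)" if r: "odd r" "1 \<le> r" "r \<le> 2 * n + 1" for r
  proof -
    obtain t where "1 \<le> t" "t \<le> n + 1" "r = 2 * t - 1" using odd[OF r] by auto
    then show ?thesis by (auto simp: H2_def)
  qed
  have row: "{(1, r), (1, Suc r)} \<in> edges (H2 n)" "{(3, r), (3, Suc r)} \<in> edges (H2 n)"
    if "1 \<le> r" "r \<le> 2 * n" for r
    using that by (auto simp: H2_def)
  have row2: "{(2, r), (2, Suc r)} \<in> edges (H2 n)" if "1 \<le> r" "r \<le> 2 * n + 1" for r
    using that by (auto simp: H2_def)
  have r: "1 \<le> r" "1 \<le> s" "i = 1 \<or> i = 2 \<or> i = 3" "j = 1 \<or> j = 2 \<or> j = 3" "r \<le> 2 * n + 2" "s \<le> 2 * n + 2"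
    "i \<noteq> 2 \<longrightarrow> r \<le> 2 * n + 1" "j \<noteq> 2 \<longrightarrow> s \<le> 2 * n + 1"
    using assms uv by (auto simp: H2_def)
  consider "i = j" "s = Suc r" | "i = j" "r = Suc s" | "i = 1" "j = 2" "s = Suc r" "odd r"
    | "i = 2" "j = 1" "r = Suc s" "odd s" | "i = 2" "j = 3" "r = s" "odd r" | "i = 3" "j = 2" "r = s" "odd r"
    using adj uv by (auto simp: hex_adj_def)
  then show "{u, v} \<in> edges (H2 n)"
  proof cases
    case 1
    then show ?thesis using r uv row[of r] row2[of r] by auto
  next
    case 2
    then show ?thesis using r uv row[of s] row2[of s] by (auto simp: insert_commute)
  next
    case 3
    then show ?thesis using r uv side[of r] by auto
  next
    case 4
    then show ?thesis using r uv side[of s] by (auto simp: insert_commute)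
  next
    case 5
    then show ?thesis using r uv side'[of r] by auto
  next
    case 6
    then show ?thesis using r uv side'[of r] by (auto simp: insert_commute)
  qed
qed

lemma Ind_H2: "Ind (H2 n) = hex.ind_complex (verts (H2 n))"
  using edges_H2_iff unfolding Ind_def independent_def hex.ind_complex_def by blast

lemma Ind_Y: "Ind (Y n) = hex.ind_complex (verts (Y n))"
proof -
  have sub: "verts (Y n) \<subseteq> verts (H2 n)" by (auto simp: Y_def del_verts_def)
  have "{u, v} \<in> edges (Y n) \<longleftrightarrow> hex_adj u v" if "u \<in> verts (Y n)" "v \<in> verts (Y n)" for u v
    using edges_H2_iff[of u n v] that sub by (auto simp: Y_def del_verts_def)
  then show ?thesis
    unfolding Ind_def independent_def hex.ind_complex_def by blast
qed

lemma finite_verts_H2: "finite (verts (H2 n))" and finite_verts_Y: "finite (verts (Y n))"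
  using finite_simple_graph_H2[of n] finite_simple_graph_Y[of n] by (auto simp: finite_simple_graph_def)

text \<open>All folds take place in a window of bounded width at the right end of the strip. The
  strip is invariant under translation by two columns, so window vertices are described by
  coordinates relative to column \<open>2 * m\<close>. The part \<open>R\<close> of the graph left of the window is arbitrary,
  except that row \<open>i\<close> of \<open>R\<close> ends before the relative column \<open>b ! i\<close>. Row \<open>0\<close> is not part of the
  graph and hosts an additional edge.\<close>

definition shift :: "nat \<Rightarrow> nat \<times> nat \<Rightarrow> nat \<times> nat" where
  "shift m u = (fst u, 2 * m + snd u)"

definition left_of :: "nat list \<Rightarrow> nat \<Rightarrow> (nat \<times> nat) set" where
  "left_of b m = {u. snd u < 2 * m + b ! fst u}"

definition region :: "(nat \<times> nat) set \<Rightarrow> nat \<Rightarrow> (nat \<times> nat) list \<Rightarrow> (nat \<times> nat) set" where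
  "region R m W = R \<union> shift m ` set W"

text \<open>The list is complete only from relative column \<open>1\<close> on: a left neighbour of
  column \<open>0\<close> has no relative coordinates. Hence the tests \<open>1 \<le> snd u\<close>
  in the checkers below.\<close>

definition nbrs :: "nat \<times> nat \<Rightarrow> (nat \<times> nat) list" where
  "nbrs u = (case u of (i, r) \<Rightarrow> (i, Suc r) # (i, r - 1) #
     (if i = 1 then if odd r then [(2, Suc r)] else []
      else if i = 2 then if odd r then [(3, r)] else [(1, r - 1)]
      else if i = 3 then if odd r then [(2, r)] else [] else []))"

lemma inj_shift: "shift m u = shift m v \<longleftrightarrow> u = v"
  by (auto simp: shift_def prod_eq_iff)

lemma hex_adj_shift: "hex_adj (shift m u) (shift m v) = hex_adj u v"
  by (auto simp: shift_def hex_adj_def)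

lemma nbrs_complete:
  assumes "hex_adj (shift m u) v" "1 \<le> snd u"
  obtains w where "w \<in> set (nbrs u)" "v = shift m w" "hex_adj u w"
proof -
  obtain i r j s where uv: "u = (i, r)" "v = (j, s)" by (cases u; cases v)
  have s: "2 * m \<le> s" using assms uv by (auto simp: hex_adj_def shift_def)
  then obtain s' where s': "s = 2 * m + s'" by (metis le_add_diff_inverse)
  then have v: "v = shift m (j, s')" by (simp add: uv shift_def)
  then have adj: "hex_adj u (j, s')" using assms(1) by (simp add: hex_adj_shift)
  then have "(j, s') \<in> set (nbrs u)"
    using assms(2) uv by (auto simp: hex_adj_def nbrs_def)
  then show ?thesis using that v adj by blast
qed

fun fold_list :: "nat list \<Rightarrow> (nat \<times> nat) list \<Rightarrow> ((nat \<times> nat) \<times> (nat \<times> nat)) list \<Rightarrow> (nat \<times> nat) list option" where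
  "fold_list b W [] = Some W"
| "fold_list b W ((u, v) # fs) =
     (if u \<in> set W \<and> v \<in> set W \<and> u \<noteq> v \<and> \<not> hex_adj u v \<and> 1 \<le> snd u \<and> b ! fst v \<le> snd v \<and>
         list_all (\<lambda>w. if w \<in> set W then hex_adj v w else b ! fst w \<le> snd w) (nbrs u)
      then fold_list b (removeAll v W) fs else None)"

lemma not_left_of: "b ! fst v \<le> snd v \<Longrightarrow> shift m v \<notin> left_of b m"
  by (auto simp: left_of_def shift_def)

lemma in_region_shift:
  assumes "R \<subseteq> left_of b m" "b ! fst v \<le> snd v"
  shows "shift m v \<in> region R m W \<longleftrightarrow> v \<in> set W"
  using assms not_left_of[of b v m] by (auto simp: region_def inj_shift)

lemma region_remove:
  assumes "R \<subseteq> left_of b m" "b ! fst v \<le> snd v"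
  shows "region R m W - {shift m v} = region R m (removeAll v W)"
  using assms not_left_of[of b v m] by (auto simp: region_def inj_shift)

lemma dominated_region:
  assumes R: "R \<subseteq> left_of b m" and uv: "u \<in> set W" "v \<in> set W" "u \<noteq> v" "\<not> hex_adj u v" "1 \<le> snd u"
    and nb: "list_all (\<lambda>w. if w \<in> set W then hex_adj v w else b ! fst w \<le> snd w) (nbrs u)"
  shows "hex.dominated (region R m W) (shift m u) (shift m v)"
  unfolding hex.dominated_def
proof (intro conjI ballI impI)
  fix w assume w: "w \<in> region R m W" and adj: "hex_adj (shift m u) w"
  obtain w' where w': "w' \<in> set (nbrs u)" "w = shift m w'" using nbrs_complete[OF adj uv(5)] .
  then have "if w' \<in> set W then hex_adj v w' else b ! fst w' \<le> snd w'"
    using nb by (simp add: list_all_iff)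
  moreover have "w' \<in> set W" if "b ! fst w' \<le> snd w'"
    using in_region_shift[OF R that] w w'(2) by simp
  ultimately have "hex_adj v w'" by (auto split: if_splits)
  then show "hex_adj (shift m v) w" by (simp add: w'(2) hex_adj_shift)
qed (use uv in \<open>auto simp: region_def inj_shift hex_adj_shift\<close>)

lemma fold_list_sound:
  assumes R: "R \<subseteq> left_of b m"
  shows "fold_list b W fs = Some W' \<Longrightarrow> hex.folds_to (region R m W) (region R m W')"
proof (induction fs arbitrary: W)
  case Nil
  then show ?case by (simp add: hex.folds_to_refl)
next
  case (Cons f fs)
  obtain u v where f: "f = (u, v)" by (cases f)
  have c: "u \<in> set W" "v \<in> set W" "u \<noteq> v" "\<not> hex_adj u v" "1 \<le> snd u" "b ! fst v \<le> snd v"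
    "list_all (\<lambda>w. if w \<in> set W then hex_adj v w else b ! fst w \<le> snd w) (nbrs u)"
    and rest: "fold_list b (removeAll v W) fs = Some W'"
    using Cons.prems unfolding f by (auto split: if_split_asm simp: list_all_iff)
  have "hex.folds_to (region R m W - {shift m v}) (region R m W')"
    unfolding region_remove[OF R c(6)] by (rule Cons.IH[OF rest])
  then show ?case
    by (rule hex.folds_to_step[OF dominated_region[OF R c(1-5,7)]])
qed

text \<open>Sufficient, for every \<open>R\<close> within the bounds \<open>b\<close>, for
  \<open>v\<close> to be outside the region and without neighbours in it. With \<open>W = []\<close>
  it separates \<open>v\<close> from \<open>R\<close> alone.\<close>

definition clear :: "nat list \<Rightarrow> (nat \<times> nat) list \<Rightarrow> nat \<times> nat \<Rightarrow> bool" where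
  "clear b W v \<longleftrightarrow> 1 \<le> snd v \<and> b ! fst v \<le> snd v \<and> v \<notin> set W \<and>
     list_all (\<lambda>w. b ! fst w \<le> snd w \<and> w \<notin> set W) (nbrs v)"

lemma clear_sound:
  assumes R: "R \<subseteq> left_of b m" and v: "clear b W v"
  shows "shift m v \<notin> region R m W" and "w \<in> region R m W \<Longrightarrow> \<not> hex_adj (shift m v) w"
proof -
  show "shift m v \<notin> region R m W"
    using in_region_shift[OF R, of v W] v by (simp add: clear_def)
  assume w: "w \<in> region R m W"
  show "\<not> hex_adj (shift m v) w"
  proof
    assume adj: "hex_adj (shift m v) w"
    have "1 \<le> snd v" using v by (simp add: clear_def)
    then obtain w' where w': "w' \<in> set (nbrs v)" "w = shift m w'" using nbrs_complete[OF adj] by metis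
    then have "b ! fst w' \<le> snd w'" "w' \<notin> set W" using v by (auto simp: clear_def list_all_iff)
    then show False using in_region_shift[OF R, of w' W] w w'(2) by simp
  qed
qed

lemma edge_disjoint_region:
  assumes "R \<subseteq> left_of b m" "hex_adj x y" "clear b W x" "clear b W y"
  shows "hex.edge_disjoint_from (shift m x) (shift m y) (region R m W)"
  unfolding hex.edge_disjoint_from_def
  using clear_sound[OF assms(1,3)] clear_sound[OF assms(1,4)] assms(2) by (auto simp: hex_adj_shift)

fun clear_edges :: "nat list \<Rightarrow> (nat \<times> nat) list \<Rightarrow> ((nat \<times> nat) \<times> (nat \<times> nat)) list \<Rightarrow> bool" where
  "clear_edges b T [] \<longleftrightarrow> True"
| "clear_edges b T ((x, y) # ps) \<longleftrightarrow> hex_adj x y \<and> clear b (map fst ps @ map snd ps @ T) x \<and>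
     clear b (map fst ps @ map snd ps @ T) y \<and> clear_edges b T ps"

abbreviation shift_edges :: "nat \<Rightarrow> ((nat \<times> nat) \<times> (nat \<times> nat)) list \<Rightarrow> ((nat \<times> nat) \<times> (nat \<times> nat)) list" where
  "shift_edges m \<equiv> map (map_prod (shift m) (shift m))"

lemma add_edges_region:
  "hex.add_edges (shift_edges m ps) (region R m T) = region R m (map fst ps @ map snd ps @ T)"
  by (auto simp: hex.add_edges_eq region_def image_Un image_image)

lemma separate_edges_region:
  assumes "R \<subseteq> left_of b m"
  shows "clear_edges b T ps \<Longrightarrow> hex.separate_edges (shift_edges m ps) (region R m T)"
proof (induction ps)
  case (Cons e ps)
  obtain x y where e: "e = (x, y)" by (cases e)
  then show ?case
    using Cons edge_disjoint_region[OF assms, of x y "map fst ps @ map snd ps @ T"]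
    by (simp add: add_edges_region)
qed simp

text \<open>Two edges make the result a suspension of a nonempty complex, hence path connected, even
  if nothing else remains. The final vertex lists are compared as sets, through both
  inclusions.\<close>

definition folds_onto :: "nat list \<Rightarrow> (nat \<times> nat) list \<Rightarrow> ((nat \<times> nat) \<times> (nat \<times> nat)) list \<Rightarrow>
    (nat \<times> nat) list \<Rightarrow> ((nat \<times> nat) \<times> (nat \<times> nat)) list \<Rightarrow> bool" where
  "folds_onto b W fs T ps \<longleftrightarrow> clear_edges b T ps \<and> 2 \<le> length ps \<and>
     (case fold_list b W fs of None \<Rightarrow> False | Some W' \<Rightarrow>
        list_all (\<lambda>u. u \<in> set (map fst ps @ map snd ps @ T)) W' \<and>
        list_all (\<lambda>u. u \<in> set W') (map fst ps @ map snd ps @ T))"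

lemma folds_onto_sound:
  assumes R: "R \<subseteq> left_of b m" "finite R" and fo: "folds_onto b W fs T ps"
  shows "hex.folds_to (region R m W) (hex.add_edges (shift_edges m ps) (region R m T))"
    and "hex.separate_edges (shift_edges m ps) (region R m T)"
    and "path_connected_space (hex.ind_space (hex.add_edges (shift_edges m ps) (region R m T)))"
proof -
  obtain W' where W': "fold_list b W fs = Some W'" "set W' = set (map fst ps @ map snd ps @ T)"
    using fo by (auto simp: folds_onto_def list_all_iff split: option.splits)
  then have "region R m W' = region R m (map fst ps @ map snd ps @ T)" by (simp only: region_def)
  then show "hex.folds_to (region R m W) (hex.add_edges (shift_edges m ps) (region R m T))"
    using fold_list_sound[OF R(1) W'(1)] by (simp only: add_edges_region)
  show sep: "hex.separate_edges (shift_edges m ps) (region R m T)"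
    using separate_edges_region[OF R(1)] fo by (simp add: folds_onto_def)
  obtain e e' ps' where ps: "ps = e # e' # ps'"
    using fo by (auto simp: folds_onto_def numeral_2_eq_2 Suc_le_length_iff)
  obtain x y where e: "e = (x, y)" by (cases e)
  have "finite (region R m T)" using R(2) by (simp add: region_def)
  then have "finite (hex.add_edges (shift_edges m (e' # ps')) (region R m T))"
    by (simp only: hex.finite_add_edges)
  moreover have "hex.add_edges (shift_edges m (e' # ps')) (region R m T) \<noteq> {}"
    by (simp add: hex.add_edges_eq)
  moreover have "hex.edge_disjoint_from (shift m x) (shift m y) (hex.add_edges (shift_edges m (e' # ps')) (region R m T))"
    using sep by (simp add: ps e)
  ultimately have "path_connected_space (hex.ind_space (insert (shift m x) (insert (shift m y)
      (hex.add_edges (shift_edges m (e' # ps')) (region R m T)))))"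
    by (rule hex.path_connected_add_edge)
  then show "path_connected_space (hex.ind_space (hex.add_edges (shift_edges m ps) (region R m T)))"
    by (simp add: ps e)
qed

definition link :: "(nat \<times> nat) list \<Rightarrow> nat \<times> nat \<Rightarrow> (nat \<times> nat) list" where
  "link W v = filter (\<lambda>u. u \<noteq> v \<and> \<not> hex_adj v u) W"

text \<open>The vertex lies far enough from \<open>R\<close> that all of \<open>R\<close> survives
  in its link; only the window needs filtering.\<close>

lemma link_region:
  assumes R: "R \<subseteq> left_of b m" and v: "clear b [] v"
  shows "{u \<in> region R m W. u \<noteq> shift m v \<and> \<not> hex_adj (shift m v) u} = region R m (link W v)"
proof -
  have "u \<noteq> shift m v \<and> \<not> hex_adj (shift m v) u" if "u \<in> R" for u
    using clear_sound(1)[OF R v] clear_sound(2)[OF R v, of u] that by (auto simp: region_def)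
  then show ?thesis by (auto simp: region_def link_def inj_shift hex_adj_shift)
qed

text \<open>After the folds \<open>w\<close> is isolated and hence a cone apex. It is taken out of
  the list because \<open>clear\<close> also asks for absence.\<close>

definition contracts :: "nat list \<Rightarrow> (nat \<times> nat) list \<Rightarrow> ((nat \<times> nat) \<times> (nat \<times> nat)) list \<Rightarrow> nat \<times> nat \<Rightarrow> bool" where
  "contracts b H hs w \<longleftrightarrow> (case fold_list b H hs of None \<Rightarrow> False | Some H' \<Rightarrow>
     w \<in> set H' \<and> clear b (removeAll w H') w)"

lemma contracts_sound:
  assumes R: "R \<subseteq> left_of b m" and c: "contracts b H hs w"
  obtains B where "hex.folds_to (region R m H) B" "shift m w \<in> B" "\<And>u. u \<in> B \<Longrightarrow> \<not> hex_adj (shift m w) u"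
proof -
  obtain H' where H': "fold_list b H hs = Some H'" "w \<in> set H'" "clear b (removeAll w H') w"
    using c by (auto simp: contracts_def split: option.splits)
  have "\<not> hex_adj (shift m w) u" if "u \<in> region R m H'" for u
  proof (cases "u = shift m w")
    case False
    then have "u \<in> region R m (removeAll w H')" using that by (auto simp: region_def)
    then show ?thesis using clear_sound(2)[OF R H'(3)] by blast
  qed (simp add: hex.adj_irrefl)
  then show ?thesis
    using that[OF fold_list_sound[OF R H'(1)]] H'(2) by (simp add: region_def)
qed

text \<open>\<open>link W v\<close>, suspended by the edge in row \<open>0\<close>, folds onto \<open>T\<close> together with the disjoint edges \<open>ps\<close>,
  and its inclusion into \<open>L\<close> is null-homotopic, since the link also folds (by \<open>gs\<close>) into the
  contractible part \<open>H\<close> of \<open>L\<close>.\<close>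

definition cone_certificate where
  "cone_certificate b W L v fs T ps gs H hs w \<longleftrightarrow>
     v \<in> set W \<and> clear b [] v \<and> link W v \<noteq> [] \<and> clear b (link W v) (0, 1) \<and> clear b (link W v) (0, 2) \<and>
     folds_onto b ((0, 1) # (0, 2) # link W v) fs T ps \<and>
     (case fold_list b (link W v) gs of None \<Rightarrow> False | Some M' \<Rightarrow> list_all (\<lambda>u. u \<in> set H) M') \<and>
     list_all (\<lambda>u. u \<in> set L) H \<and> contracts b H hs w"

lemma cone_certificate_sound:
  assumes R: "R \<subseteq> left_of b m" "finite R" and c: "cone_certificate b W L v fs T ps gs H hs w"
  shows "shift m v \<in> region R m W"
    and "{u \<in> region R m W. u \<noteq> shift m v \<and> \<not> hex_adj (shift m v) u} = region R m (link W v)"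
    and "region R m (link W v) \<noteq> {}"
    and "hex.edge_disjoint_from (shift m (0, 1)) (shift m (0, 2)) (region R m (link W v))"
    and "hex.folds_to (insert (shift m (0, 1)) (insert (shift m (0, 2)) (region R m (link W v))))
       (hex.add_edges (shift_edges m ps) (region R m T))"
    and "hex.separate_edges (shift_edges m ps) (region R m T)"
    and "path_connected_space (hex.ind_space (hex.add_edges (shift_edges m ps) (region R m T)))"
    and "\<exists>M' H. hex.folds_to (region R m (link W v)) M' \<and> M' \<subseteq> H \<and> H \<subseteq> region R m L \<and> contractible_space (hex.ind_space H)"
proof -
  have c': "v \<in> set W" "clear b [] v" "link W v \<noteq> []" "clear b (link W v) (0, 1)" "clear b (link W v) (0, 2)"
     "folds_onto b ((0, 1) # (0, 2) # link W v) fs T ps" "list_all (\<lambda>u. u \<in> set L) H" "contracts b H hs w"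
    using c by (auto simp: cone_certificate_def)
  show "shift m v \<in> region R m W" using c'(1) by (simp add: region_def)
  show "{u \<in> region R m W. u \<noteq> shift m v \<and> \<not> hex_adj (shift m v) u} = region R m (link W v)"
    by (rule link_region[OF R(1) c'(2)])
  show "region R m (link W v) \<noteq> {}" using c'(3) by (simp add: region_def)
  show "hex.edge_disjoint_from (shift m (0, 1)) (shift m (0, 2)) (region R m (link W v))"
    by (rule edge_disjoint_region[OF R(1) _ c'(4,5)]) (simp add: hex_adj_def)
  have "region R m ((0, 1) # (0, 2) # link W v) =
      insert (shift m (0, 1)) (insert (shift m (0, 2)) (region R m (link W v)))"
    by (auto simp: region_def)
  then show "hex.folds_to (insert (shift m (0, 1)) (insert (shift m (0, 2)) (region R m (link W v))))
       (hex.add_edges (shift_edges m ps) (region R m T))"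
    using folds_onto_sound(1)[OF R c'(6)] by simp
  show "hex.separate_edges (shift_edges m ps) (region R m T)"
    "path_connected_space (hex.ind_space (hex.add_edges (shift_edges m ps) (region R m T)))"
    using folds_onto_sound(2,3)[OF R c'(6)] by auto
  obtain M' where M': "fold_list b (link W v) gs = Some M'" "list_all (\<lambda>u. u \<in> set H) M'"
    using c by (auto simp: cone_certificate_def split: option.splits)
  obtain B where B: "hex.folds_to (region R m H) B" "shift m w \<in> B" "\<And>u. u \<in> B \<Longrightarrow> \<not> hex_adj (shift m w) u"
    using contracts_sound[OF R(1) c'(8)] by metis
  have "finite (region R m H)" using R(2) by (simp add: region_def)
  then have "contractible_space (hex.ind_space (region R m H))"
    by (rule hex.contractible_folds_to[OF _ B])
  moreover have "region R m M' \<subseteq> region R m H" "region R m H \<subseteq> region R m L"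
    using M'(2) c'(7) by (auto simp: region_def list_all_iff)
  ultimately show "\<exists>M' H. hex.folds_to (region R m (link W v)) M' \<and> M' \<subseteq> H \<and> H \<subseteq> region R m L \<and> contractible_space (hex.ind_space H)"
    using fold_list_sound[OF R(1) M'(1)] by blast
qed

section \<open>Wedge decompositions from certificates\<close>

lemma region_wedge_two:
  assumes R: "R \<subseteq> left_of b m" "finite R" and L: "L = filter (\<lambda>u. u \<noteq> v0 \<and> u \<noteq> v1) W" "L \<noteq> []"
    and adj: "hex_adj v0 v1"
    and c0: "cone_certificate b W L v0 fs0 T0 ps0 gs0 H0 hs0 w0"
    and c1: "cone_certificate b W L v1 fs1 T1 ps1 gs1 H1 hs1 w1"
    and c2: "folds_onto b L fs2 T2 ps2"
    and Z: "Z0 homeomorphic_space hex.ind_space (hex.add_edges (shift_edges m ps0) (region R m T0))"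
      "Z1 homeomorphic_space hex.ind_space (hex.add_edges (shift_edges m ps1) (region R m T1))"
      "Z2 homeomorphic_space hex.ind_space (hex.add_edges (shift_edges m ps2) (region R m T2))"
    and z: "z0 \<in> topspace Z0" "z1 \<in> topspace Z1" "z2 \<in> topspace Z2"
  shows "hex.ind_space (region R m W) homotopy_equivalent_space wedge [(Z0, z0), (Z1, z1), (Z2, z2)]"
proof -
  note s0 = cone_certificate_sound[OF R c0] and s1 = cone_certificate_sound[OF R c1] and s2 = folds_onto_sound[OF R c2]
  let ?v = "\<lambda>j::nat. if j = 0 then shift m v0 else shift m v1"
  let ?M = "\<lambda>j::nat. if j = 0 then region R m (link W v0) else region R m (link W v1)"
  let ?C = "\<lambda>j::nat. if j = 0 then hex.add_edges (shift_edges m ps0) (region R m T0)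
     else if j = 1 then hex.add_edges (shift_edges m ps1) (region R m T1)
     else hex.add_edges (shift_edges m ps2) (region R m T2)"
  have two: "j < 2 \<longleftrightarrow> j = 0 \<or> j = 1" and three: "j \<le> 2 \<longleftrightarrow> j = 0 \<or> j = 1 \<or> j = 2" for j :: nat by auto
  have img: "?v ` {..<2::nat} = {shift m v0, shift m v1}" by (auto simp: lessThan_nat_numeral lessThan_Suc)
  \<comment> \<open>The filter acts on the window only, so it has to be known that \<open>R\<close>
    does not contain the deleted vertices.\<close>
  have nR: "shift m v0 \<notin> R" "shift m v1 \<notin> R"
    using c0 c1 clear_sound(1)[OF R(1), of "[]"] by (auto simp: cone_certificate_def region_def)
  have Leq: "region R m L = region R m W - ?v ` {..<2::nat}"
    unfolding img using nR by (auto simp: region_def L(1) inj_shift)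
  show ?thesis
  proof (rule hex.ind_space_wedge[where k = 2 and v = ?v and M = ?M and C = ?C and L = "region R m L"
        and x = "shift m (0, 1)" and y = "shift m (0, 2)"])
    show "finite (region R m W)" using R(2) by (simp add: region_def)
    show "region R m L \<noteq> {}" using L(2) by (simp add: region_def)
    show "hex_adj (?v i) (?v j)" if "i < 2" "j < 2" "i \<noteq> j" for i j
      using that adj hex.adj_sym by (auto simp: two hex_adj_shift)
    show "\<exists>M' H. hex.folds_to (?M j) M' \<and> M' \<subseteq> H \<and> H \<subseteq> region R m L \<and> contractible_space (hex.ind_space H)"
      if "j < 2" for j
      using s0(8) s1(8) by simp
  qed (use Leq s0(1-7) s1(1-7) s2 Z z in \<open>auto simp: two three\<close>)
qed

lemma region_wedge_one:
  assumes R: "R \<subseteq> left_of b m" "finite R" and L: "L = filter (\<lambda>u. u \<noteq> v0) W" "L \<noteq> []"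
    and c0: "cone_certificate b W L v0 fs0 T0 ps0 gs0 H0 hs0 w0"
    and c1: "folds_onto b L fs1 T1 ps1"
    and Z: "Z0 homeomorphic_space hex.ind_space (hex.add_edges (shift_edges m ps0) (region R m T0))"
      "Z1 homeomorphic_space hex.ind_space (hex.add_edges (shift_edges m ps1) (region R m T1))"
    and z: "z0 \<in> topspace Z0" "z1 \<in> topspace Z1"
  shows "hex.ind_space (region R m W) homotopy_equivalent_space wedge [(Z0, z0), (Z1, z1)]"
proof -
  note s0 = cone_certificate_sound[OF R c0] and s1 = folds_onto_sound[OF R c1]
  let ?C = "\<lambda>j::nat. if j = 0 then hex.add_edges (shift_edges m ps0) (region R m T0)
     else hex.add_edges (shift_edges m ps1) (region R m T1)"
  have nR: "shift m v0 \<notin> R"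
    using c0 clear_sound(1)[OF R(1), of "[]"] by (auto simp: cone_certificate_def region_def)
  have one: "j \<le> Suc 0 \<longleftrightarrow> j = 0 \<or> j = 1" for j :: nat by auto
  have Leq: "region R m L = region R m W - (\<lambda>j. shift m v0) ` {..<1::nat}"
    using nR by (auto simp: region_def L(1) inj_shift)
  show ?thesis
  proof (rule hex.ind_space_wedge[where k = 1 and v = "\<lambda>_. shift m v0" and M = "\<lambda>_. region R m (link W v0)" and C = ?C
        and L = "region R m L" and x = "shift m (0, 1)" and y = "shift m (0, 2)"])
    show "finite (region R m W)" using R(2) by (simp add: region_def)
    show "region R m L \<noteq> {}" using L(2) by (simp add: region_def)
    show "\<exists>M' H. hex.folds_to (region R m (link W v0)) M' \<and> M' \<subseteq> H \<and> H \<subseteq> region R m L \<and> contractible_space (hex.ind_space H)"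
      by (rule s0(8))
  qed (use Leq s0(1-7) s1 Z z in \<open>auto simp: one\<close>)
qed


section \<open>Fold certificates\<close>

definition rows :: "nat \<times> nat \<Rightarrow> nat \<times> nat \<Rightarrow> nat \<times> nat \<Rightarrow> (nat \<times> nat) list" where
  "rows a b c = map (Pair 1) [fst a..<snd a] @ map (Pair 2) [fst b..<snd b] @ map (Pair 3) [fst c..<snd c]"

text \<open>For \<open>n \<le> 4\<close> the window is the whole graph: \<open>R\<close> is empty
  and all bounds are \<open>0\<close>. Here two disjoint edges remain, whose independence complex is
  a 4-cycle.\<close>

lemma Y1_folds: "folds_onto [0, 0, 0, 0] (rows (1, 2) (1, 4) (1, 4))
     [((1, 1), (2, 1)), ((3, 1), (3, 3)), ((1, 1), (2, 3))] [] [((1, 1), (2, 2)), ((3, 1), (3, 2))]"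
  by code_simp

text \<open>The deleted vertices lie in columns \<open>2 * n\<close> and \<open>2 * n + 1\<close>.
  Each of the three certificates ends with four edges, for a link including the one in row
  \<open>0\<close>, and so yields a 3-sphere.\<close>

lemma Y2_cone0:
  "cone_certificate [0, 0, 0, 0] (rows (1, 4) (1, 6) (1, 6)) (filter (\<lambda>u. u \<noteq> (2, 4) \<and> u \<noteq> (2, 5)) (rows (1, 4) (1, 6) (1, 6))) (2, 4)
     [((1, 2), (2, 2)), ((2, 1), (3, 2)), ((3, 3), (3, 5))]
     [] [((0, 1), (0, 2)), ((1, 1), (1, 2)), ((2, 1), (3, 1)), ((3, 3), (3, 4))]
     [((1, 2), (2, 2)), ((3, 5), (3, 3))]
     [(1, 1), (1, 2), (2, 1), (2, 3), (3, 1), (3, 2), (3, 4), (3, 5)]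
     [] (2, 3)"
  by code_simp

lemma Y2_cone1:
  "cone_certificate [0, 0, 0, 0] (rows (1, 4) (1, 6) (1, 6)) (filter (\<lambda>u. u \<noteq> (2, 4) \<and> u \<noteq> (2, 5)) (rows (1, 4) (1, 6) (1, 6))) (2, 5)
     [((3, 4), (2, 3)), ((1, 3), (1, 1)), ((2, 2), (3, 1)), ((3, 4), (3, 2))]
     [] [((0, 1), (0, 2)), ((1, 2), (1, 3)), ((2, 1), (2, 2)), ((3, 3), (3, 4))]
     [((3, 4), (3, 2)), ((3, 1), (2, 2)), ((2, 3), (3, 4))]
     [(1, 1), (1, 2), (1, 3), (2, 1), (2, 3), (3, 1), (3, 3), (3, 5)]
     [] (3, 5)"
  by code_simp

lemma Y2_base:
  "folds_onto [0, 0, 0, 0] (filter (\<lambda>u. u \<noteq> (2, 4) \<and> u \<noteq> (2, 5)) (rows (1, 4) (1, 6) (1, 6)))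
     [((1, 3), (1, 1)), ((3, 5), (3, 3)), ((3, 2), (2, 1))]
     [] [((1, 2), (1, 3)), ((2, 2), (2, 3)), ((3, 1), (3, 2)), ((3, 4), (3, 5))]"
  by code_simp

text \<open>Here deleting the single vertex in column \<open>2 * n + 1\<close> is enough: its
  suspended link and the rest both fold to six edges, that is, to 5-spheres.\<close>

lemma Y3_cone0:
  "cone_certificate [0, 0, 0, 0] (rows (1, 6) (1, 8) (1, 8)) (filter (\<lambda>u. u \<noteq> (2, 7)) (rows (1, 6) (1, 8) (1, 8))) (2, 7)
     [((3, 6), (2, 5)), ((3, 6), (3, 4)), ((1, 5), (1, 3)), ((2, 4), (3, 3)), ((1, 2), (2, 2)), ((2, 1), (3, 2))]
     [] [((0, 1), (0, 2)), ((1, 1), (1, 2)), ((1, 4), (1, 5)), ((2, 1), (3, 1)), ((2, 3), (2, 4)), ((3, 5), (3, 6))]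
     [((3, 6), (2, 5)), ((1, 5), (1, 3)), ((2, 4), (3, 3)), ((3, 4), (3, 6))]
     [(1, 1), (1, 2), (1, 4), (1, 5), (2, 1), (2, 2), (2, 3), (2, 4), (3, 1), (3, 2), (3, 4), (3, 5), (3, 7)]
     [] (3, 7)"
  by code_simp

lemma Y3_base:
  "folds_onto [0, 0, 0, 0] (filter (\<lambda>u. u \<noteq> (2, 7)) (rows (1, 6) (1, 8) (1, 8)))
     [((3, 7), (3, 5)), ((3, 4), (2, 3)), ((3, 4), (3, 2)), ((3, 1), (2, 2)), ((1, 1), (1, 3)), ((2, 4), (2, 6))]
     [] [((1, 1), (1, 2)), ((1, 4), (1, 5)), ((2, 1), (3, 1)), ((2, 4), (2, 5)), ((3, 3), (3, 4)), ((3, 6), (3, 7))]"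
  by code_simp

text \<open>Prepares for dropping \<open>(2, 9)\<close>, after which row \<open>2\<close> ends at
  column \<open>8\<close> and the two vertices of the cone construction are taken from columns
  \<open>6\<close> and \<open>7\<close>.\<close>

lemma Y4_link_contracts:
  "contracts [0, 0, 0, 0] (link (rows (1, 8) (1, 10) (1, 10)) (2, 9))
     [((1, 7), (1, 5)), ((1, 4), (1, 2)), ((3, 8), (2, 7)), ((1, 1), (2, 1)), ((2, 6), (3, 5)), ((3, 1), (3, 3))] (3, 4)"
  by code_simp

lemma Y4_cone0:
  "cone_certificate [0, 0, 0, 0] (rows (1, 8) (1, 9) (1, 10)) (filter (\<lambda>u. u \<noteq> (2, 6) \<and> u \<noteq> (2, 7)) (rows (1, 8) (1, 9) (1, 10))) (2, 6)
     [((2, 8), (1, 6)), ((3, 9), (3, 7)), ((1, 4), (2, 4)), ((3, 6), (3, 4)), ((1, 4), (1, 2)), ((1, 1), (2, 3)), ((3, 3), (3, 1)), ((1, 1), (2, 1))]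
     [] [((0, 1), (0, 2)), ((1, 1), (2, 2)), ((1, 3), (1, 4)), ((1, 7), (2, 8)), ((3, 2), (3, 3)), ((3, 5), (3, 6)), ((3, 8), (3, 9))]
     [((2, 8), (1, 6)), ((1, 4), (1, 2)), ((1, 1), (2, 3)), ((2, 4), (1, 4))]
     [(1, 1), (1, 3), (1, 5), (1, 7), (2, 1), (2, 2), (2, 4), (2, 8), (3, 1), (3, 2), (3, 3), (3, 4), (3, 5), (3, 6), (3, 7), (3, 8), (3, 9)]
     [] (1, 5)"
  by code_simp

text \<open>The only cone certificate in which \<open>H\<close> has no isolated vertex to start with
  and needs folds of its own to isolate \<open>w\<close>.\<close>

lemma Y4_cone1:
  "cone_certificate [0, 0, 0, 0] (rows (1, 8) (1, 9) (1, 10)) (filter (\<lambda>u. u \<noteq> (2, 6) \<and> u \<noteq> (2, 7)) (rows (1, 8) (1, 9) (1, 10))) (2, 7)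
     [((1, 7), (1, 5)), ((1, 4), (2, 4)), ((3, 6), (2, 5)), ((3, 6), (3, 4)), ((1, 4), (1, 2)), ((1, 1), (2, 1)), ((3, 1), (3, 3)), ((1, 1), (2, 3))]
     [] [((0, 1), (0, 2)), ((1, 1), (2, 2)), ((1, 3), (1, 4)), ((1, 6), (1, 7)), ((3, 1), (3, 2)), ((3, 5), (3, 6)), ((3, 8), (3, 9))]
     [((1, 7), (1, 5)), ((3, 6), (2, 5)), ((3, 6), (3, 4)), ((1, 4), (1, 2)), ((1, 1), (2, 3))]
     [(1, 1), (1, 3), (1, 4), (1, 5), (1, 6), (1, 7), (2, 1), (2, 2), (2, 4), (2, 8), (3, 1), (3, 2), (3, 3), (3, 4), (3, 5), (3, 6), (3, 7), (3, 8), (3, 9)]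
     [((2, 8), (1, 6)), ((1, 5), (1, 3))] (2, 4)"
  by code_simp

lemma Y4_base:
  "folds_onto [0, 0, 0, 0] (filter (\<lambda>u. u \<noteq> (2, 6) \<and> u \<noteq> (2, 7)) (rows (1, 8) (1, 9) (1, 10)))
     [((2, 8), (1, 6)), ((3, 9), (3, 7)), ((3, 6), (3, 4)), ((3, 6), (2, 5)), ((1, 5), (1, 3)), ((2, 4), (2, 2)), ((2, 4), (3, 3)), ((2, 1), (3, 2))]
     [] [((1, 1), (1, 2)), ((1, 4), (1, 5)), ((1, 7), (2, 8)), ((2, 1), (3, 1)), ((2, 3), (2, 4)), ((3, 5), (3, 6)), ((3, 8), (3, 9))]"
  by code_simp

text \<open>With \<open>n = m + 4\<close>, the bounds \<open>[0, 2, 3, 2]\<close> are, relative to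
  \<open>2 * m\<close>, the first columns beyond \<open>H2 m\<close>; row \<open>0\<close> is empty.
  The remaining window vertices are those of \<open>H2 (m + 1)\<close> beyond \<open>H2 m\<close>,
  and the four edges, one of them in row \<open>0\<close>, account for four suspensions.\<close>

lemma Y_large_cone0:
  "cone_certificate [0, 2, 3, 2] (rows (2, 8) (3, 10) (2, 10)) (filter (\<lambda>u. u \<noteq> (2, 8) \<and> u \<noteq> (2, 9)) (rows (2, 8) (3, 10) (2, 10))) (2, 8)
     [((1, 6), (2, 6)), ((1, 6), (1, 4)), ((3, 9), (3, 7)), ((3, 6), (3, 4)), ((3, 6), (2, 5))]
     [(1, 2), (1, 3), (2, 3), (2, 4), (3, 2), (3, 3)] [((0, 1), (0, 2)), ((1, 5), (1, 6)), ((3, 5), (3, 6)), ((3, 8), (3, 9))]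
     [((1, 6), (2, 6)), ((3, 9), (3, 7))]
     [(1, 2), (1, 3), (1, 4), (1, 5), (1, 6), (2, 3), (2, 4), (2, 5), (2, 7), (3, 2), (3, 3), (3, 4), (3, 5), (3, 6), (3, 8), (3, 9)]
     [] (2, 7)"
  by code_simp

text \<open>Nothing of the window remains besides six edges, so \<open>H2 m\<close> itself is left,
  suspended six times.\<close>

lemma Y_large_cone1:
  "cone_certificate [0, 2, 3, 2] (rows (2, 8) (3, 10) (2, 10)) (filter (\<lambda>u. u \<noteq> (2, 8) \<and> u \<noteq> (2, 9)) (rows (2, 8) (3, 10) (2, 10))) (2, 9)
     [((1, 7), (1, 5)), ((3, 8), (2, 7)), ((2, 6), (2, 4)), ((1, 4), (1, 2)), ((2, 6), (3, 5)), ((3, 4), (3, 2)), ((3, 8), (3, 6)), ((3, 4), (2, 3))]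
     [] [((0, 1), (0, 2)), ((1, 3), (1, 4)), ((1, 6), (1, 7)), ((2, 5), (2, 6)), ((3, 3), (3, 4)), ((3, 7), (3, 8))]
     [((3, 8), (2, 7)), ((1, 7), (1, 5)), ((2, 6), (3, 5)), ((3, 6), (3, 8))]
     [(1, 2), (1, 3), (1, 4), (1, 6), (1, 7), (2, 3), (2, 4), (2, 5), (2, 6), (3, 2), (3, 3), (3, 4), (3, 6), (3, 7), (3, 9)]
     [] (3, 9)"
  by code_simp

text \<open>All five edges lie in the strip, since the rest is not suspended by the cone
  construction; \<open>(2, 3)\<close>, \<open>(3, 2)\<close> and \<open>(3, 3)\<close> complete
  \<open>H2 m\<close> to \<open>Y (m + 1)\<close>.\<close>

lemma Y_large_base:
  "folds_onto [0, 2, 3, 2] (filter (\<lambda>u. u \<noteq> (2, 8) \<and> u \<noteq> (2, 9)) (rows (2, 8) (3, 10) (2, 10)))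
     [((3, 9), (3, 7)), ((2, 7), (1, 5)), ((1, 4), (2, 4)), ((1, 4), (1, 2)), ((2, 7), (2, 5)), ((3, 6), (3, 4))]
     [(2, 3), (3, 2), (3, 3)] [((1, 3), (1, 4)), ((1, 6), (1, 7)), ((2, 6), (2, 7)), ((3, 5), (3, 6)), ((3, 8), (3, 9))]"
  by code_simp


section \<open>The graphs as windows\<close>

lemma in_region_rows:
  "(i, r) \<in> region R m (rows a b c) \<longleftrightarrow> (i, r) \<in> R \<or>
     i = 1 \<and> 2 * m + fst a \<le> r \<and> r < 2 * m + snd a \<or>
     i = 2 \<and> 2 * m + fst b \<le> r \<and> r < 2 * m + snd b \<or>
     i = 3 \<and> 2 * m + fst c \<le> r \<and> r < 2 * m + snd c"
proof -
  have row: "(i, r) \<in> shift m ` Pair j ` {k..<l} \<longleftrightarrow> i = j \<and> 2 * m + k \<le> r \<and> r < 2 * m + l" for j k l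
  proof
    assume "i = j \<and> 2 * m + k \<le> r \<and> r < 2 * m + l"
    then show "(i, r) \<in> shift m ` Pair j ` {k..<l}"
      by (intro image_eqI[of _ _ "(j, r - 2 * m)"] image_eqI[of _ _ "r - 2 * m"]) (auto simp: shift_def)
  qed (auto simp: shift_def)
  show ?thesis
    unfolding region_def rows_def set_append set_map set_upt image_Un Un_iff row by blast
qed

lemma in_verts_H2:
  "(i, r) \<in> verts (H2 n) \<longleftrightarrow> 1 \<le> r \<and>
     (i = 1 \<and> r \<le> 2 * n + 1 \<or> i = 2 \<and> r \<le> 2 * n + 2 \<or> i = 3 \<and> r \<le> 2 * n + 1)"
  by (auto simp: H2_def)

lemma in_verts_Y:
  assumes "1 \<le> n"
  shows "(i, r) \<in> verts (Y n) \<longleftrightarrow> 1 \<le> r \<and>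
     (i = 1 \<and> r \<le> 2 * n - 1 \<or> i = 2 \<and> r \<le> 2 * n + 1 \<or> i = 3 \<and> r \<le> 2 * n + 1)"
proof -
  have "verts (Y n) = verts (H2 n) - {(1, 2 * n), (1, 2 * n + 1), (2, 2 * n + 2)}"
    by (simp add: Y_def del_verts_def)
  then show ?thesis
    using assms by (cases "i = 1"; cases "i = 2"; cases "i = 3"; simp add: in_verts_H2; linarith?)
qed

lemma verts_Y_region:
  assumes "1 \<le> n"
  shows "verts (Y n) = region {} 0 (rows (1, 2 * n) (1, 2 * n + 2) (1, 2 * n + 2))"
proof (intro set_eqI)
  show "u \<in> verts (Y n) \<longleftrightarrow> u \<in> region {} 0 (rows (1, 2 * n) (1, 2 * n + 2) (1, 2 * n + 2))" for u
    using assms by (cases u) (auto simp: in_region_rows in_verts_Y)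
qed

lemma verts_H2_left_of: "verts (H2 m) \<subseteq> left_of [0, 2, 3, 2] m"
proof
  show "u \<in> left_of [0, 2, 3, 2] m" if "u \<in> verts (H2 m)" for u
    using that by (cases u) (auto simp: in_verts_H2 left_of_def numeral_2_eq_2 numeral_3_eq_3)
qed

text \<open>For \<open>n = m + 4\<close> the graphs \<open>Y n\<close>, \<open>H2 (n - 3)\<close>
  and \<open>Y (n - 3)\<close> all extend \<open>H2 (n - 4)\<close>, so one choice of
  \<open>R\<close> serves all three certificates.\<close>

lemma window_large:
  "verts (Y (m + 4)) = region (verts (H2 m)) m (rows (2, 8) (3, 10) (2, 10))"
  "verts (H2 (m + 1)) = region (verts (H2 m)) m (rows (2, 4) (3, 5) (2, 4))"
  "verts (Y (m + 1)) = region (verts (H2 m)) m (rows (2, 2) (3, 4) (2, 4))"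
proof -
  show "verts (Y (m + 4)) = region (verts (H2 m)) m (rows (2, 8) (3, 10) (2, 10))"
  proof (intro set_eqI)
    show "u \<in> verts (Y (m + 4)) \<longleftrightarrow> u \<in> region (verts (H2 m)) m (rows (2, 8) (3, 10) (2, 10))" for u
      by (cases u) (auto simp: in_region_rows in_verts_Y in_verts_H2)
  qed
  show "verts (H2 (m + 1)) = region (verts (H2 m)) m (rows (2, 4) (3, 5) (2, 4))"
  proof (intro set_eqI)
    show "u \<in> verts (H2 (m + 1)) \<longleftrightarrow> u \<in> region (verts (H2 m)) m (rows (2, 4) (3, 5) (2, 4))" for u
      by (cases u) (auto simp: in_region_rows in_verts_H2)
  qed
  show "verts (Y (m + 1)) = region (verts (H2 m)) m (rows (2, 2) (3, 4) (2, 4))"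
  proof (intro set_eqI)
    show "u \<in> verts (Y (m + 1)) \<longleftrightarrow> u \<in> region (verts (H2 m)) m (rows (2, 2) (3, 4) (2, 4))" for u
      by (cases u) (auto simp: in_region_rows in_verts_Y in_verts_H2)
  qed
qed

text \<open>With \<open>R\<close> and \<open>T\<close> empty only disjoint edges remain, and
  \<open>k + 1\<close> of them span the boundary of a cross-polytope.\<close>

lemma nsphere_folds_onto:
  assumes "folds_onto b W fs [] ps" "length ps = Suc k"
  shows "nsphere k homeomorphic_space hex.ind_space (hex.add_edges (shift_edges 0 ps) (region {} 0 []))"
proof -
  have "hex.separate_edges (shift_edges 0 ps) (region {} 0 [])"
    by (rule folds_onto_sound(2)[OF _ _ assms(1)]) auto
  then show ?thesis
    using hex.nsphere_add_edges[of "shift_edges 0 ps" k] assms(2) by (simp add: region_def)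
qed

lemma iter_suspension_folds_onto:
  assumes "R \<subseteq> left_of b m" "finite R" "folds_onto b W fs T ps" "length ps = k"
    and "A = region R m T" "A \<noteq> {}"
  shows "iter_suspension k (hex.ind_space A) homeomorphic_space
    hex.ind_space (hex.add_edges (shift_edges m ps) (region R m T))"
  using hex.iter_suspension_add_edges[OF _ _ folds_onto_sound(2)[OF assms(1-3)]] assms
  by (simp add: region_def)

lemma cone_certificate_folds_onto:
  "cone_certificate b W L v fs T ps gs H hs w \<Longrightarrow> folds_onto b ((0, 1) # (0, 2) # link W v) fs T ps"
  by (simp add: cone_certificate_def)

section \<open>The five cases\<close>

lemma Ind_Y_1: "realization (Ind (Y 1)) homotopy_equivalent_space nsphere 1"
proof -
  let ?A = "region {} 0 (rows (1, 2) (1, 4) (1, 4))"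
  have Y: "verts (Y 1) = ?A" using verts_Y_region[of 1] by simp
  have "hex.ind_space ?A homotopy_equivalent_space
      hex.ind_space (hex.add_edges (shift_edges 0 [((1, 1), (2, 2)), ((3, 1), (3, 2))]) (region {} 0 []))"
    by (rule hex.homotopy_equivalent_folds_to[OF folds_onto_sound(1)[OF _ _ Y1_folds]])
       (auto simp: region_def)
  also have "\<dots> homotopy_equivalent_space nsphere 1"
    by (rule homeomorphic_imp_homotopy_equivalent_space[OF homeomorphic_space_sym[THEN iffD1]])
       (rule nsphere_folds_onto[OF Y1_folds], simp)
  finally show ?thesis unfolding Ind_Y Y .
qed

lemma Ind_Y_2:
  assumes "a \<in> topspace (nsphere 3)" "b \<in> topspace (nsphere 3)" "c \<in> topspace (nsphere 3)"
  shows "realization (Ind (Y 2)) homotopy_equivalent_space wedge [(nsphere 3, a), (nsphere 3, b), (nsphere 3, c)]"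
proof -
  have Y: "verts (Y 2) = region {} 0 (rows (1, 4) (1, 6) (1, 6))" using verts_Y_region[of 2] by simp
  show ?thesis
    unfolding Ind_Y Y
    by (rule region_wedge_two[OF _ _ refl _ _ Y2_cone0 Y2_cone1 Y2_base
          nsphere_folds_onto[OF cone_certificate_folds_onto[OF Y2_cone0]]
          nsphere_folds_onto[OF cone_certificate_folds_onto[OF Y2_cone1]] nsphere_folds_onto[OF Y2_base] assms])
       (simp_all add: hex_adj_def rows_def)
qed

lemma Ind_Y_3:
  assumes "a \<in> topspace (nsphere 5)" "b \<in> topspace (nsphere 5)"
  shows "realization (Ind (Y 3)) homotopy_equivalent_space wedge [(nsphere 5, a), (nsphere 5, b)]"
proof -
  have Y: "verts (Y 3) = region {} 0 (rows (1, 6) (1, 8) (1, 8))" using verts_Y_region[of 3] by simp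
  show ?thesis
    unfolding Ind_Y Y
    by (rule region_wedge_one[OF _ _ refl _ Y3_cone0 Y3_base
          nsphere_folds_onto[OF cone_certificate_folds_onto[OF Y3_cone0]] nsphere_folds_onto[OF Y3_base] assms])
       (simp_all add: hex_adj_def rows_def)
qed

lemma Ind_Y_4:
  assumes "a \<in> topspace (nsphere 6)" "b \<in> topspace (nsphere 6)" "c \<in> topspace (nsphere 6)"
  shows "realization (Ind (Y 4)) homotopy_equivalent_space wedge [(nsphere 6, a), (nsphere 6, b), (nsphere 6, c)]"
proof -
  let ?W = "rows (1, 8) (1, 10) (1, 10)"
  have Y: "verts (Y 4) = region {} 0 ?W" using verts_Y_region[of 4] by simp
  have R: "{} \<subseteq> left_of [0, 0, 0, 0] 0" by simp
  have v: "clear [0, 0, 0, 0] [] (2, 9)" by (simp add: clear_def nbrs_def)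
  obtain B where B: "hex.folds_to (region {} 0 (link ?W (2, 9))) B" "shift 0 (3, 4) \<in> B"
    "\<And>u. u \<in> B \<Longrightarrow> \<not> hex_adj (shift 0 (3, 4)) u"
    using contracts_sound[OF R Y4_link_contracts] by metis
  have "hex.ind_space (region {} 0 ?W) homotopy_equivalent_space hex.ind_space (region {} 0 ?W - {shift 0 (2, 9)})"
  proof (rule hex.homotopy_equivalent_delete_vertex[OF _ _ _ B(2,3)])
    show "hex.folds_to {u \<in> region {} 0 ?W. u \<noteq> shift 0 (2, 9) \<and> \<not> hex_adj (shift 0 (2, 9)) u} B"
      unfolding link_region[OF R v] by (rule B(1))
  qed (auto simp: region_def rows_def)
  also have "region {} 0 ?W - {shift 0 (2, 9)} = region {} 0 (rows (1, 8) (1, 9) (1, 10))"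
  proof (intro set_eqI)
    show "u \<in> region {} 0 ?W - {shift 0 (2, 9)} \<longleftrightarrow> u \<in> region {} 0 (rows (1, 8) (1, 9) (1, 10))" for u
      by (cases u) (auto simp: in_region_rows shift_def)
  qed
  also have "hex.ind_space (region {} 0 (rows (1, 8) (1, 9) (1, 10))) homotopy_equivalent_space
      wedge [(nsphere 6, a), (nsphere 6, b), (nsphere 6, c)]"
    by (rule region_wedge_two[OF _ _ refl _ _ Y4_cone0 Y4_cone1 Y4_base
          nsphere_folds_onto[OF cone_certificate_folds_onto[OF Y4_cone0]]
          nsphere_folds_onto[OF cone_certificate_folds_onto[OF Y4_cone1]] nsphere_folds_onto[OF Y4_base] assms])
       (simp_all add: hex_adj_def rows_def)
  finally show ?thesis unfolding Ind_Y Y .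
qed

lemma Ind_Y_large:
  assumes "a \<in> topspace (iter_suspension 4 (realization (Ind (H2 (m + 1)))))"
    and "b \<in> topspace (iter_suspension 6 (realization (Ind (H2 m))))"
    and "c \<in> topspace (iter_suspension 5 (realization (Ind (Y (m + 1)))))"
  shows "realization (Ind (Y (m + 4))) homotopy_equivalent_space
    wedge [(iter_suspension 4 (realization (Ind (H2 (m + 1)))), a),
           (iter_suspension 6 (realization (Ind (H2 m))), b),
           (iter_suspension 5 (realization (Ind (Y (m + 1)))), c)]"
proof -
  let ?R = "verts (H2 m)"
  note R = verts_H2_left_of[of m] finite_verts_H2[of m]
  have T: "verts (H2 (m + 1)) = region ?R m [(1, 2), (1, 3), (2, 3), (2, 4), (3, 2), (3, 3)]"
    "?R = region ?R m []" "verts (Y (m + 1)) = region ?R m [(2, 3), (3, 2), (3, 3)]"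
  proof -
    have "rows (2, 4) (3, 5) (2, 4) = [(1, 2), (1, 3), (2, 3), (2, 4), (3, 2), (3, 3)]"
      "rows (2, 2) (3, 4) (2, 4) = [(2, 3), (3, 2), (3, 3)]"
      by code_simp+
    then show "verts (H2 (m + 1)) = region ?R m [(1, 2), (1, 3), (2, 3), (2, 4), (3, 2), (3, 3)]"
      "verts (Y (m + 1)) = region ?R m [(2, 3), (3, 2), (3, 3)]"
      by (simp_all only: window_large(2,3))
  qed (simp add: region_def)
  have ne: "verts (H2 (m + 1)) \<noteq> {}" "?R \<noteq> {}" "verts (Y (m + 1)) \<noteq> {}"
    using in_verts_H2[of 1 1] in_verts_Y[of "m + 1" 1 1] by auto
  show ?thesis
    unfolding Ind_Y Ind_H2 window_large(1)
    by (rule region_wedge_two[OF R refl _ _ Y_large_cone0 Y_large_cone1 Y_large_base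
          iter_suspension_folds_onto[OF R cone_certificate_folds_onto[OF Y_large_cone0] _ T(1) ne(1)]
          iter_suspension_folds_onto[OF R cone_certificate_folds_onto[OF Y_large_cone1] _ T(2) ne(2)]
          iter_suspension_folds_onto[OF R Y_large_base _ T(3) ne(3)] assms[unfolded Ind_Y Ind_H2]])
       (simp_all add: hex_adj_def rows_def)
qed

theorem theorem4p3:
  fixes n :: nat
  assumes "n \<ge> 1"
  shows
    "(n = 1 \<longrightarrow> realization (Ind (Y n)) homotopy_equivalent_space nsphere 1) \<and>
     (n = 2 \<longrightarrow>
        (\<forall>a \<in> topspace (nsphere 3). \<forall>b \<in> topspace (nsphere 3). \<forall>c \<in> topspace (nsphere 3).
           realization (Ind (Y n)) homotopy_equivalent_space
             wedge [(nsphere 3, a), (nsphere 3, b), (nsphere 3, c)])) \<and>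
     (n = 3 \<longrightarrow>
        (\<forall>a \<in> topspace (nsphere 5). \<forall>b \<in> topspace (nsphere 5).
           realization (Ind (Y n)) homotopy_equivalent_space
             wedge [(nsphere 5, a), (nsphere 5, b)])) \<and>
     (n = 4 \<longrightarrow>
        (\<forall>a \<in> topspace (nsphere 6). \<forall>b \<in> topspace (nsphere 6). \<forall>c \<in> topspace (nsphere 6).
           realization (Ind (Y n)) homotopy_equivalent_space
             wedge [(nsphere 6, a), (nsphere 6, b), (nsphere 6, c)])) \<and>
     (n \<ge> 5 \<longrightarrow>
        (\<forall>a \<in> topspace (iter_suspension 4 (realization (Ind (H2 (n - 3))))).
         \<forall>b \<in> topspace (iter_suspension 6 (realization (Ind (H2 (n - 4))))).
         \<forall>c \<in> topspace (iter_suspension 5 (realization (Ind (Y (n - 3))))).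
           realization (Ind (Y n)) homotopy_equivalent_space
             wedge [(iter_suspension 4 (realization (Ind (H2 (n - 3)))), a),
                    (iter_suspension 6 (realization (Ind (H2 (n - 4)))), b),
                    (iter_suspension 5 (realization (Ind (Y (n - 3)))), c)]))"
proof (intro conjI impI ballI)
  fix a b c
  assume n: "5 \<le> n" and "a \<in> topspace (iter_suspension 4 (realization (Ind (H2 (n - 3)))))"
    "b \<in> topspace (iter_suspension 6 (realization (Ind (H2 (n - 4)))))"
    "c \<in> topspace (iter_suspension 5 (realization (Ind (Y (n - 3)))))"
  moreover have "n - 4 + 1 = n - 3" "n - 4 + 4 = n" using n by auto
  ultimately show "realization (Ind (Y n)) homotopy_equivalent_space
             wedge [(iter_suspension 4 (realization (Ind (H2 (n - 3)))), a),
                    (iter_suspension 6 (realization (Ind (H2 (n - 4)))), b),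
                    (iter_suspension 5 (realization (Ind (Y (n - 3)))), c)]"
    using Ind_Y_large[of a "n - 4" b c] by simp
qed (use Ind_Y_1 Ind_Y_2 Ind_Y_3 Ind_Y_4 in \<open>simp_all\<close>)

end
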